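(* Let $\mathcal I$ be a non-empty (finite or countable) family of pairwise disjoint proper open arcs of the unit circle $\mathbb S^1\subset\mathbb R^2$, and let $C(\mathcal I)\subset\mathbb H$ be the associated surface. Then: (1) $C(\mathcal I)$ is a minimal cone; (2) $C(\mathcal I)$ is of class $C^1$ if and only if $\mathcal I$ is finite and the closure of $\bigcup_{I\in\mathcal I}I$ is $\mathbb S^1$.
   Context: Heisenberg group: $\mathbb H=\mathbb R^3$ with product $(x,y,t)*(x',y',t')=(x+x',y+y',t+t'+(x'y-xy'))$ and dilations $\delta_\lambda(x,y,t)=(\lambda x,\lambda y,\lambda^2t)$, $\lambda>0$. Left-invariant fields: $X=\partial_x+y\,\partial_t$, $Y=\partial_y-x\,\partial_t$, $T=\partial_t$. A horizontal vector field is $V=v_1X+v_2Y$, with $|V|=(v_1^2+v_2^2)^{1/2}$ and $\operatorname{div}V=Xv_1+Yv_2$. A cone is a set invariant under all $\delta_\lambda$, $\lambda>0$. Perimeter: for $E\subset\mathbb H$ measurable and $\Omega\subset\mathbb H$ open, $P(E;\Omega)=\sup\{\int_E\operatorname{div}(V)\,d\mathcal L^3: V \text{ a } C^1 \text{ horizontal vector field with compact support in }\Omega,\ |V|\le1\}$. $E$ has locally finite perimeter if $P(E;\Omega)<\infty$ for every bounded open $\Omega$; then $|\partial E|$ denotes the Radon measure with $|\partial E|(\Omega)=P(E;\Omega)$ for open $\Omega$. $E$ is a perimeter minimizer in $\Omega$ if $P(E;\Omega)\le P(F;\Omega)$ for every $F$ of locally finite perimeter whose symmetric difference with $E$ is relatively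 compact in $\Omega$; it is a local perimeter minimizer if this holds in every bounded open set $\Omega$. A surface $S\subset\mathbb H$ is minimal (area-minimizing) if there is a local perimeter minimizer $E$ of locally finite perimeter such that $S$ is the closure of the reduced boundary of $E$, i.e. $S$ is the support of $|\partial E|$. A minimal cone is a minimal surface that is a cone. The $t$-graph of $u:\mathbb R^2\to\mathbb R$ is $\{(x,y,u(x,y))\}$, regarded as the boundary of the subgraph $\{t\le u(x,y)\}$. A surface is of class $C^k$ if it is an embedded two-dimensional $C^k$ submanifold of $\mathbb R^3$. The surfaces $C(\mathcal I)$: for $A\subset\mathbb S^1$, $0\# A=\{rv: r\ge0,\ v\in A\}$. A proper open arc $I$ is a non-empty open arc of length $2\alpha$ with $\alpha\in(0,\pi)$. If $I$ is centred at $(1,0)$, i.e. $I=\{(\cos\theta,\sin\theta):|\theta|<\alpha\}$, set $u_I(x,y)=y(|y|\cot\alpha-x)$ for $(x,y)\in 0\# I$ and $u_I=0$ elsewhere on $\mathbb R^2$. If $I$ is centred at $(\cos\theta_0,\sin\theta_0)$, then $u_I=u_{I'}\circ R_{-\theta_0}$, where $R_{-\theta_0}$ is the rotation of the plane by $-\theta_0$ and $I'=R_{-\theta_0}I$. (Geometrically, the $t$-graph of $u_I$ over $0\# I$ is the union of the horizontal lifts starting at $0$ of the bisectrix $L$ of $I$ and of the half-lines starting on $L$ and parallel to the two boundary half-lines of $0\# I$; outside $0\# I$ it is the union of half-lines from $0$ in $\{t=0\}$.) For a family $\mathcal I$ of pairwise disjoint proper open arcs, $u_{\mathcal I}=\sum_{I\in\mathcal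 I}u_I$ (at most one term is non-zero at each point), and $C(\mathcal I)$ is the $t$-graph of $u_{\mathcal I}$. *)

theory Defs
  imports "HOL-Analysis.Analysis"
begin

type_synonym plane = "real \<times> real"
type_synonym heis = "real \<times> real \<times> real"

definition dilation :: "real \<Rightarrow> heis \<Rightarrow> heis" where
  "dilation l = (\<lambda>(x, y, t). (l * x, l * y, l\<^sup>2 * t))"

definition heis_cone :: "heis set \<Rightarrow> bool" where
  "heis_cone S \<longleftrightarrow> (\<forall>l>0. dilation l ` S = S)"

(* Meant for open U. Continuity of f' is with respect to the operator norm. *)
definition C1_on :: "'a::real_normed_vector set \<Rightarrow> ('a \<Rightarrow> 'b::real_normed_vector) \<Rightarrow> bool" where
  "C1_on U f \<longleftrightarrow> (\<exists>f' :: 'a \<Rightarrow> 'a \<Rightarrow>\<^sub>L 'b.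
     (\<forall>p\<in>U. (f has_derivative blinfun_apply (f' p)) (at p)) \<and> continuous_on U f')"

(* The fields X = d/dx + y d/dt and Y = d/dy - x d/dt, acting on differentiable functions.
   They are left-invariant for the group law
   (x, y, t) * (x', y', t') = (x + x', y + y', t + t' + (x' y - x y')). *)
definition X_deriv :: "(heis \<Rightarrow> real) \<Rightarrow> heis \<Rightarrow> real" where
  "X_deriv f = (\<lambda>(x, y, t). frechet_derivative f (at (x, y, t)) (1, 0, y))"

definition Y_deriv :: "(heis \<Rightarrow> real) \<Rightarrow> heis \<Rightarrow> real" where
  "Y_deriv f = (\<lambda>(x, y, t). frechet_derivative f (at (x, y, t)) (0, 1, - x))"

(* The horizontal field v1 X + v2 Y is encoded by its pair of coefficients p \<mapsto> (v1 p, v2 p);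
   the product norm on pairs is then |V| = sqrt (v1^2 + v2^2). *)
definition hdiv :: "(heis \<Rightarrow> plane) \<Rightarrow> heis \<Rightarrow> real" where
  "hdiv V p = X_deriv (\<lambda>q. fst (V q)) p + Y_deriv (\<lambda>q. snd (V q)) p"

definition test_fields :: "heis set \<Rightarrow> (heis \<Rightarrow> plane) set" where
  "test_fields \<Omega> = {V. C1_on UNIV V \<and>
     compact (closure {p. V p \<noteq> 0}) \<and> closure {p. V p \<noteq> 0} \<subseteq> \<Omega> \<and>
     (\<forall>p. norm (V p) \<le> 1)}"

definition perimeter :: "heis set \<Rightarrow> heis set \<Rightarrow> ereal" where
  "perimeter E \<Omega> = (SUP V\<in>test_fields \<Omega>. ereal (LINT p:E|lebesgue. hdiv V p))"

definition locally_finite_perimeter :: "heis set \<Rightarrow> bool" where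
  "locally_finite_perimeter E \<longleftrightarrow> E \<in> sets lebesgue \<and>
     (\<forall>\<Omega>. open \<Omega> \<and> bounded \<Omega> \<longrightarrow> perimeter E \<Omega> < \<infinity>)"

definition perimeter_minimizer :: "heis set \<Rightarrow> heis set \<Rightarrow> bool" where
  "perimeter_minimizer E \<Omega> \<longleftrightarrow>
     (\<forall>F. locally_finite_perimeter F \<and>
          compact (closure (sym_diff E F)) \<and> closure (sym_diff E F) \<subseteq> \<Omega>
        \<longrightarrow> perimeter E \<Omega> \<le> perimeter F \<Omega>)"

definition local_perimeter_minimizer :: "heis set \<Rightarrow> bool" where
  "local_perimeter_minimizer E \<longleftrightarrow>
     (\<forall>\<Omega>. open \<Omega> \<and> bounded \<Omega> \<longrightarrow> perimeter_minimizer E \<Omega>)"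

(* The support of the perimeter measure |dE|, i.e. the closure of the reduced boundary of E:
   the points all of whose open neighbourhoods have positive |dE|-measure. Only open sets
   matter here, and on those |dE| is given by the perimeter. *)
definition perimeter_support :: "heis set \<Rightarrow> heis set" where
  "perimeter_support E = {p. \<forall>U. open U \<and> p \<in> U \<longrightarrow> perimeter E U > 0}"

definition minimal_surface :: "heis set \<Rightarrow> bool" where
  "minimal_surface S \<longleftrightarrow>
     (\<exists>E. locally_finite_perimeter E \<and> local_perimeter_minimizer E \<and> S = perimeter_support E)"

definition minimal_cone :: "heis set \<Rightarrow> bool" where
  "minimal_cone S \<longleftrightarrow> minimal_surface S \<and> heis_cone S"

(* Embedded two-dimensional C^1 submanifold of R^3: near each of its points, S is mapped to the
   plane {t = 0} by a C^1 diffeomorphism between open subsets of R^3. *)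
definition C1_surface :: "heis set \<Rightarrow> bool" where
  "C1_surface S \<longleftrightarrow>
     (\<forall>p\<in>S. \<exists>U V (\<phi> :: heis \<Rightarrow> heis) \<psi>. open U \<and> p \<in> U \<and> open V \<and>
        homeomorphism U V \<phi> \<psi> \<and> C1_on U \<phi> \<and> C1_on V \<psi> \<and>
        \<phi> ` (S \<inter> U) = {q \<in> V. snd (snd q) = 0})"

(* The open arc of length 2 \<alpha> centred at (cos \<theta>0, sin \<theta>0). *)
definition circle_arc :: "real \<Rightarrow> real \<Rightarrow> plane set" where
  "circle_arc \<theta>0 \<alpha> = {(cos \<theta>, sin \<theta>) | \<theta>. \<bar>\<theta> - \<theta>0\<bar> < \<alpha>}"

definition proper_open_arc :: "plane set \<Rightarrow> bool" where
  "proper_open_arc I \<longleftrightarrow> (\<exists>\<theta>0 \<alpha>. 0 < \<alpha> \<and> \<alpha> < pi \<and> I = circle_arc \<theta>0 \<alpha>)"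

(* For a proper open arc the half-angle is unique and the central angle is unique modulo 2 pi;
   only the rotation by the central angle is used below, so its choice is irrelevant. *)
definition arc_half_angle :: "plane set \<Rightarrow> real" where
  "arc_half_angle I = (THE \<alpha>. 0 < \<alpha> \<and> \<alpha> < pi \<and> (\<exists>\<theta>0. I = circle_arc \<theta>0 \<alpha>))"

definition arc_centre :: "plane set \<Rightarrow> real" where
  "arc_centre I = (SOME \<theta>0. I = circle_arc \<theta>0 (arc_half_angle I))"

definition rotation :: "real \<Rightarrow> plane \<Rightarrow> plane" where
  "rotation \<theta> = (\<lambda>(x, y). (cos \<theta> * x - sin \<theta> * y, sin \<theta> * x + cos \<theta> * y))"

(* The set 0 # A. *)
definition ray_cone :: "plane set \<Rightarrow> plane set" where
  "ray_cone A = {r *\<^sub>R v | r v. r \<ge> 0 \<and> v \<in> A}"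

definition u_centred :: "real \<Rightarrow> plane \<Rightarrow> real" where
  "u_centred \<alpha> = (\<lambda>(x, y).
     if (x, y) \<in> ray_cone (circle_arc 0 \<alpha>) then y * (\<bar>y\<bar> * cot \<alpha> - x) else 0)"

definition u_arc :: "plane set \<Rightarrow> plane \<Rightarrow> real" where
  "u_arc I = u_centred (arc_half_angle I) \<circ> rotation (- arc_centre I)"

(* For pairwise disjoint arcs at most one summand is non-zero at each z. *)
definition u_family :: "plane set set \<Rightarrow> plane \<Rightarrow> real" where
  "u_family \<I> z = (\<Sum>\<^sub>\<infinity>I\<in>\<I>. u_arc I z)"

definition t_graph :: "(plane \<Rightarrow> real) \<Rightarrow> heis set" where
  "t_graph u = {(x, y, u (x, y)) | x y. True}"

definition C_surface :: "plane set set \<Rightarrow> heis set" where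
  "C_surface \<I> = t_graph (u_family \<I>)"

end

theory Submission
  imports Defs
begin

text \<open>
  Let \<open>E\<close> be the subgraph of \<open>u = u_family \<I>\<close>, and let \<open>N = (y - u\<^sub>x, - x - u\<^sub>y)\<close> be its outer horizontal normal. For a test
  field \<open>V\<close> the divergence theorem gives \<open>\<integral>\<^sub>E div V = \<integral> V (z, u z) \<bullet> N z dz\<close> (\<open>flux_family\<close>). The sum over \<open>\<I>\<close> is locally
  Lipschitz with piecewise \<open>C\<^sup>1\<close> terms, and the formula passes from finite subfamilies to \<open>\<I>\<close> by dominated convergence.

  Minimality is a calibration argument. Let \<open>K\<close> be the complement of the arcs in the unit circle and
  \<open>w z = max {z \<bullet> k | k \<in> K}\<close> its support function. Inside the sector over an arc the maximum is attained at the
  nearest endpoint of the arc, and on the remaining rays at the direction of \<open>z\<close>. A computation with the explicit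
  formula for \<open>u\<close> shows that \<open>N\<close> is a nonnegative multiple of \<open>(w\<^sub>y, - w\<^sub>x)\<close>, a unit field that depends only on
  \<open>(x, y)\<close> and is divergence-free, being a rotated gradient (\<open>exposed_direction\<close>). Since \<open>w\<close> is merely Lipschitz, it is
  replaced by the smooth functions \<open>ln (\<Sum>\<^sub>j exp (\<beta> z \<bullet> k\<^sub>j)) / \<beta>\<close> where the \<open>k\<^sub>j\<close> are the first terms of
  a dense sequence in \<open>K\<close>. Their rotated gradients
  are divergence-free, have length at most 1, and pair with \<open>N\<close> to \<open>\<bar>N\<bar>\<close> in the limit (\<open>calibration\<close>). A
  competitor \<open>F\<close> is tested against \<open>(1 - \<eta>) V + \<eta> \<nu>\<close>, where the cutoff \<open>\<eta>\<close> is 1 on the symmetric difference; this field has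
  the same integral over \<open>F\<close> as over \<open>E\<close> and at least the flux of \<open>V\<close> (\<open>competitor_flux_le\<close>). The same inequality
  with \<open>F = E\<close> shows that the perimeter charges every neighbourhood of every point of the graph.

  For the second part, a \<open>C\<^sup>1\<close> surface that is a locally Lipschitz graph is the graph of a \<open>C\<^sup>1\<close> function
  (\<open>C1_surface_graphD\<close>). The angular derivative of \<open>u\<close> at the unit circle is \<open>1\<close> at the endpoints of the arcs, \<open>- 1\<close> at their
  centres and \<open>0\<close> in the interior of \<open>K\<close>. Continuity therefore excludes both an accumulation of arcs and a gap.
  Conversely, adjacent arcs match because the gradient on a boundary half-line does not depend on the arc.
\<close>

section \<open>Continuously differentiable maps and cutoff functions\<close>

lemma C1_onI:
  fixes f :: "'a::euclidean_space \<Rightarrow> 'b::real_normed_vector"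
  assumes der: "\<And>p. p \<in> U \<Longrightarrow> (f has_derivative f' p) (at p)"
    and cont: "\<And>h. continuous_on U (\<lambda>p. f' p h)"
  shows "C1_on U f"
proof -
  define F where "F p = Blinfun (f' p)" for p
  have F: "blinfun_apply (F p) = f' p" if "p \<in> U" for p
    unfolding F_def using der[OF that]
    by (intro bounded_linear_Blinfun_apply) (rule has_derivative_bounded_linear)
  have "continuous_on U (\<lambda>p. blinfun_apply (F p) h)" for h
    using cont[of h] by (rule continuous_on_eq) (simp add: F)
  then have "continuous_on U F"
    by (intro continuous_on_blinfun_componentwise)
  then show ?thesis
    unfolding C1_on_def using der F by (intro exI[of _ F]) auto
qed

lemma C1_on_continuous:
  assumes "C1_on U f"
  shows "continuous_on U f"
  using assms unfolding C1_on_def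
  by (meson continuous_at_imp_continuous_on has_derivative_continuous)

lemma hdiv_eq:
  assumes "(V has_derivative V') (at p)"
  shows "hdiv V p = fst (V' (1, 0, fst (snd p))) + snd (V' (0, 1, - fst p))"
proof -
  obtain x y t where p: "p = (x, y, t)"
    by (metis surj_pair)
  have "frechet_derivative (\<lambda>q. fst (V q)) (at p) = (\<lambda>h. fst (V' h))"
    using has_derivative_fst[OF assms] by (simp add: frechet_derivative_at[symmetric])
  moreover have "frechet_derivative (\<lambda>q. snd (V q)) (at p) = (\<lambda>h. snd (V' h))"
    using has_derivative_snd[OF assms] by (simp add: frechet_derivative_at[symmetric])
  ultimately show ?thesis
    by (simp add: hdiv_def X_deriv_def Y_deriv_def p)
qed

text \<open>The squared positive part is the simplest profile that is \<open>C\<^sup>1\<close> and vanishes on a half-line; all cutoffs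
  below are built from it.\<close>

definition sqpos :: "real \<Rightarrow> real" where
  "sqpos s = (max 0 s)\<^sup>2"

lemma sqpos_has_real_derivative:
  "(sqpos has_real_derivative 2 * max 0 s) (at s)"
proof -
  consider "s > 0" | "s < 0" | "s = 0" by linarith
  then show ?thesis
  proof cases
    case 1
    have "((\<lambda>s. s\<^sup>2) has_real_derivative 2 * max 0 s) (at s)"
      using 1 by (auto intro!: derivative_eq_intros)
    then show ?thesis
      by (rule has_field_derivative_transform_within_open[where S="{0<..}"])
        (use 1 in \<open>auto simp: sqpos_def\<close>)
  next
    case 2
    have "((\<lambda>s. 0) has_real_derivative 2 * max 0 s) (at s)"
      using 2 by auto
    then show ?thesis
      by (rule has_field_derivative_transform_within_open[where S="{..<0}"])
        (use 2 in \<open>auto simp: sqpos_def\<close>)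
  next
    case 3
    have "(\<lambda>h. sqpos h / h) \<midarrow>0\<rightarrow> 0"
    proof (rule Lim_null_comparison)
      show "\<forall>\<^sub>F h in at 0. norm (sqpos h / h) \<le> \<bar>h\<bar>"
        by (intro always_eventually allI) (auto simp: sqpos_def power2_eq_square max_def)
      show "((\<lambda>h::real. \<bar>h\<bar>) \<longlongrightarrow> 0) (at 0)"
        by (intro tendsto_eq_intros) auto
    qed
    then show ?thesis
      using 3 by (simp add: DERIV_def sqpos_def)
  qed
qed

text \<open>Bumps \<open>(r\<^sup>2 - \<bar>p - c\<bar>\<^sup>2)\<^sub>+\<^sup>2\<close> on finitely many balls covering \<open>C\<close> add up to a function \<open>S \<ge> \<delta> > 0\<close> on \<open>C\<close>;
  the profile \<open>s \<mapsto> 1 - (1 - s / \<delta>)\<^sub>+\<^sup>2\<close> truncates it at height 1 without losing differentiability.\<close>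

lemma C1_cutoff:
  fixes \<Omega> :: "'a::euclidean_space set"
  assumes C: "compact C" and \<Omega>: "open \<Omega>" and sub: "C \<subseteq> \<Omega>"
  obtains \<eta> :: "'a \<Rightarrow> real"
  where "C1_on UNIV \<eta>" "\<And>p. 0 \<le> \<eta> p" "\<And>p. \<eta> p \<le> 1" "\<And>p. p \<in> C \<Longrightarrow> \<eta> p = 1"
    "compact (closure {p. \<eta> p \<noteq> 0})" "closure {p. \<eta> p \<noteq> 0} \<subseteq> \<Omega>"
proof -
  have "\<exists>r>0. cball c r \<subseteq> \<Omega>" if "c \<in> C" for c
    using \<Omega> sub that by (meson open_contains_cball subsetD)
  then obtain r where r: "\<And>c. c \<in> C \<Longrightarrow> r c > 0 \<and> cball c (r c) \<subseteq> \<Omega>"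
    by metis
  obtain T where T: "T \<subseteq> C" "finite T" "C \<subseteq> (\<Union>c\<in>T. ball c (r c))"
    using compactE_image[OF C, of C "\<lambda>c. ball c (r c)"] r
    by (smt (verit, best) UN_I centre_in_ball open_ball subsetI)
  define b where "b c p = sqpos ((r c)\<^sup>2 - (p - c) \<bullet> (p - c))" for c p :: 'a
  define S where "S p = (\<Sum>c\<in>T. b c p)" for p
  have b_pos: "b c p > 0 \<longleftrightarrow> p \<in> ball c (r c)" if "c \<in> T" for c p
  proof -
    have "(p - c) \<bullet> (p - c) < (r c)\<^sup>2 \<longleftrightarrow> norm (p - c) < r c"
      using r[of c] T that by (metis dot_square_norm norm_ge_zero order_less_le power2_less_imp_less power_strict_mono subsetD zero_less_numeral)
    then show ?thesis
      by (auto simp: b_def sqpos_def dist_norm norm_minus_commute)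
  qed
  have b_nonneg: "b c p \<ge> 0" for c p
    by (simp add: b_def sqpos_def)
  define b' where "b' c p h = 2 * max 0 ((r c)\<^sup>2 - (p - c) \<bullet> (p - c)) * (- 2 * ((p - c) \<bullet> h))" for c p h :: 'a
  have b': "(b c has_derivative b' c p) (at p)" for c p
  proof -
    have g: "((\<lambda>p. (r c)\<^sup>2 - (p - c) \<bullet> (p - c)) has_derivative (\<lambda>h. - 2 * ((p - c) \<bullet> h))) (at p)"
      by (auto intro!: derivative_eq_intros simp: inner_commute)
    show ?thesis
      using has_derivative_compose[OF g
          sqpos_has_real_derivative[unfolded has_field_derivative_def]]
      by (simp add: b_def[abs_def] b'_def[abs_def])
  qed
  have S': "(S has_derivative (\<lambda>h. \<Sum>c\<in>T. b' c p h)) (at p)" for p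
    unfolding S_def[abs_def] by (intro has_derivative_sum b')
  have contS: "continuous_on UNIV S"
    using S' by (meson continuous_at_imp_continuous_on has_derivative_continuous)
  have S_nonneg: "S p \<ge> 0" for p
    by (auto simp: S_def intro!: sum_nonneg b_nonneg)
  have S_pos: "S p > 0 \<longleftrightarrow> p \<in> (\<Union>c\<in>T. ball c (r c))" for p
  proof -
    have "S p > 0 \<longleftrightarrow> (\<exists>c\<in>T. b c p > 0)"
      using sum_nonneg_eq_0_iff[OF \<open>finite T\<close>, of "\<lambda>c. b c p"] S_nonneg[of p] b_nonneg
      unfolding S_def by (metis less_eq_real_def less_numeral_extra(3))
    then show ?thesis using b_pos by auto
  qed
  obtain \<delta> where \<delta>: "\<delta> > 0" "\<And>p. p \<in> C \<Longrightarrow> S p \<ge> \<delta>"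
  proof (cases "C = {}")
    case False
    obtain q where "q \<in> C" "\<And>p. p \<in> C \<Longrightarrow> S q \<le> S p"
      using continuous_attains_inf[OF C False continuous_on_subset[OF contS]] by auto
    moreover have "S q > 0"
      using \<open>q \<in> C\<close> T(3) unfolding S_pos by blast
    ultimately show ?thesis
      using that[of "S q"] by blast
  qed (use that[of 1] in auto)
  then have "\<delta> \<noteq> 0" by simp
  define \<eta> where "\<eta> p = 1 - sqpos (1 - S p / \<delta>)" for p
  define \<eta>' where "\<eta>' p h = 2 * max 0 (1 - S p / \<delta>) * ((\<Sum>c\<in>T. b' c p h) / \<delta>)" for p h
  have \<eta>': "(\<eta> has_derivative \<eta>' p) (at p)" for p
  proof -
    have g: "((\<lambda>p. 1 - S p / \<delta>) has_derivative (\<lambda>h. - ((\<Sum>c\<in>T. b' c p h) / \<delta>))) (at p)"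
      using \<open>\<delta> \<noteq> 0\<close> by (auto intro!: derivative_eq_intros S')
    have "((\<lambda>p. 1 - sqpos (1 - S p / \<delta>)) has_derivative
        (\<lambda>h. 0 - 2 * max 0 (1 - S p / \<delta>) * (- ((\<Sum>c\<in>T. b' c p h) / \<delta>)))) (at p)"
      by (intro has_derivative_diff has_derivative_const has_derivative_compose[OF g
          sqpos_has_real_derivative[unfolded has_field_derivative_def]])
    then show ?thesis
      by (simp add: \<eta>_def[abs_def] \<eta>'_def[abs_def])
  qed
  show ?thesis
  proof
    show "C1_on UNIV \<eta>"
      using \<open>\<delta> \<noteq> 0\<close> by (intro C1_onI[OF \<eta>']) (auto simp: \<eta>'_def b'_def intro!: continuous_intros contS)
    show "\<eta> p \<le> 1" for p
      by (simp add: \<eta>_def sqpos_def)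
    show "0 \<le> \<eta> p" for p
    proof -
      have "max 0 (1 - S p / \<delta>) \<le> 1"
        using S_nonneg[of p] \<delta> by simp
      then show ?thesis
        by (simp add: \<eta>_def sqpos_def power_le_one)
    qed
    show "\<eta> p = 1" if "p \<in> C" for p
      using \<delta>(1) \<delta>(2)[OF that] by (simp add: \<eta>_def sqpos_def)
    have "{p. \<eta> p \<noteq> 0} \<subseteq> (\<Union>c\<in>T. cball c (r c))"
    proof (clarify, rule ccontr)
      fix p assume "\<eta> p \<noteq> 0" "p \<notin> (\<Union>c\<in>T. cball c (r c))"
      then have "S p = 0"
        using S_pos[of p] S_nonneg[of p] by force
      with \<open>\<eta> p \<noteq> 0\<close> show False
        by (simp add: \<eta>_def sqpos_def)
    qed
    moreover have comp: "compact (\<Union>c\<in>T. cball c (r c))"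
      using T by (intro compact_UN) auto
    ultimately have cl: "closure {p. \<eta> p \<noteq> 0} \<subseteq> (\<Union>c\<in>T. cball c (r c))"
      by (intro closure_minimal compact_imp_closed)
    then show "closure {p. \<eta> p \<noteq> 0} \<subseteq> \<Omega>"
      using r T by blast
    show "compact (closure {p. \<eta> p \<noteq> 0})"
      using bounded_subset[OF compact_imp_bounded[OF comp] cl] by (simp add: compact_eq_bounded_closed)
  qed
qed

section \<open>The flux of a horizontal field through a graph\<close>

lemma integrable_bounded_cball:
  fixes g :: "'a::euclidean_space \<Rightarrow> real"
  assumes "g \<in> borel_measurable borel" "\<And>x. \<bar>g x\<bar> \<le> B" "\<And>x. norm x > R \<Longrightarrow> g x = 0"
  shows "integrable lborel g"
proof (rule integrableI_bounded_set[where A="cball 0 R" and B=B])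
  show "emeasure lborel (cball (0::'a) R) < \<infinity>"
    by (rule emeasure_lborel_cball_finite)
qed (use assms in \<open>auto simp: not_le\<close>)

lemma bounded_of_continuous_cball:
  fixes g :: "'a::euclidean_space \<Rightarrow> real"
  assumes "continuous_on UNIV g" "\<And>x. norm x > R \<Longrightarrow> g x = 0"
  obtains B where "B > 0" "\<And>x. \<bar>g x\<bar> \<le> B"
proof -
  have "bounded (g ` cball 0 R)"
    using assms(1) by (intro compact_imp_bounded compact_continuous_image) (auto intro: continuous_on_subset)
  then obtain B where B: "B > 0" "\<And>x. x \<in> cball 0 R \<Longrightarrow> \<bar>g x\<bar> \<le> B"
    unfolding bounded_pos by auto
  then have "\<bar>g x\<bar> \<le> B" for x
    using assms(2)[of x] by (cases "norm x \<le> R") auto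
  then show ?thesis using that B by blast
qed

lemma derivative_zero_off_cball:
  fixes f :: "'a::real_normed_vector \<Rightarrow> 'b::real_normed_vector"
  assumes "(f has_derivative f') (at p)" "norm p > R" "\<And>p. norm p > R \<Longrightarrow> f p = 0"
  shows "f' = (\<lambda>h. 0)"
proof -
  have "open {p :: 'a. norm p > R}"
    by (intro open_Collect_less continuous_intros)
  then have "((\<lambda>_. 0) has_derivative f') (at p)"
    using assms(2,3) by (intro has_derivative_transform_within_open[OF assms(1)]) auto
  then show ?thesis
    by (rule has_derivative_unique[OF _ has_derivative_const])
qed

lemma LINT_derivative_zero:
  fixes h g :: "real \<Rightarrow> real"
  assumes h: "continuous_on UNIV h" "\<And>x. \<bar>x\<bar> > R \<Longrightarrow> h x = 0"
    and g: "g \<in> borel_measurable borel" "\<And>x. \<bar>g x\<bar> \<le> B" "\<And>x. \<bar>x\<bar> > R \<Longrightarrow> g x = 0"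
    and S: "finite S" "\<And>x. x \<notin> S \<Longrightarrow> (h has_real_derivative g x) (at x)"
  shows "(LINT x|lborel. g x) = 0"
proof -
  define M where "M = \<bar>R\<bar> + 1"
  have "(g has_integral h M - h (- M)) {- M..M}"
  proof (rule fundamental_theorem_of_calculus_strong[OF S(1)])
    show "continuous_on {- M..M} h"
      using h(1) by (rule continuous_on_subset) simp
  qed (use S(2) in \<open>auto simp: M_def has_real_derivative_iff_has_vector_derivative\<close>)
  moreover have "h M = 0" "h (- M) = 0"
    by (auto intro!: h(2) simp: M_def)
  ultimately have "(g has_integral 0) {- M..M}" by simp
  then have "(g has_integral 0) UNIV"
    by (rule has_integral_on_superset) (auto intro!: g(3) simp: M_def)
  moreover have "(g has_integral (LINT x|lborel. g x)) UNIV"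
    by (rule has_integral_integral_lborel, rule integrable_bounded_cball[OF g(1,2), of R])
      (use g(3) in auto)
  ultimately show ?thesis
    using has_integral_unique by blast
qed

text \<open>The two coordinate directions of the plane are treated together: \<open>True\<close> stands for horizontal lines and
  \<open>False\<close> for vertical ones.\<close>

definition axis_line :: "bool \<Rightarrow> real \<Rightarrow> real \<Rightarrow> plane" where
  "axis_line b c x = (if b then (x, c) else (c, x))"

definition axis_vec :: "bool \<Rightarrow> plane" where
  "axis_vec b = (of_bool b, of_bool (\<not> b))"

text \<open>Finitely many kinks are allowed on each coordinate line, and the line through the origin is ignored
  because the kinks of the functions in question lie on half-lines from the origin, which may fill it.\<close>

definition piecewise_partial :: "bool \<Rightarrow> (plane \<Rightarrow> real) \<Rightarrow> (plane \<Rightarrow> real) \<Rightarrow> bool" where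
  "piecewise_partial b u d \<longleftrightarrow> (\<forall>c. c \<noteq> 0 \<longrightarrow> (\<exists>S. finite S \<and>
     (\<forall>x. x \<notin> S \<longrightarrow> ((\<lambda>x. u (axis_line b c x)) has_real_derivative d (axis_line b c x)) (at x))))"

lemma axis_line_has_derivative:
  "(axis_line b c has_derivative (\<lambda>h. h *\<^sub>R axis_vec b)) (at x)"
  by (cases b) (auto simp: axis_line_def[abs_def] axis_vec_def intro!: derivative_eq_intros)

lemma axis_line_norm: "norm (axis_line b c x) \<ge> \<bar>x\<bar>"
  using norm_fst_le[of x c] norm_snd_le[of x c] by (simp add: axis_line_def)

text \<open>Fubini and the fundamental theorem of calculus on almost every coordinate line.\<close>

lemma piecewise_partial_integral_zero:
  fixes H G :: "plane \<Rightarrow> real"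
  assumes H: "continuous_on UNIV H" "\<And>z. norm z > R \<Longrightarrow> H z = 0"
    and G: "G \<in> borel_measurable borel" "\<And>z. \<bar>G z\<bar> \<le> B" "\<And>z. norm z > R \<Longrightarrow> G z = 0"
    and pp: "piecewise_partial b H G"
  shows "(LINT z|lborel. G z) = 0"
proof -
  have int: "integrable (lborel \<Otimes>\<^sub>M lborel) (\<lambda>(x, y). G (x, y))"
    using integrable_bounded_cball[OF G] by (simp add: lborel_prod)
  have fubini: "(LINT z|lborel. G z) = (LINT c|lborel. LINT x|lborel. G (axis_line b c x))"
    using lborel_pair.integral_fst[OF int] lborel_pair.integral_snd[OF int]
    by (cases b) (simp_all add: lborel_prod axis_line_def)
  have line: "continuous_on UNIV (axis_line b c)" for c
    unfolding axis_line_def[abs_def] by (cases b) (auto intro!: continuous_intros)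
  have "(LINT x|lborel. G (axis_line b c x)) = 0" if c: "c \<noteq> 0" for c
  proof -
    obtain S where S: "finite S \<and> (\<forall>x. x \<notin> S \<longrightarrow>
        ((\<lambda>x. H (axis_line b c x)) has_real_derivative G (axis_line b c x)) (at x))"
      using pp c unfolding piecewise_partial_def by presburger
    show ?thesis
    proof (rule LINT_derivative_zero[where R=R and S=S])
      show "continuous_on UNIV (\<lambda>x. H (axis_line b c x))"
        by (rule continuous_on_compose2[OF H(1) line]) simp
      show "(\<lambda>x. G (axis_line b c x)) \<in> borel_measurable borel"
        by (rule measurable_compose[OF borel_measurable_continuous_onI[OF line] G(1)])
      show "H (axis_line b c x) = 0" "G (axis_line b c x) = 0" if "\<bar>x\<bar> > R" for x
        using less_le_trans[OF that axis_line_norm] by (simp_all add: H(2) G(3))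
    qed (use S G(2) in simp_all)
  qed
  then have "AE c in lborel. (LINT x|lborel. G (axis_line b c x)) = 0"
    by (intro eventually_mono[OF AE_lborel_singleton[of "0::real"]])
  then show ?thesis
    unfolding fubini by (rule integral_eq_zero_AE)
qed

text \<open>The type of points of the Heisenberg group nests its pairs to the right, so that it is not
  literally the product of the plane and the line.\<close>

definition at_height :: "plane \<Rightarrow> real \<Rightarrow> heis" where
  "at_height z t = (fst z, snd z, t)"

definition subgraph :: "(plane \<Rightarrow> real) \<Rightarrow> heis set" where
  "subgraph u = {p. snd (snd p) \<le> u (fst p, fst (snd p))}"

lemma continuous_at_height [continuous_intros]:
  assumes "continuous_on A f" "continuous_on A g"
  shows "continuous_on A (\<lambda>x. at_height (f x) (g x))"
  unfolding at_height_def by (intro continuous_intros assms)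

lemma norm_at_height: "norm (at_height z t) \<ge> norm z" "norm (at_height z t) \<ge> \<bar>t\<bar>"
proof -
  have "norm (at_height z t) = sqrt ((norm z)\<^sup>2 + t\<^sup>2)"
    by (cases z) (simp add: at_height_def norm_Pair algebra_simps)
  then show "norm (at_height z t) \<ge> norm z" "norm (at_height z t) \<ge> \<bar>t\<bar>"
    by (auto simp: real_le_rsqrt)
qed

text \<open>Regrouping \<open>((x, y), t)\<close> as \<open>(x, y, t)\<close> preserves volume, so that Fubini applies to the plane
  and the vertical direction.\<close>

lemma lborel_heis: "distr lborel borel (\<lambda>w. at_height (fst w) (snd w)) = lborel"
proof (rule lborel_eqI[symmetric])
  have cont: "continuous_on UNIV (\<lambda>w :: plane \<times> real. at_height (fst w) (snd w))"
    by (intro continuous_intros)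
  have meas [measurable]: "(\<lambda>w. at_height (fst w) (snd w)) \<in> lborel \<rightarrow>\<^sub>M borel"
    using borel_measurable_continuous_onI[OF cont] by simp
  fix l u :: heis
  assume "\<And>b. b \<in> Basis \<Longrightarrow> l \<bullet> b \<le> u \<bullet> b"
  then have box: "emeasure lborel (box l u) = (\<Prod>b\<in>Basis. (u - l) \<bullet> b)"
    by (simp add: emeasure_lborel_box_eq)
  obtain l1 l2 l3 u1 u2 u3 where lu: "l = (l1, l2, l3)" "u = (u1, u2, u3)"
    by (metis surj_pair)
  have b: "box l u = box l1 u1 \<times> (box l2 u2 \<times> box l3 u3)"
    by (auto simp: lu box_def Basis_prod_def inner_Pair)
  have vim: "(\<lambda>w. at_height (fst w) (snd w)) -` box l u = (box l1 u1 \<times> box l2 u2) \<times> box l3 u3"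
    unfolding b by (auto simp: at_height_def)
  have times: "emeasure lborel (A \<times> B) = emeasure lborel A * emeasure lborel B"
    if "A \<in> sets borel" "B \<in> sets borel"
    for A :: "'a::euclidean_space set" and B :: "'b::euclidean_space set"
    using that lborel.emeasure_pair_measure_Times[of A lborel B] by (simp add: lborel_prod)
  have "emeasure (distr lborel borel (\<lambda>w. at_height (fst w) (snd w))) (box l u)
      = emeasure lborel ((box l1 u1 \<times> box l2 u2) \<times> box l3 u3)"
    by (subst emeasure_distr) (auto simp: vim)
  also have "\<dots> = emeasure lborel (box l1 u1 \<times> (box l2 u2 \<times> box l3 u3))"
    by (simp add: times borel_open open_Times mult.assoc)
  finally show "emeasure (distr lborel borel (\<lambda>w. at_height (fst w) (snd w))) (box l u)
      = ennreal (\<Prod>b\<in>Basis. (u - l) \<bullet> b)"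
    using box b by simp
qed simp

lemma pair_sigma_finite_plane_real:
  "pair_sigma_finite (lborel :: plane measure) (lborel :: real measure)"
  by (intro pair_sigma_finite.intro lborel.sigma_finite_measure_axioms)

text \<open>The vertical shear \<open>t = s + u z\<close> preserves volume and turns the subgraph into the half-space \<open>s \<le> 0\<close>.
  This removes the graph from the domain of integration and puts it into the integrand.\<close>

lemma integral_subgraph_sheared:
  fixes g :: "heis \<Rightarrow> real"
  assumes u: "continuous_on UNIV u"
    and g: "g \<in> borel_measurable borel" "\<And>p. \<bar>g p\<bar> \<le> B" "\<And>p. norm p > R \<Longrightarrow> g p = 0"
  shows "integrable lborel (\<lambda>p. indicator (subgraph u) p * g p)" (is ?int)
    and "integrable (lborel \<Otimes>\<^sub>M lborel)
      (\<lambda>(z, s). indicator {..0} s * g (at_height z (s + u z)))" (is ?int')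
    and "(LINT p|lborel. indicator (subgraph u) p * g p)
      = (LINT z|lborel. LINT s|lborel. indicator {..0} s * g (at_height z (s + u z)))" (is ?eq)
proof -
  have "closed (subgraph u)"
    unfolding subgraph_def
    by (intro closed_Collect_le continuous_intros continuous_on_compose2[OF u]) auto
  then have sub [measurable]: "subgraph u \<in> sets borel" by simp
  define k where "k p = indicator (subgraph u) p * g p" for p
  have k: "k \<in> borel_measurable borel"
    unfolding k_def[abs_def] using g(1) by measurable
  have kB: "\<bar>k p\<bar> \<le> B" for p
    using g(2)[of p] by (auto simp: k_def indicator_def)
  have kR: "k p = 0" if "norm p > R" for p
    using g(3)[OF that] by (simp add: k_def)
  show ?int
    using integrable_bounded_cball[OF k kB kR] by (simp add: k_def[abs_def])
  define \<Phi> where "\<Phi> w = indicator {..0} (snd w) * g (at_height (fst w) (snd w + u (fst w)))" for w :: "plane \<times> real"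
  obtain M where M: "M > 0" "\<And>z. z \<in> cball 0 R \<Longrightarrow> \<bar>u z\<bar> \<le> M"
  proof -
    have "bounded (u ` cball 0 R)"
      using u by (intro compact_imp_bounded compact_continuous_image) (auto intro: continuous_on_subset)
    then show ?thesis using that unfolding bounded_pos by auto
  qed
  have "(\<lambda>w :: plane \<times> real. at_height (fst w) (snd w + u (fst w))) \<in> borel \<rightarrow>\<^sub>M borel"
    by (intro borel_measurable_continuous_onI continuous_intros continuous_on_compose2[OF u]) auto
  from measurable_compose[OF this g(1)]
  have [measurable]: "(\<lambda>w :: plane \<times> real. g (at_height (fst w) (snd w + u (fst w)))) \<in> borel_measurable borel" .
  have "(\<lambda>w :: plane \<times> real. indicator {..0} (snd w) :: real) \<in> borel_measurable borel"
    by (simp add: borel_prod[symmetric])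
  then have \<Phi>: "\<Phi> \<in> borel_measurable borel"
    unfolding \<Phi>_def[abs_def] by measurable
  have \<Phi>B: "\<bar>\<Phi> w\<bar> \<le> B" for w
    using g(2)[of "at_height (fst w) (snd w + u (fst w))"] by (auto simp: \<Phi>_def indicator_def)
  have \<Phi>R: "\<Phi> w = 0" if w: "norm w > R + (R + M)" for w
  proof (rule ccontr)
    assume "\<Phi> w \<noteq> 0"
    then have "norm (at_height (fst w) (snd w + u (fst w))) \<le> R"
      using g(3) unfolding \<Phi>_def by (metis mult_zero_right not_le)
    then have 1: "norm (fst w) \<le> R" "\<bar>snd w + u (fst w)\<bar> \<le> R"
      using norm_at_height(1)[of "fst w" "snd w + u (fst w)"] norm_at_height(2)[of "snd w + u (fst w)" "fst w"] by linarith+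
    then have "\<bar>u (fst w)\<bar> \<le> M" by (intro M(2)) simp
    then have "norm w \<le> R + (R + M)"
      using 1 sqrt_sum_squares_le_sum[of "norm (fst w)" "norm (snd w)"] by (simp add: norm_prod_def)
    with w show False by simp
  qed
  have int\<Phi>: "integrable lborel \<Phi>"
    using \<Phi> \<Phi>B \<Phi>R by (rule integrable_bounded_cball)
  then show ?int'
    by (simp add: \<Phi>_def[abs_def] lborel_prod case_prod_beta')
  have lift_borel: "(\<lambda>w :: plane \<times> real. at_height (fst w) (snd w)) \<in> lborel \<rightarrow>\<^sub>M borel"
    by (simp, intro borel_measurable_continuous_onI continuous_intros)
  have "(LINT p|lborel. k p) = (LINT w|lborel. k (at_height (fst w) (snd w)))"
    using integral_distr[OF lift_borel k] by (simp add: lborel_heis)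
  also have "\<dots> = (LINT z|lborel. LINT t|lborel. k (at_height z t))"
  proof -
    have "integrable lborel (\<lambda>w. k (at_height (fst w) (snd w)))"
      using integrable_distr_eq[OF lift_borel k] integrable_bounded_cball[OF k kB kR]
      by (simp add: lborel_heis)
    then show ?thesis
      using pair_sigma_finite.integral_fst'[OF pair_sigma_finite_plane_real, of "\<lambda>w. k (at_height (fst w) (snd w))"] by (simp add: lborel_prod)
  qed
  also have "\<dots> = (LINT z|lborel. LINT s|lborel. k (at_height z (u z + s)))"
    using lborel_integral_real_affine[of 1 "\<lambda>t. k (at_height z t)" "u z" for z] by simp
  also have "(\<lambda>z s. k (at_height z (u z + s))) = (\<lambda>z s. \<Phi> (z, s))"
    by (auto simp: k_def \<Phi>_def subgraph_def at_height_def indicator_def fun_eq_iff add.commute)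
  finally show ?eq
    by (simp add: k_def[abs_def] \<Phi>_def[abs_def])
qed

lemma integral_vertical_derivative:
  fixes f f3 :: "heis \<Rightarrow> real"
  assumes f: "\<And>z t. ((\<lambda>t. f (at_height z t)) has_real_derivative f3 (at_height z t)) (at t)"
    and f3: "continuous_on UNIV f3"
    and R: "\<And>p. norm p > R \<Longrightarrow> f p = 0" "\<And>p. norm p > R \<Longrightarrow> f3 p = 0"
  shows "(LINT s|lborel. indicator {..0} s * f3 (at_height z (s + c))) = f (at_height z c)"
proof -
  define M where "M = \<bar>R\<bar> + \<bar>c\<bar> + 1"
  have out: "norm (at_height z (s + c)) > R" if "s \<le> - M" for s
    using that norm_at_height(2)[of "s + c" z] by (auto simp: M_def)
  have "(LINT s|lborel. indicator {..0} s * f3 (at_height z (s + c)))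
      = (LINT s|lborel. indicator {- M..0} s *\<^sub>R f3 (at_height z (s + c)))"
    by (intro Bochner_Integration.integral_cong refl) (auto simp: indicator_def intro!: R(2) out)
  also have "\<dots> = f (at_height z (0 + c)) - f (at_height z (- M + c))"
  proof (rule integral_FTC_Icc)
    show "((\<lambda>s. f (at_height z (s + c))) has_vector_derivative f3 (at_height z (s + c))) (at s within {- M..0})" for s
      using DERIV_at_within_shift[of "\<lambda>t. f (at_height z t)" "f3 (at_height z (s + c))" c s UNIV] f[of z "s + c"]
      by (auto simp: add.commute has_real_derivative_iff_has_vector_derivative
          intro: has_vector_derivative_at_within)
    show "continuous_on {- M..0} (\<lambda>s. f3 (at_height z (s + c)))"
      by (rule continuous_on_compose2[OF f3]) (auto intro!: continuous_intros)
  qed (simp add: M_def)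
  also have "f (at_height z (- M + c)) = 0"
    by (intro R(1) out) simp
  finally show ?thesis by simp
qed

text \<open>Here \<open>fe\<close> and \<open>f3\<close> are the derivatives of \<open>f\<close> in a horizontal coordinate direction and in the vertical one,
  and \<open>d\<close> is the derivative of \<open>u\<close> in that direction. After the shear, \<open>fe + a f3\<close> splits into the derivative
  \<open>fe + d f3\<close> of \<open>z \<mapsto> f (z, s + u z)\<close>, which integrates to zero over the plane for each \<open>s\<close>, and
  \<open>(a - d) f3\<close>, whose integral over \<open>s \<le> 0\<close> is the boundary term \<open>(a - d) f (z, u z)\<close>. No differentiation
  under the integral sign is involved.\<close>

lemma integral_subgraph_derivative:
  fixes f fe f3 :: "heis \<Rightarrow> real" and u d a :: "plane \<Rightarrow> real"
  assumes u: "continuous_on UNIV u"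
    and fe: "continuous_on UNIV fe" and f3: "continuous_on UNIV f3"
    and R: "\<And>p. norm p > R \<Longrightarrow> f p = 0" "\<And>p. norm p > R \<Longrightarrow> fe p = 0" "\<And>p. norm p > R \<Longrightarrow> f3 p = 0"
    and f: "\<And>z t. ((\<lambda>t. f (at_height z t)) has_real_derivative f3 (at_height z t)) (at t)"
    and a: "continuous_on UNIV a"
    and d: "d \<in> borel_measurable borel" "\<And>z. \<bar>d z\<bar> \<le> L * norm z"
    and zero: "\<And>s. (LINT z|lborel. fe (at_height z (s + u z)) + d z * f3 (at_height z (s + u z))) = 0"
  shows "integrable lborel (\<lambda>p. indicator (subgraph u) p * (fe p + a (fst p, fst (snd p)) * f3 p))"
    and "(LINT p|lborel. indicator (subgraph u) p * (fe p + a (fst p, fst (snd p)) * f3 p))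
      = (LINT z|lborel. f (at_height z (u z)) * (a z - d z))"
proof -
  have plane_le: "norm (fst p, fst (snd p)) \<le> norm p" for p :: heis
    using norm_at_height(1)[of "(fst p, fst (snd p))" "snd (snd p)"] by (simp add: at_height_def)
  obtain Be where Be: "Be > 0" "\<And>p. \<bar>fe p\<bar> \<le> Be"
    using bounded_of_continuous_cball[OF fe R(2)] by blast
  obtain B3 where B3: "B3 > 0" "\<And>p. \<bar>f3 p\<bar> \<le> B3"
    using bounded_of_continuous_cball[OF f3 R(3)] by blast
  define g1 where "g1 p = fe p + d (fst p, fst (snd p)) * f3 p" for p
  define g2 where "g2 p = (a (fst p, fst (snd p)) - d (fst p, fst (snd p))) * f3 p" for p
  have g: "fe p + a (fst p, fst (snd p)) * f3 p = g1 p + g2 p" for p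
    by (simp add: g1_def g2_def algebra_simps)
  have [measurable]: "fe \<in> borel_measurable borel" "f3 \<in> borel_measurable borel"
    using fe f3 by (auto intro: borel_measurable_continuous_onI)
  have [measurable]: "(\<lambda>p :: heis. d (fst p, fst (snd p))) \<in> borel_measurable borel"
    by (rule measurable_compose[OF _ d(1)]) (intro borel_measurable_continuous_onI continuous_intros)
  have ca: "continuous_on UNIV (\<lambda>p :: heis. a (fst p, fst (snd p)))"
    by (rule continuous_on_compose2[OF a]) (auto intro!: continuous_intros)
  then have [measurable]: "(\<lambda>p :: heis. a (fst p, fst (snd p))) \<in> borel_measurable borel"
    by (rule borel_measurable_continuous_onI)
  have g1m: "g1 \<in> borel_measurable borel" and g2m: "g2 \<in> borel_measurable borel"
    unfolding g1_def[abs_def] g2_def[abs_def] by measurable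
  have d3: "\<bar>d (fst p, fst (snd p)) * f3 p\<bar> \<le> \<bar>L\<bar> * \<bar>R\<bar> * B3" for p
  proof (cases "norm p > R")
    case False
    have "\<bar>d (fst p, fst (snd p))\<bar> \<le> \<bar>L\<bar> * norm (fst p, fst (snd p))"
      using d(2)[of "(fst p, fst (snd p))"] by (rule order_trans) (intro mult_right_mono, auto)
    also have "\<dots> \<le> \<bar>L\<bar> * \<bar>R\<bar>"
      using plane_le[of p] False by (intro mult_left_mono) auto
    finally show ?thesis
      unfolding abs_mult by (intro mult_mono B3) auto
  qed (use R(3) B3(1) in auto)
  have "continuous_on UNIV (\<lambda>p. a (fst p, fst (snd p)) * f3 p)"
    by (intro continuous_intros ca f3)
  then obtain Ba where "Ba > 0" and Ba: "\<And>p. \<bar>a (fst p, fst (snd p)) * f3 p\<bar> \<le> Ba"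
    by (rule bounded_of_continuous_cball[of _ R]) (simp_all add: R(3))
  have g1B: "\<bar>g1 p\<bar> \<le> Be + \<bar>L\<bar> * \<bar>R\<bar> * B3" for p
    using Be(2)[of p] d3[of p] unfolding g1_def by linarith
  have g2B: "\<bar>g2 p\<bar> \<le> Ba + \<bar>L\<bar> * \<bar>R\<bar> * B3" for p
    using Ba[of p] d3[of p] unfolding g2_def left_diff_distrib by linarith
  have g1R: "g1 p = 0" and g2R: "g2 p = 0" if "norm p > R" for p
    using R(2,3)[OF that] by (auto simp: g1_def g2_def)
  note sh1 = integral_subgraph_sheared[where R=R, OF u g1m g1B g1R]
  note sh2 = integral_subgraph_sheared[where R=R, OF u g2m g2B g2R]
  have split: "indicator (subgraph u) p * (fe p + a (fst p, fst (snd p)) * f3 p)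
      = indicator (subgraph u) p * g1 p + indicator (subgraph u) p * g2 p" for p
    unfolding g distrib_left ..
  show "integrable lborel (\<lambda>p. indicator (subgraph u) p * (fe p + a (fst p, fst (snd p)) * f3 p))"
    unfolding split by (intro Bochner_Integration.integrable_add sh1(1) sh2(1))
  have "(LINT p|lborel. indicator (subgraph u) p * g1 p)
      = (LINT s|lborel. LINT z|lborel. indicator {..0} s * g1 (at_height z (s + u z)))"
    using sh1(3) pair_sigma_finite.Fubini_integral[OF pair_sigma_finite_plane_real sh1(2)] by simp
  also have "\<dots> = 0"
    using zero by (simp add: g1_def at_height_def)
  finally have 1: "(LINT p|lborel. indicator (subgraph u) p * g1 p) = 0" .
  have "(LINT s|lborel. indicator {..0} s * g2 (at_height z (s + u z))) = f (at_height z (u z)) * (a z - d z)" for z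
  proof -
    have "(LINT s|lborel. indicator {..0} s * g2 (at_height z (s + u z)))
        = (LINT s|lborel. (a z - d z) * (indicator {..0} s * f3 (at_height z (s + u z))))"
      by (simp add: g2_def at_height_def mult.left_commute)
    also have "\<dots> = (a z - d z) * f (at_height z (u z))"
      by (simp add: integral_vertical_derivative[OF f f3 R(1,3)])
    finally show ?thesis by (simp add: mult.commute)
  qed
  then have 2: "(LINT p|lborel. indicator (subgraph u) p * g2 p)
      = (LINT z|lborel. f (at_height z (u z)) * (a z - d z))"
    using sh2(3) by simp
  show "(LINT p|lborel. indicator (subgraph u) p * (fe p + a (fst p, fst (snd p)) * f3 p))
      = (LINT z|lborel. f (at_height z (u z)) * (a z - d z))"
    unfolding split using 1 2 sh1(1) sh2(1) by simp
qed

text \<open>The fields \<open>X = \<partial>\<^sub>x + y \<partial>\<^sub>t\<close> and \<open>Y = \<partial>\<^sub>y - x \<partial>\<^sub>t\<close> are the two instances, with \<open>a (x, y) = y\<close> and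
  \<open>a (x, y) = - x\<close>.\<close>

lemma flux_component:
  fixes f :: "heis \<Rightarrow> real" and u d a :: "plane \<Rightarrow> real"
  assumes u: "continuous_on UNIV u"
    and f: "\<And>p. (f has_derivative f' p) (at p)"
    and cont: "\<And>h. continuous_on UNIV (\<lambda>p. f' p h)"
    and out: "\<forall>p. norm p > R \<longrightarrow> f p = 0"
    and a: "continuous_on UNIV a"
    and d: "d \<in> borel_measurable borel" "\<And>z. \<bar>d z\<bar> \<le> L * norm z"
    and pp: "piecewise_partial b u d"
  defines "F \<equiv> \<lambda>p. f' p (fst (axis_vec b), snd (axis_vec b), a (fst p, fst (snd p)))"
  shows "integrable lborel (\<lambda>p. indicator (subgraph u) p * F p)"
    and "(LINT p|lborel. indicator (subgraph u) p * F p)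
      = (LINT z|lborel. f (at_height z (u z)) * (a z - d z))"
proof -
  define e where "e = axis_vec b"
  have R: "f p = 0" if "norm p > R" for p
    using out that by blast
  have lin: "linear (f' p)" for p
    using f[of p] by (intro bounded_linear.linear has_derivative_bounded_linear)
  have f'0: "f' p h = 0" if "norm p > R" for p h
    using derivative_zero_off_cball[OF f that R] by simp
  define f3 where "f3 p = f' p (0, 0, 1)" for p
  define fe where "fe p = f' p (fst e, snd e, 0)" for p
  have cf3: "continuous_on UNIV f3" and cfe: "continuous_on UNIV fe"
    unfolding f3_def[abs_def] fe_def[abs_def] by (rule cont)+
  have f3R: "f3 p = 0" and feR: "fe p = 0" if "norm p > R" for p
    using f'0[OF that] by (simp_all add: f3_def fe_def)
  have scale3: "f' p (0, 0, h) = f3 p * h" for p h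
    using linear_scale[OF lin, of p h "(0, 0, 1)"] by (simp add: f3_def mult.commute)
  have split: "f' p (h * fst e, h * snd e, k) = h * fe p + k * f3 p" for p h k
    using linear_scale[OF lin, of p h "(fst e, snd e, 0)"]
      linear_add[OF lin, of p "(h * fst e, h * snd e, 0)" "(0, 0, k)"]
    by (simp add: fe_def scale3 mult.commute)
  have f3: "((\<lambda>t. f (at_height z t)) has_real_derivative f3 (at_height z t)) (at t)" for z t
  proof -
    have g: "((\<lambda>t. at_height z t) has_derivative (\<lambda>h. (0, 0, h))) (at t)"
      unfolding at_height_def by (intro has_derivative_Pair has_derivative_const has_derivative_ident)
    show ?thesis
      using has_derivative_compose[OF g f] by (simp add: has_field_derivative_def scale3)
  qed
  have cl: "continuous_on UNIV (\<lambda>z. at_height z (s + u z))" for s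
    by (intro continuous_intros u)
  obtain B3 where B3: "B3 > 0" "\<And>p. \<bar>f3 p\<bar> \<le> B3"
    using bounded_of_continuous_cball[OF cf3 f3R] by blast
  obtain Be where Be: "Be > 0" "\<And>p. \<bar>fe p\<bar> \<le> Be"
    using bounded_of_continuous_cball[OF cfe feR] by blast
  have zero: "(LINT z|lborel. fe (at_height z (s + u z)) + d z * f3 (at_height z (s + u z))) = 0" for s
  proof (rule piecewise_partial_integral_zero)
    \<comment> \<open>The integrand is the partial derivative of \<open>f (z, s + u z)\<close>.\<close>
    show "continuous_on UNIV (\<lambda>z. f (at_height z (s + u z)))"
      using has_derivative_continuous_on[of UNIV f f'] f by (intro continuous_on_compose2[OF _ cl]) auto
    have [measurable]: "(\<lambda>z. fe (at_height z (s + u z))) \<in> borel_measurable borel"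
        "(\<lambda>z. f3 (at_height z (s + u z))) \<in> borel_measurable borel"
      by (intro borel_measurable_continuous_onI continuous_on_compose2[OF cfe cl]
          continuous_on_compose2[OF cf3 cl]; simp)+
    show "(\<lambda>z. fe (at_height z (s + u z)) + d z * f3 (at_height z (s + u z))) \<in> borel_measurable borel"
      using d(1) by measurable
    show out: "f (at_height z (s + u z)) = 0" "fe (at_height z (s + u z)) + d z * f3 (at_height z (s + u z)) = 0"
      if "norm z > R" for z
    proof -
      have "norm (at_height z (s + u z)) > R"
        using that norm_at_height(1)[of z "s + u z"] by linarith
      then show "f (at_height z (s + u z)) = 0" "fe (at_height z (s + u z)) + d z * f3 (at_height z (s + u z)) = 0"
        by (simp_all add: R feR f3R)
    qed
    show "\<bar>fe (at_height z (s + u z)) + d z * f3 (at_height z (s + u z))\<bar> \<le> Be + \<bar>L\<bar> * \<bar>R\<bar> * B3" for z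
    proof (cases "norm z > R")
      case True
      then show ?thesis using out(2)[OF True] Be B3 by simp
    next
      case False
      have "\<bar>d z\<bar> \<le> \<bar>L\<bar> * norm z"
        using d(2)[of z] by (rule order_trans) (intro mult_right_mono, auto)
      also have "\<dots> \<le> \<bar>L\<bar> * \<bar>R\<bar>"
        using False by (intro mult_left_mono) auto
      finally have "\<bar>d z * f3 (at_height z (s + u z))\<bar> \<le> \<bar>L\<bar> * \<bar>R\<bar> * B3"
        unfolding abs_mult by (intro mult_mono B3) auto
      then show ?thesis
        using Be(2)[of "at_height z (s + u z)"] by linarith
    qed
    show "piecewise_partial b (\<lambda>z. f (at_height z (s + u z)))
        (\<lambda>z. fe (at_height z (s + u z)) + d z * f3 (at_height z (s + u z)))"
      unfolding piecewise_partial_def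
    proof (intro allI impI)
      fix c :: real assume "c \<noteq> 0"
      then obtain S where S: "finite S \<and> (\<forall>x. x \<notin> S \<longrightarrow>
          ((\<lambda>x. u (axis_line b c x)) has_real_derivative d (axis_line b c x)) (at x))"
        using pp unfolding piecewise_partial_def by presburger
      have "((\<lambda>x. f (at_height (axis_line b c x) (s + u (axis_line b c x)))) has_real_derivative
          fe (at_height (axis_line b c x) (s + u (axis_line b c x)))
            + d (axis_line b c x) * f3 (at_height (axis_line b c x) (s + u (axis_line b c x)))) (at x)"
        if "x \<notin> S" for x
      proof -
        have ux: "((\<lambda>x. u (axis_line b c x)) has_derivative (\<lambda>h. d (axis_line b c x) * h)) (at x)"
          using S that by (simp add: has_field_derivative_def)
        note g = axis_line_has_derivative[of b c x, folded e_def]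
        have "((\<lambda>x. at_height (axis_line b c x) (s + u (axis_line b c x))) has_derivative
            (\<lambda>h. (h * fst e, h * snd e, d (axis_line b c x) * h))) (at x)"
          unfolding at_height_def
          using has_derivative_fst[OF g] has_derivative_snd[OF g]
            has_derivative_add[OF has_derivative_const ux, of s]
          by (intro has_derivative_Pair) simp_all
        from has_derivative_compose[OF this f] show ?thesis
          unfolding has_field_derivative_def split
          by (rule has_derivative_eq_rhs) (simp add: fun_eq_iff algebra_simps)
      qed
      with S show "\<exists>S. finite S \<and> (\<forall>x. x \<notin> S \<longrightarrow>
          ((\<lambda>x. f (at_height (axis_line b c x) (s + u (axis_line b c x)))) has_real_derivative
          fe (at_height (axis_line b c x) (s + u (axis_line b c x)))
            + d (axis_line b c x) * f3 (at_height (axis_line b c x) (s + u (axis_line b c x)))) (at x))"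
        by (intro exI[of _ S]) simp
    qed
  qed
  have F: "F p = fe p + a (fst p, fst (snd p)) * f3 p" for p
    using split[of p 1] by (simp add: F_def e_def)
  show "integrable lborel (\<lambda>p. indicator (subgraph u) p * F p)"
    unfolding F by (rule integral_subgraph_derivative[OF u cfe cf3 R feR f3R f3 a d zero])
  show "(LINT p|lborel. indicator (subgraph u) p * F p)
      = (LINT z|lborel. f (at_height z (u z)) * (a z - d z))"
    unfolding F by (rule integral_subgraph_derivative[OF u cfe cf3 R feR f3R f3 a d zero])
qed

definition rot90 :: "plane \<Rightarrow> plane" where
  "rot90 z = (- snd z, fst z)"

text \<open>For \<open>D\<close> the gradient of \<open>u\<close>, the components \<open>(y - u\<^sub>x, - x - u\<^sub>y)\<close> are those of the horizontal gradient of
  \<open>t - u (x, y)\<close>, hence an outer horizontal normal of the subgraph; its length is the density of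
  the perimeter with respect to area in the plane.\<close>

definition hnormal :: "(plane \<Rightarrow> plane) \<Rightarrow> plane \<Rightarrow> plane" where
  "hnormal D z = - (rot90 z + D z)"

lemma test_field_norm_le: "V \<in> test_fields \<Omega> \<Longrightarrow> norm (V p) \<le> 1"
  unfolding test_fields_def by blast

lemma test_field_continuous: "V \<in> test_fields \<Omega> \<Longrightarrow> continuous_on UNIV V"
  by (simp add: test_fields_def C1_on_continuous)

lemma test_fieldE:
  assumes "V \<in> test_fields \<Omega>"
  obtains V' R where "R > 0" "\<And>p. (V has_derivative V' p) (at p)"
    "\<And>h. continuous_on UNIV (\<lambda>p. V' p h)" "\<And>p. norm p > R \<Longrightarrow> V p = 0"
proof -
  obtain F :: "heis \<Rightarrow> heis \<Rightarrow>\<^sub>L plane" where F: "\<And>p. (V has_derivative blinfun_apply (F p)) (at p)"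
      "continuous_on UNIV F"
    using assms unfolding test_fields_def C1_on_def by auto
  have "bounded (closure {p. V p \<noteq> 0})"
    using assms compact_imp_bounded unfolding test_fields_def by blast
  then obtain R where R: "R > 0" "\<And>p. p \<in> closure {p. V p \<noteq> 0} \<Longrightarrow> norm p \<le> R"
    unfolding bounded_pos by auto
  have out: "V p = 0" if "norm p > R" for p
  proof (rule ccontr)
    assume "V p \<noteq> 0"
    then have "norm p \<le> R"
      by (intro R(2) subsetD[OF closure_subset]) simp
    then show False using that by simp
  qed
  show ?thesis
    using F(2) by (intro that[OF R(1) F(1) _ out] continuous_intros) auto
qed

text \<open>The divergence theorem for horizontal fields on a subgraph.\<close>

lemma flux_piecewise:
  fixes u :: "plane \<Rightarrow> real" and D :: "plane \<Rightarrow> plane"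
  assumes u: "continuous_on UNIV u"
    and D: "D \<in> borel_measurable borel" "\<And>z. norm (D z) \<le> L * norm z"
    and pp: "piecewise_partial True u (\<lambda>z. fst (D z))" "piecewise_partial False u (\<lambda>z. snd (D z))"
    and V: "V \<in> test_fields UNIV"
  shows "(LINT p:subgraph u|lebesgue. hdiv V p) = (LINT z|lborel. V (at_height z (u z)) \<bullet> hnormal D z)"
proof -
  obtain V' R where V': "R > 0" "\<And>p. (V has_derivative V' p) (at p)"
    "\<And>h. continuous_on UNIV (\<lambda>p. V' p h)" "\<And>p. norm p > R \<Longrightarrow> V p = 0"
    by (rule test_fieldE[OF V], rule that)
  have D1: "(\<lambda>z. fst (D z)) \<in> borel_measurable borel" and D2: "(\<lambda>z. snd (D z)) \<in> borel_measurable borel"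
    by (rule measurable_compose[OF D(1)], intro borel_measurable_continuous_onI continuous_intros)+
  have b1: "\<bar>fst (D z)\<bar> \<le> L * norm z" and b2: "\<bar>snd (D z)\<bar> \<le> L * norm z" for z
    using D(2)[of z] norm_fst_le[of "fst (D z)" "snd (D z)"] norm_snd_le[of "snd (D z)" "fst (D z)"] by auto
  define F1 where "F1 p = fst (V' p (1, 0, fst (snd p)))" for p
  define F2 where "F2 p = snd (V' p (0, 1, - fst p))" for p
  have 1: "integrable lborel (\<lambda>p. indicator (subgraph u) p * F1 p)"
    "(LINT p|lborel. indicator (subgraph u) p * F1 p)
      = (LINT z|lborel. fst (V (at_height z (u z))) * (snd z - fst (D z)))"
  proof -
    have c: "continuous_on UNIV (\<lambda>z :: plane. snd z)"
      by (intro continuous_intros)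
    have F: "F1 = (\<lambda>p. fst (V' p (fst (axis_vec True), snd (axis_vec True), snd (fst p, fst (snd p)))))"
      by (simp add: F1_def axis_vec_def fun_eq_iff)
    have o: "\<forall>p. norm p > R \<longrightarrow> fst (V p) = 0"
      using V'(4) by simp
    show "integrable lborel (\<lambda>p. indicator (subgraph u) p * F1 p)"
      "(LINT p|lborel. indicator (subgraph u) p * F1 p)
      = (LINT z|lborel. fst (V (at_height z (u z))) * (snd z - fst (D z)))"
      unfolding F
      by (rule flux_component[OF u has_derivative_fst[OF V'(2)] continuous_on_fst[OF V'(3)] o c D1 b1 pp(1)])+
  qed
  have 2: "integrable lborel (\<lambda>p. indicator (subgraph u) p * F2 p)"
    "(LINT p|lborel. indicator (subgraph u) p * F2 p)
      = (LINT z|lborel. snd (V (at_height z (u z))) * (- fst z - snd (D z)))"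
  proof -
    have c: "continuous_on UNIV (\<lambda>z :: plane. - fst z)"
      by (intro continuous_intros)
    have F: "F2 = (\<lambda>p. snd (V' p (fst (axis_vec False), snd (axis_vec False), - fst (fst p, fst (snd p)))))"
      by (simp add: F2_def axis_vec_def fun_eq_iff)
    have o: "\<forall>p. norm p > R \<longrightarrow> snd (V p) = 0"
      using V'(4) by simp
    show "integrable lborel (\<lambda>p. indicator (subgraph u) p * F2 p)"
      "(LINT p|lborel. indicator (subgraph u) p * F2 p)
      = (LINT z|lborel. snd (V (at_height z (u z))) * (- fst z - snd (D z)))"
      unfolding F
      by (rule flux_component[OF u has_derivative_snd[OF V'(2)] continuous_on_snd[OF V'(3)] o c D2 b2 pp(2)])+
  qed
  have cV: "continuous_on UNIV V"
    using V by (rule test_field_continuous)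
  have [measurable]: "(\<lambda>z. V (at_height z (u z))) \<in> borel_measurable borel"
    by (intro borel_measurable_continuous_onI continuous_on_compose2[OF cV]) (auto intro!: continuous_intros u)
  have int: "integrable lborel (\<lambda>z. g (V (at_height z (u z))) * k z)"
    if g: "continuous_on UNIV g" "\<And>v. \<bar>g v\<bar> \<le> norm v" and k: "k \<in> borel_measurable borel" "\<And>z. \<bar>k z\<bar> \<le> (1 + L) * norm z"
    for g :: "plane \<Rightarrow> real" and k
  proof (rule integrable_bounded_cball[where R=R and B="(1 + \<bar>L\<bar>) * R"])
    have "(\<lambda>z. g (V (at_height z (u z)))) \<in> borel_measurable borel"
      by (intro borel_measurable_continuous_onI continuous_on_compose2[OF g(1)] continuous_on_compose2[OF cV])
        (auto intro!: continuous_intros u)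
    then show "(\<lambda>z. g (V (at_height z (u z))) * k z) \<in> borel_measurable borel"
      using k(1) by measurable
    show 0: "g (V (at_height z (u z))) * k z = 0" if "norm z > R" for z
    proof -
      have "V (at_height z (u z)) = 0"
        using that norm_at_height(1)[of z "u z"] by (intro V'(4)) linarith
      then show ?thesis using g(2)[of 0] by simp
    qed
    show "\<bar>g (V (at_height z (u z))) * k z\<bar> \<le> (1 + \<bar>L\<bar>) * R" for z
    proof (cases "norm z > R")
      case True
      then show ?thesis unfolding 0[OF True] using V'(1) by simp
    next
      case False
      have "norm (V (at_height z (u z))) \<le> 1"
        using V by (rule test_field_norm_le)
      then have "\<bar>g (V (at_height z (u z)))\<bar> \<le> 1"
        using g(2) order_trans by blast
      moreover have "\<bar>k z\<bar> \<le> (1 + \<bar>L\<bar>) * R"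
      proof -
        have "(1 + L) * norm z \<le> (1 + \<bar>L\<bar>) * R"
          using False by (intro mult_mono) auto
        then show ?thesis using k(2)[of z] by linarith
      qed
      ultimately have "\<bar>g (V (at_height z (u z)))\<bar> * \<bar>k z\<bar> \<le> 1 * ((1 + \<bar>L\<bar>) * R)"
        by (intro mult_mono) auto
      then show ?thesis by (simp add: abs_mult)
    qed
  qed
  have fst_le: "\<bar>fst v\<bar> \<le> norm v" and snd_le: "\<bar>snd v\<bar> \<le> norm v" for v :: plane
    using norm_fst_le[of "fst v" "snd v"] norm_snd_le[of "snd v" "fst v"] by auto
  have i1: "integrable lborel (\<lambda>z. fst (V (at_height z (u z))) * (snd z - fst (D z)))"
  proof (rule int[OF _ fst_le])
    have "(\<lambda>z :: plane. snd z) \<in> borel_measurable borel"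
      by (intro borel_measurable_continuous_onI continuous_intros)
    then show "(\<lambda>z. snd z - fst (D z)) \<in> borel_measurable borel"
      using D1 by measurable
    show "\<bar>snd z - fst (D z)\<bar> \<le> (1 + L) * norm z" for z
      using b1[of z] snd_le[of z] by (auto simp: algebra_simps)
  qed (intro continuous_intros)
  have i2: "integrable lborel (\<lambda>z. snd (V (at_height z (u z))) * (- fst z - snd (D z)))"
  proof (rule int[OF _ snd_le])
    have "(\<lambda>z :: plane. fst z) \<in> borel_measurable borel"
      by (intro borel_measurable_continuous_onI continuous_intros)
    then show "(\<lambda>z. - fst z - snd (D z)) \<in> borel_measurable borel"
      using D2 by measurable
    show "\<bar>- fst z - snd (D z)\<bar> \<le> (1 + L) * norm z" for z
      using b2[of z] fst_le[of z] by (auto simp: algebra_simps)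
  qed (intro continuous_intros)
  have "(LINT p:subgraph u|lebesgue. hdiv V p)
      = (LINT p|lebesgue. indicator (subgraph u) p * F1 p + indicator (subgraph u) p * F2 p)"
    unfolding set_lebesgue_integral_def hdiv_eq[OF V'(2)] F1_def F2_def by (simp add: distrib_left)
  also have "\<dots> = (LINT p|lborel. indicator (subgraph u) p * F1 p + indicator (subgraph u) p * F2 p)"
    using 1(1) 2(1) by (intro integral_completion borel_measurable_add borel_measurable_integrable)
  also have "\<dots> = (LINT z|lborel. fst (V (at_height z (u z))) * (snd z - fst (D z)))
      + (LINT z|lborel. snd (V (at_height z (u z))) * (- fst z - snd (D z)))"
    using 1 2 by simp
  also have "\<dots> = (LINT z|lborel. fst (V (at_height z (u z))) * (snd z - fst (D z))
      + snd (V (at_height z (u z))) * (- fst z - snd (D z)))"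
    using i1 i2 by simp
  also have "\<dots> = (LINT z|lborel. V (at_height z (u z)) \<bullet> hnormal D z)"
    by (intro Bochner_Integration.integral_cong refl)
      (simp add: hnormal_def rot90_def inner_prod_def algebra_simps)
  finally show ?thesis .
qed

section \<open>Arcs and the sectors they span\<close>

lemma rot90_simps [simp]:
  "fst (rot90 z) = - snd z" "snd (rot90 z) = fst z"
  "norm (rot90 z) = norm z" "rot90 z \<bullet> rot90 w = z \<bullet> w" "rot90 (- z) = - rot90 z"
  "z \<bullet> rot90 z = 0" "rot90 z \<bullet> z = 0" "rot90 0 = 0" "rot90 (rot90 z) = - z"
  by (cases z; cases w; simp add: rot90_def norm_prod_def inner_prod_def algebra_simps prod_eq_iff)+

lemma rot90_linear: "rot90 (z + w) = rot90 z + rot90 w" "rot90 (z - w) = rot90 z - rot90 w"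
  "rot90 (r *\<^sub>R z) = r *\<^sub>R rot90 z"
  by (simp_all add: rot90_def prod_eq_iff)

lemma continuous_rot90 [continuous_intros]:
  "continuous_on A f \<Longrightarrow> continuous_on A (\<lambda>x. rot90 (f x))"
  unfolding rot90_def by (intro continuous_intros)

text \<open>Every unit vector \<open>c\<close> gives an orthonormal frame \<open>c\<close>, \<open>rot90 c\<close>. Working in the frame of the axis
  of an arc replaces the rotations in the definition of the surface.\<close>

lemma plane_frame:
  assumes "norm c = 1"
  shows "z = (z \<bullet> c) *\<^sub>R c + (z \<bullet> rot90 c) *\<^sub>R rot90 c"
    and "z \<bullet> w = (z \<bullet> c) * (w \<bullet> c) + (z \<bullet> rot90 c) * (w \<bullet> rot90 c)"
proof -
  obtain a b x y where c: "c = (a, b)" and z: "z = (x, y)" by (metis surj_pair)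
  have ab: "a\<^sup>2 + b\<^sup>2 = 1"
    using assms by (simp add: c norm_prod_def)
  have "(x * a + y * b) * a + (y * a - x * b) * - b = x * (a\<^sup>2 + b\<^sup>2)"
    "(x * a + y * b) * b + (y * a - x * b) * a = y * (a\<^sup>2 + b\<^sup>2)"
    by (simp_all add: algebra_simps power2_eq_square)
  then show *: "z = (z \<bullet> c) *\<^sub>R c + (z \<bullet> rot90 c) *\<^sub>R rot90 c"
    by (simp add: c z rot90_def inner_prod_def ab algebra_simps)
  show "z \<bullet> w = (z \<bullet> c) * (w \<bullet> c) + (z \<bullet> rot90 c) * (w \<bullet> rot90 c)"
    using arg_cong[OF *, of "\<lambda>v. v \<bullet> w"]
    by (simp add: inner_add_left inner_add_right inner_commute)
qed

lemma plane_norm_frame: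
  assumes "norm c = 1"
  shows "(norm z)\<^sup>2 = (z \<bullet> c)\<^sup>2 + (z \<bullet> rot90 c)\<^sup>2"
  unfolding power2_norm_eq_inner plane_frame(2)[OF assms, of z z] by (simp add: power2_eq_square)

definition direction :: "real \<Rightarrow> plane" where
  "direction \<theta> = (cos \<theta>, sin \<theta>)"

lemma norm_direction [simp]: "norm (direction \<theta>) = 1"
  by (simp add: direction_def norm_prod_def)

lemma direction_inner:
  "direction \<theta> \<bullet> direction \<phi> = cos (\<theta> - \<phi>)"
  "direction \<theta> \<bullet> rot90 (direction \<phi>) = sin (\<theta> - \<phi>)"
  by (simp_all add: direction_def rot90_def inner_prod_def cos_diff sin_diff algebra_simps)

lemma direction_frame:
  assumes "norm v = 1" "v \<bullet> direction \<phi> = cos t" "v \<bullet> rot90 (direction \<phi>) = sin t"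
  shows "v = direction (\<phi> + t)"
  using plane_frame(1)[OF norm_direction, of v \<phi>] assms(2,3)
  by (simp add: direction_def rot90_def cos_add sin_add algebra_simps)

lemma direction_eq_iff: "direction \<theta> = direction \<phi> \<longleftrightarrow> (\<exists>n::int. \<theta> = \<phi> + 2 * pi * n)"
  using sin_cos_eq_iff[of \<theta> \<phi>] by (auto simp: direction_def)

lemma circle_arc_direction:
  "circle_arc \<theta>0 \<alpha> = {direction \<theta> | \<theta>. \<bar>\<theta> - \<theta>0\<bar> < \<alpha>}"
  by (simp add: circle_arc_def direction_def)

text \<open>In polar coordinates \<open>(r, \<theta>)\<close> about the arc_axis of the arc, the defining inequality reads
  \<open>r sin (\<alpha> - \<bar>\<theta>\<bar>) > 0\<close>.\<close>

lemma circle_arc_iff: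
  assumes \<alpha>: "0 < \<alpha>" "\<alpha> < pi"
  shows "v \<in> circle_arc \<theta>0 \<alpha> \<longleftrightarrow> norm v = 1 \<and>
    (v \<bullet> direction \<theta>0) * sin \<alpha> > \<bar>v \<bullet> rot90 (direction \<theta>0)\<bar> * cos \<alpha>"
proof
  assume "v \<in> circle_arc \<theta>0 \<alpha>"
  then obtain \<theta> where v: "v = direction \<theta>" and \<theta>: "\<bar>\<theta> - \<theta>0\<bar> < \<alpha>"
    by (auto simp: circle_arc_direction)
  have s: "\<bar>sin (\<theta> - \<theta>0)\<bar> = sin \<bar>\<theta> - \<theta>0\<bar>"
    using \<theta> \<alpha> sin_ge_zero[of "\<bar>\<theta> - \<theta>0\<bar>"] sin_minus[of "\<theta>0 - \<theta>"]
    by (auto simp: abs_if split: if_splits)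
  have "sin (\<alpha> - \<bar>\<theta> - \<theta>0\<bar>) > 0"
    using \<theta> \<alpha> by (intro sin_gt_zero) auto
  then show "norm v = 1 \<and> (v \<bullet> direction \<theta>0) * sin \<alpha> > \<bar>v \<bullet> rot90 (direction \<theta>0)\<bar> * cos \<alpha>"
    by (simp add: v direction_inner s sin_diff[of \<alpha>] mult.commute)
next
  assume v: "norm v = 1 \<and> (v \<bullet> direction \<theta>0) * sin \<alpha> > \<bar>v \<bullet> rot90 (direction \<theta>0)\<bar> * cos \<alpha>"
  have "(v \<bullet> direction \<theta>0)\<^sup>2 + \<bar>v \<bullet> rot90 (direction \<theta>0)\<bar>\<^sup>2 = 1"
    using plane_norm_frame[OF norm_direction, of v \<theta>0] v by simp
  from sincos_total_pi[OF abs_ge_zero this]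
  obtain t where t: "0 \<le> t" "t \<le> pi" "v \<bullet> direction \<theta>0 = cos t" "\<bar>v \<bullet> rot90 (direction \<theta>0)\<bar> = sin t"
    by blast
  have "sin (\<alpha> - t) > 0"
    using v t by (simp add: sin_diff algebra_simps)
  then have "t < \<alpha>"
    using t \<alpha> sin_ge_zero[of "t - \<alpha>"] sin_minus[of "\<alpha> - t"] by fastforce
  define s where "s = (if v \<bullet> rot90 (direction \<theta>0) \<ge> 0 then t else - t)"
  have "v = direction (\<theta>0 + s)"
    using v t by (intro direction_frame) (auto simp: s_def)
  moreover have "\<bar>(\<theta>0 + s) - \<theta>0\<bar> < \<alpha>"
    using t \<open>t < \<alpha>\<close> by (simp add: s_def)
  ultimately show "v \<in> circle_arc \<theta>0 \<alpha>"
    unfolding circle_arc_direction by blast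
qed

text \<open>On the real line of angles, an interval of half-length \<open>\<alpha> > \<beta>\<close> about a point of the second arc would
  contain one of the two endpoints of (a translate of) the second interval, and these endpoints do not
  belong to the second arc. In particular the half-angle of an arc is well defined.\<close>

lemma circle_arc_subset_imp_le:
  assumes \<alpha>: "0 < \<alpha>" and \<beta>: "0 < \<beta>" "\<beta> < pi"
    and sub: "circle_arc \<theta>0 \<alpha> \<subseteq> circle_arc \<theta>1 \<beta>"
  shows "\<alpha> \<le> \<beta>"
proof (rule ccontr)
  assume "\<not> \<alpha> \<le> \<beta>"
  have endpoint: "direction (\<theta>1 + s * \<beta> + 2 * pi * n) \<notin> circle_arc \<theta>1 \<beta>"
    if "s = 1 \<or> s = - 1" for s and n :: int
  proof -
    have "direction (\<theta>1 + s * \<beta> + 2 * pi * n) = direction (\<theta>1 + s * \<beta>)"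
      by (subst direction_eq_iff) auto
    moreover have "\<bar>sin \<beta>\<bar> = sin \<beta>"
      using \<beta> by (simp add: sin_ge_zero)
    ultimately show ?thesis
      using that unfolding circle_arc_iff[OF \<beta>] by (auto simp: direction_inner)
  qed
  have "direction \<theta>0 \<in> circle_arc \<theta>1 \<beta>"
    using sub \<alpha> by (force simp: circle_arc_direction)
  then obtain \<theta> where "direction \<theta>0 = direction \<theta>" and \<theta>: "\<bar>\<theta> - \<theta>1\<bar> < \<beta>"
    by (auto simp: circle_arc_direction)
  then obtain n :: int where n: "\<theta>0 = \<theta> + 2 * pi * n"
    by (auto simp: direction_eq_iff)
  have "\<exists>s. (s = 1 \<or> s = - 1) \<and> \<bar>(\<theta>1 + s * \<beta> + 2 * pi * n) - \<theta>0\<bar> < \<alpha>"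
  proof (cases "\<theta> \<ge> \<theta>1")
    case True
    then show ?thesis
      using n \<theta> \<open>\<not> \<alpha> \<le> \<beta>\<close> by (intro exI[of _ 1]) auto
  next
    case False
    then show ?thesis
      using n \<theta> \<open>\<not> \<alpha> \<le> \<beta>\<close> by (intro exI[of _ "- 1"]) auto
  qed
  then show False
    using sub endpoint unfolding circle_arc_direction by blast
qed

definition arc_axis :: "plane set \<Rightarrow> plane" where
  "arc_axis I = direction (arc_centre I)"

definition along :: "plane set \<Rightarrow> plane \<Rightarrow> real" where
  "along I z = z \<bullet> arc_axis I"

definition across :: "plane set \<Rightarrow> plane \<Rightarrow> real" where
  "across I z = z \<bullet> rot90 (arc_axis I)"

text \<open>In polar coordinates about the axis of \<open>I\<close>, with half-angle \<open>\<alpha>\<close>, this is \<open>r sin (\<alpha> - \<bar>\<theta>\<bar>)\<close>. It is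
  positive exactly in the open sector over \<open>I\<close>, vanishes exactly on its two boundary half-lines, and is
  positively homogeneous and Lipschitz; all sectors are described by it.\<close>

definition wedge :: "plane set \<Rightarrow> plane \<Rightarrow> real" where
  "wedge I z = along I z * sin (arc_half_angle I) - \<bar>across I z\<bar> * cos (arc_half_angle I)"

definition grad_sector :: "plane set \<Rightarrow> plane \<Rightarrow> plane" where
  "grad_sector I z = - across I z *\<^sub>R arc_axis I
     + (2 * \<bar>across I z\<bar> * cot (arc_half_angle I) - along I z) *\<^sub>R rot90 (arc_axis I)"

text \<open>The formula for \<open>u\<close> on the sector, extended to the whole plane. The extension is \<open>C\<^sup>1\<close> because
  \<open>y \<bar>y\<bar>\<close> is, and \<open>grad_sector\<close> is its gradient.\<close>

definition u_sector :: "plane set \<Rightarrow> plane \<Rightarrow> real" where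
  "u_sector I z = across I z * (\<bar>across I z\<bar> * cot (arc_half_angle I) - along I z)"

lemma norm_axis [simp]: "norm (arc_axis I) = 1"
  by (simp add: arc_axis_def)

lemma frame_axis: "z = along I z *\<^sub>R arc_axis I + across I z *\<^sub>R rot90 (arc_axis I)"
  unfolding along_def across_def by (rule plane_frame) simp

lemma norm_along_across: "(norm z)\<^sup>2 = (along I z)\<^sup>2 + (across I z)\<^sup>2"
  unfolding along_def across_def by (rule plane_norm_frame) simp

lemma abs_along_le: "\<bar>along I z\<bar> \<le> norm z" and abs_across_le: "\<bar>across I z\<bar> \<le> norm z"
  using Cauchy_Schwarz_ineq2[of z "arc_axis I"] Cauchy_Schwarz_ineq2[of z "rot90 (arc_axis I)"]
  by (simp_all add: along_def across_def)

lemma along_across_linear: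
  "along I (z + w) = along I z + along I w" "across I (z + w) = across I z + across I w"
  "along I (z - w) = along I z - along I w" "across I (z - w) = across I z - across I w"
  "along I (r *\<^sub>R z) = r * along I z" "across I (r *\<^sub>R z) = r * across I z"
  "along I 0 = 0" "across I 0 = 0"
  by (simp_all add: along_def across_def inner_add_left inner_diff_left)

lemma along_across_axis [simp]: "along I (arc_axis I) = 1" "across I (arc_axis I) = 0"
  by (simp_all add: along_def across_def dot_square_norm)

lemma continuous_along [continuous_intros]: "continuous_on A f \<Longrightarrow> continuous_on A (\<lambda>x. along I (f x))"
  and continuous_across [continuous_intros]: "continuous_on A f \<Longrightarrow> continuous_on A (\<lambda>x. across I (f x))"
  and continuous_wedge [continuous_intros]: "continuous_on A f \<Longrightarrow> continuous_on A (\<lambda>x. wedge I (f x))"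
  unfolding wedge_def along_def across_def by (intro continuous_intros; assumption)+

lemma continuous_grad_sector: "continuous_on A (grad_sector I)"
  unfolding grad_sector_def[abs_def] by (intro continuous_intros continuous_on_id)

lemma wedge_scale: "r \<ge> 0 \<Longrightarrow> wedge I (r *\<^sub>R z) = r * wedge I z"
  by (simp add: wedge_def along_across_linear abs_mult algebra_simps)

lemma wedge_diff_le: "\<bar>wedge I z - wedge I w\<bar> \<le> 2 * norm (z - w)"
proof -
  let ?s = "sin (arc_half_angle I)" and ?c = "cos (arc_half_angle I)"
  have "\<bar>along I z - along I w\<bar> * \<bar>?s\<bar> \<le> norm (z - w) * 1"
    using abs_along_le[of I "z - w"] by (intro mult_mono) (auto simp: along_across_linear)
  moreover have "\<bar>\<bar>across I z\<bar> - \<bar>across I w\<bar>\<bar> * \<bar>?c\<bar> \<le> norm (z - w) * 1"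
    using abs_across_le[of I "z - w"] by (intro mult_mono) (auto simp: along_across_linear)
  moreover have "wedge I z - wedge I w = (along I z - along I w) * ?s - (\<bar>across I z\<bar> - \<bar>across I w\<bar>) * ?c"
    by (simp add: wedge_def algebra_simps)
  ultimately show ?thesis
    unfolding abs_mult[symmetric] by linarith
qed

lemma arc_half_angle:
  assumes "proper_open_arc I"
  shows "0 < arc_half_angle I" "arc_half_angle I < pi" "I = circle_arc (arc_centre I) (arc_half_angle I)"
    "sin (arc_half_angle I) > 0"
proof -
  have "\<exists>!\<alpha>. 0 < \<alpha> \<and> \<alpha> < pi \<and> (\<exists>\<theta>0. I = circle_arc \<theta>0 \<alpha>)"
  proof (rule ex_ex1I)
    show "\<exists>\<alpha>. 0 < \<alpha> \<and> \<alpha> < pi \<and> (\<exists>\<theta>0. I = circle_arc \<theta>0 \<alpha>)"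
      using assms unfolding proper_open_arc_def by blast
  next
    fix \<alpha> \<beta>
    assume "0 < \<alpha> \<and> \<alpha> < pi \<and> (\<exists>\<theta>0. I = circle_arc \<theta>0 \<alpha>)" "0 < \<beta> \<and> \<beta> < pi \<and> (\<exists>\<theta>0. I = circle_arc \<theta>0 \<beta>)"
    then show "\<alpha> = \<beta>"
      using circle_arc_subset_imp_le by (metis order_antisym order_refl)
  qed
  from theI'[OF this]
  have *: "0 < arc_half_angle I" "arc_half_angle I < pi" "\<exists>\<theta>0. I = circle_arc \<theta>0 (arc_half_angle I)"
    unfolding arc_half_angle_def by blast+
  then show "0 < arc_half_angle I" "arc_half_angle I < pi" "sin (arc_half_angle I) > 0"
    by (auto intro: sin_gt_zero)
  show "I = circle_arc (arc_centre I) (arc_half_angle I)"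
    unfolding arc_centre_def using *(3) by (rule someI_ex)
qed

lemma arc_iff_wedge:
  assumes "proper_open_arc I"
  shows "v \<in> I \<longleftrightarrow> norm v = 1 \<and> wedge I v > 0"
  using circle_arc_iff[OF arc_half_angle(1,2)[OF assms], of v "arc_centre I"] arc_half_angle(3)[OF assms]
  by (simp add: wedge_def along_def across_def arc_axis_def)

lemma wedge_axis_pos: "proper_open_arc I \<Longrightarrow> wedge I (arc_axis I) > 0"
  using arc_half_angle(4) by (simp add: wedge_def)

text \<open>The second form shows that \<open>u\<close> is continuous across the boundary of the sector; it is the one to estimate.\<close>

lemma u_arc_eq:
  assumes "proper_open_arc I"
  shows "u_arc I z = (if wedge I z > 0 then u_sector I z else 0)"
    and "u_arc I z = - (across I z / sin (arc_half_angle I)) * max 0 (wedge I z)"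
proof -
  let ?\<alpha> = "arc_half_angle I"
  note \<alpha> = arc_half_angle[OF assms]
  have rot: "rotation (- arc_centre I) z = (along I z, across I z)"
    by (cases z) (simp add: rotation_def along_def across_def arc_axis_def direction_def rot90_def
        inner_prod_def algebra_simps)
  have cone: "(x, y) \<in> ray_cone (circle_arc 0 ?\<alpha>) \<longleftrightarrow> (x, y) = 0 \<or> x * sin ?\<alpha> > \<bar>y\<bar> * cos ?\<alpha>" for x y
  proof -
    have d0: "direction 0 = (1, 0)" "rot90 (1, 0) = (0, 1)"
      by (simp_all add: direction_def rot90_def)
    have in_arc: "v \<in> circle_arc 0 ?\<alpha> \<longleftrightarrow> norm v = 1 \<and> fst v * sin ?\<alpha> > \<bar>snd v\<bar> * cos ?\<alpha>" for v
      using circle_arc_iff[OF \<alpha>(1,2), of v 0] by (simp add: d0 inner_prod_def)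
    show ?thesis
    proof
      assume "(x, y) \<in> ray_cone (circle_arc 0 ?\<alpha>)"
      then obtain r v where rv: "(x, y) = r *\<^sub>R v" "r \<ge> 0" "v \<in> circle_arc 0 ?\<alpha>"
        unfolding ray_cone_def by blast
      then have "r * (\<bar>snd v\<bar> * cos ?\<alpha>) < r * (fst v * sin ?\<alpha>)" if "r \<noteq> 0"
        using that by (intro mult_strict_left_mono) (auto simp: in_arc)
      moreover have "x = r * fst v" "y = r * snd v"
        using rv(1) by (auto simp: prod_eq_iff)
      ultimately show "(x, y) = 0 \<or> x * sin ?\<alpha> > \<bar>y\<bar> * cos ?\<alpha>"
        using rv(2) by (cases "r = 0") (auto simp: abs_mult zero_prod_def mult.assoc)
    next
      assume *: "(x, y) = 0 \<or> x * sin ?\<alpha> > \<bar>y\<bar> * cos ?\<alpha>"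
      have "(1, 0) \<in> circle_arc 0 ?\<alpha>"
        using \<alpha>(4) by (simp add: in_arc norm_prod_def)
      show "(x, y) \<in> ray_cone (circle_arc 0 ?\<alpha>)"
      proof (cases "(x, y) = 0")
        case True
        then show ?thesis
          using \<open>(1, 0) \<in> circle_arc 0 ?\<alpha>\<close> unfolding ray_cone_def mem_Collect_eq
          by (intro exI[of _ 0] exI[of _ "(1, 0)"]) (simp add: zero_prod_def)
      next
        case False
        define r where "r = norm (x, y)"
        have r: "r > 0" using False by (simp add: r_def)
        have "(\<bar>y\<bar> * cos ?\<alpha>) / r < (x * sin ?\<alpha>) / r"
          using * False r by (intro divide_strict_right_mono) auto
        then have "(1 / r) *\<^sub>R (x, y) \<in> circle_arc 0 ?\<alpha>"
          using r norm_scaleR[of "1 / r" "(x, y)"] by (simp add: in_arc r_def[symmetric] abs_mult)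
        moreover have "(x, y) = r *\<^sub>R ((1 / r) *\<^sub>R (x, y))"
          using r by simp
        ultimately show ?thesis
          using r unfolding ray_cone_def by (metis (mono_tags, lifting) mem_Collect_eq less_imp_le)
      qed
    qed
  qed
  show 1: "u_arc I z = (if wedge I z > 0 then u_sector I z else 0)"
    unfolding u_arc_def o_def rot u_centred_def
    by (auto simp: cone wedge_def u_sector_def zero_prod_def)
  have "cot ?\<alpha> = cos ?\<alpha> / sin ?\<alpha>" by (simp add: cot_def)
  then have "u_sector I z = - (across I z / sin ?\<alpha>) * wedge I z"
    using \<alpha>(4) by (simp add: u_sector_def wedge_def field_simps)
  then show "u_arc I z = - (across I z / sin ?\<alpha>) * max 0 (wedge I z)"
    unfolding 1 by (auto simp: max_def)
qed

lemma u_sector_has_derivative: "(u_sector I has_derivative (\<lambda>h. grad_sector I z \<bullet> h)) (at z)"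
proof -
  have sq: "((\<lambda>y. y * \<bar>y\<bar>) has_real_derivative 2 * \<bar>y\<bar>) (at y)" for y :: real
  proof -
    have "((\<lambda>y. sqpos y - sqpos (- y)) has_real_derivative 2 * max 0 y - (2 * max 0 (- y)) * (- 1)) (at y)"
      by (intro DERIV_diff sqpos_has_real_derivative DERIV_chain2[OF sqpos_has_real_derivative])
        (auto intro!: derivative_eq_intros)
    moreover have "(\<lambda>y. sqpos y - sqpos (- y)) = (\<lambda>y. y * \<bar>y\<bar>)"
      by (auto simp: fun_eq_iff sqpos_def max_def power2_eq_square)
    moreover have "2 * max 0 y - (2 * max 0 (- y)) * (- 1) = 2 * \<bar>y\<bar>"
      by (auto simp: max_def)
    ultimately show ?thesis by simp
  qed
  have a: "(across I has_derivative (\<lambda>h. h \<bullet> rot90 (arc_axis I))) (at z)"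
    "(along I has_derivative (\<lambda>h. h \<bullet> arc_axis I)) (at z)"
    unfolding across_def[abs_def] along_def[abs_def] by (auto intro!: derivative_eq_intros)
  have "((\<lambda>z. (across I z * \<bar>across I z\<bar>) * cot (arc_half_angle I) - across I z * along I z) has_derivative
      (\<lambda>h. 2 * \<bar>across I z\<bar> * (h \<bullet> rot90 (arc_axis I)) * cot (arc_half_angle I)
        - (across I z * (h \<bullet> arc_axis I) + (h \<bullet> rot90 (arc_axis I)) * along I z))) (at z)"
    by (intro has_derivative_diff has_derivative_mult_left has_derivative_mult a
        has_derivative_compose[OF a(1) sq[unfolded has_field_derivative_def]])
  moreover have "u_sector I = (\<lambda>z. (across I z * \<bar>across I z\<bar>) * cot (arc_half_angle I) - across I z * along I z)"
    by (rule ext) (simp add: u_sector_def algebra_simps)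
  moreover have "(\<lambda>h. 2 * \<bar>across I z\<bar> * (h \<bullet> rot90 (arc_axis I)) * cot (arc_half_angle I)
        - (across I z * (h \<bullet> arc_axis I) + (h \<bullet> rot90 (arc_axis I)) * along I z)) = (\<lambda>h. grad_sector I z \<bullet> h)"
    by (rule ext) (simp add: grad_sector_def inner_add_left inner_commute algebra_simps)
  ultimately show ?thesis by metis
qed

lemma arc_point_of_wedge_pos:
  assumes "proper_open_arc I" "wedge I z > 0"
  shows "(1 / norm z) *\<^sub>R z \<in> I"
proof -
  have "z \<noteq> 0"
    using assms(2) by (auto simp: wedge_def along_across_linear)
  then show ?thesis
    using assms wedge_scale[of "1 / norm z" I z] by (simp add: arc_iff_wedge)
qed

text \<open>An arc longer than a half circle contains every unit vector \<open>v\<close> with \<open>v \<bullet> c \<ge> 0\<close>, where \<open>c\<close> is its centre.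
  One of the two unit vectors orthogonal to the axis of \<open>I\<close> therefore belongs to both arcs.\<close>

lemma obtuse_arcs_meet:
  assumes I: "proper_open_arc I" "cos (arc_half_angle I) < 0"
    and J: "proper_open_arc J" "cos (arc_half_angle J) < 0"
  shows "I \<inter> J \<noteq> {}"
proof -
  define s :: real where "s = (if along J (rot90 (arc_axis I)) \<ge> 0 then 1 else - 1)"
  define v where "v = s *\<^sub>R rot90 (arc_axis I)"
  have s: "s = 1 \<or> s = - 1" by (simp add: s_def)
  have v: "norm v = 1" using s by (auto simp: v_def)
  have "along I v = 0" "\<bar>across I v\<bar> = 1"
    using s by (auto simp: v_def along_def across_def inner_commute[of _ "arc_axis I"] dot_square_norm)
  then have "v \<in> I"
    using I v by (simp add: arc_iff_wedge wedge_def)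
  moreover have "along J v \<ge> 0"
    by (auto simp: v_def s_def along_across_linear)
  moreover have "along J v \<noteq> 0 \<or> across J v \<noteq> 0"
    using norm_along_across[of v J] v by auto
  ultimately have "wedge J v > 0"
  proof -
    have "along J v * sin (arc_half_angle J) \<ge> 0" "\<bar>across J v\<bar> * - cos (arc_half_angle J) \<ge> 0"
      using \<open>along J v \<ge> 0\<close> arc_half_angle(4)[OF J(1)] J(2) by (intro mult_nonneg_nonneg; simp)+
    moreover have "along J v * sin (arc_half_angle J) \<noteq> 0 \<or> \<bar>across J v\<bar> * - cos (arc_half_angle J) \<noteq> 0"
      using \<open>along J v \<noteq> 0 \<or> across J v \<noteq> 0\<close> arc_half_angle(4)[OF J(1)] J(2) by auto
    ultimately show ?thesis unfolding wedge_def by (auto simp: less_le)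
  qed
  then have "v \<in> J" using J v by (simp add: arc_iff_wedge)
  with \<open>v \<in> I\<close> show ?thesis by blast
qed

text \<open>The quotient of \<open>\<bar>across I z\<bar>\<close> by the sine of the half-angle is half the length of the horizontal normal
  over the sector, so that \<open>L\<close> controls the slopes of all pieces of the surface at once.\<close>

definition slope_bound :: "real \<Rightarrow> plane set set \<Rightarrow> bool" where
  "slope_bound L \<F> \<longleftrightarrow> L \<ge> 1 \<and>
     (\<forall>I\<in>\<F>. \<forall>z. wedge I z > 0 \<longrightarrow> \<bar>across I z\<bar> \<le> L * sin (arc_half_angle I) * norm z)"

lemma slope_boundD:
  assumes "slope_bound L \<F>"
  shows "L \<ge> 1"
    and "I \<in> \<F> \<Longrightarrow> wedge I z > 0 \<Longrightarrow> \<bar>across I z\<bar> \<le> L * sin (arc_half_angle I) * norm z"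
  using assms unfolding slope_bound_def by blast+

lemma slope_bound_subset: "slope_bound L \<F> \<Longrightarrow> \<G> \<subseteq> \<F> \<Longrightarrow> slope_bound L \<G>"
  unfolding slope_bound_def by blast

lemma across_le_acute:
  assumes "proper_open_arc I" "cos (arc_half_angle I) \<ge> 0" "wedge I z > 0"
  shows "\<bar>across I z\<bar> \<le> sin (arc_half_angle I) * norm z"
proof -
  let ?s = "sin (arc_half_angle I)" and ?c = "cos (arc_half_angle I)"
  have s: "?s > 0" using assms(1) by (rule arc_half_angle)
  have "\<bar>across I z\<bar> * ?c \<le> along I z * ?s"
    using assms(3) by (simp add: wedge_def)
  then have "(\<bar>across I z\<bar> * ?c)\<^sup>2 \<le> (along I z * ?s)\<^sup>2"
    using assms(2) by (intro power_mono) auto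
  then have "(across I z)\<^sup>2 * ?c\<^sup>2 \<le> ((norm z)\<^sup>2 - (across I z)\<^sup>2) * ?s\<^sup>2"
    by (simp add: power_mult_distrib norm_along_across[of z I])
  moreover have "(across I z)\<^sup>2 = (across I z)\<^sup>2 * ?c\<^sup>2 + (across I z)\<^sup>2 * ?s\<^sup>2"
    by (simp flip: distrib_left)
  ultimately have "\<bar>across I z\<bar>\<^sup>2 \<le> (?s * norm z)\<^sup>2"
    by (simp add: left_diff_distrib right_diff_distrib power_mult_distrib mult.commute)
  then show ?thesis
    by (rule power2_le_imp_le) (use s in simp)
qed

text \<open>Over each half of a sector, the horizontal normal is a nonnegative multiple of a fixed vector: the endpoint \<open>k z\<close>
  of the arc on the side of \<open>z\<close>, turned by \<open>- \<pi> / 2\<close>.\<close>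

lemma grad_normal:
  assumes "proper_open_arc I"
  defines "\<sigma> \<equiv> \<lambda>z. if across I z \<ge> 0 then 1 else - 1 :: real"
  defines "k \<equiv> \<lambda>z. cos (arc_half_angle I) *\<^sub>R arc_axis I + (\<sigma> z * sin (arc_half_angle I)) *\<^sub>R rot90 (arc_axis I)"
  shows "- (rot90 z + grad_sector I z) = (2 * \<bar>across I z\<bar> / sin (arc_half_angle I)) *\<^sub>R (- rot90 (k z))"
    and "norm (k z) = 1"
    and "along I (k z) = cos (arc_half_angle I)" "across I (k z) = \<sigma> z * sin (arc_half_angle I)"
proof -
  let ?s = "sin (arc_half_angle I)"
  have s: "?s > 0" using assms(1) by (rule arc_half_angle)
  have rz: "rot90 z = along I z *\<^sub>R rot90 (arc_axis I) - across I z *\<^sub>R arc_axis I"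
    using arg_cong[OF frame_axis[of z I], of rot90] by (simp add: rot90_linear)
  have rk: "- rot90 (k z) = - cos (arc_half_angle I) *\<^sub>R rot90 (arc_axis I) + (\<sigma> z * ?s) *\<^sub>R arc_axis I"
    by (simp add: k_def rot90_linear)
  have a: "\<bar>across I z\<bar> * \<sigma> z = across I z"
    by (simp add: \<sigma>_def)
  show "- (rot90 z + grad_sector I z) = (2 * \<bar>across I z\<bar> / ?s) *\<^sub>R (- rot90 (k z))"
  proof -
    have "- (rot90 z + grad_sector I z)
        = (2 * across I z) *\<^sub>R arc_axis I - (2 * \<bar>across I z\<bar> * cot (arc_half_angle I)) *\<^sub>R rot90 (arc_axis I)"
    proof -
      have "- (al *\<^sub>R w - ac *\<^sub>R v + (- ac *\<^sub>R v + (k - al) *\<^sub>R w)) = (2 * ac) *\<^sub>R v - k *\<^sub>R w"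
        for al ac k and v w :: plane
        by (simp add: prod_eq_iff algebra_simps)
      then show ?thesis unfolding rz grad_sector_def .
    qed
    also have "\<dots> = (2 * \<bar>across I z\<bar> / ?s) *\<^sub>R (- rot90 (k z))"
    proof -
      have "2 * \<bar>across I z\<bar> / ?s * (\<sigma> z * ?s) = 2 * (\<bar>across I z\<bar> * \<sigma> z)"
        using s by simp
      moreover have "2 * \<bar>across I z\<bar> / ?s * cos (arc_half_angle I) = 2 * \<bar>across I z\<bar> * cot (arc_half_angle I)"
        by (simp add: cot_def)
      ultimately show ?thesis
        unfolding rk scaleR_add_right scaleR_scaleR a by (simp add: algebra_simps)
    qed
    finally show ?thesis .
  qed
  show al: "along I (k z) = cos (arc_half_angle I)" and ac: "across I (k z) = \<sigma> z * ?s"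
    by (simp_all add: k_def along_def across_def inner_add_left dot_square_norm)
  have "(norm (k z))\<^sup>2 = 1"
    unfolding norm_along_across[of "k z" I] al ac by (simp add: power_mult_distrib \<sigma>_def)
  then show "norm (k z) = 1"
    using norm_ge_zero[of "k z"] by (auto simp: power2_eq_1_iff)
qed

lemma norm_normal:
  assumes "proper_open_arc I"
  shows "norm (rot90 z + grad_sector I z) = 2 * \<bar>across I z\<bar> / sin (arc_half_angle I)"
  using arg_cong[OF grad_normal(1)[OF assms, of z], of norm] grad_normal(2)[OF assms, of z]
    arc_half_angle(4)[OF assms]
  by (simp only: norm_minus_cancel norm_scaleR rot90_simps) simp

text \<open>On the boundary half-lines the gradient is the rotation field, whatever the half-angle. This is why
  adjacent sectors fit together in a \<open>C\<^sup>1\<close> way, whereas a sector and a gap, where \<open>u\<close> vanishes, do not.\<close>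

lemma grad_boundary:
  assumes "proper_open_arc I" "wedge I z = 0"
  shows "grad_sector I z = rot90 z"
proof -
  have "sin (arc_half_angle I) > 0" using assms(1) by (rule arc_half_angle)
  then have "along I z = \<bar>across I z\<bar> * cot (arc_half_angle I)"
    using assms(2) by (simp add: wedge_def cot_def field_simps)
  then have "2 * \<bar>across I z\<bar> * cot (arc_half_angle I) - along I z = along I z" by simp
  then show ?thesis
    using arg_cong[OF frame_axis[of z I], of rot90] by (simp add: grad_sector_def rot90_linear)
qed

lemma u_sector_boundary:
  assumes "proper_open_arc I" "wedge I z = 0"
  shows "u_sector I z = 0"
proof -
  have "sin (arc_half_angle I) > 0" using assms(1) by (rule arc_half_angle)
  then have "along I z = \<bar>across I z\<bar> * cot (arc_half_angle I)"
    using assms(2) by (simp add: wedge_def cot_def field_simps)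
  then show ?thesis by (simp add: u_sector_def)
qed

text \<open>The constant must not depend on the arc. For short arcs \<open>1 / sin \<alpha>\<close> is large, but on the sector both quotients
  \<open>across / sin \<alpha>\<close> and \<open>wedge / sin \<alpha>\<close> remain bounded by multiples of the norm.\<close>

lemma u_arc_lipschitz:
  assumes I: "proper_open_arc I" and L: "slope_bound L {I}" and R: "norm z \<le> R" "norm w \<le> R"
  shows "\<bar>u_arc I z - u_arc I w\<bar> \<le> (3 * L + 1) * R * norm (z - w)"
proof -
  let ?s = "sin (arc_half_angle I)"
  have s: "?s > 0" using I by (rule arc_half_angle)
  have L1: "L \<ge> 1" using L by (rule slope_boundD)
  have R0: "R \<ge> 0" using R(1) norm_ge_zero order_trans by blast
  define a where "a z = across I z / ?s" for z
  have a: "\<bar>a z\<bar> \<le> L * R" if "wedge I z > 0" "norm z \<le> R" for z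
  proof -
    have "\<bar>across I z\<bar> \<le> L * ?s * norm z"
      using slope_boundD(2)[OF L _ that(1)] by simp
    also have "\<dots> \<le> L * ?s * R"
      using L1 s that(2) by (intro mult_left_mono) auto
    finally show ?thesis
      using s by (simp add: a_def field_simps)
  qed
  have u: "u_arc I z = - a z * max 0 (wedge I z)" for z
    using u_arc_eq(2)[OF I] by (simp add: a_def)
  have d: "wedge I z - wedge I w \<le> 2 * norm (z - w)" "wedge I w - wedge I z \<le> 2 * norm (z - w)"
    using wedge_diff_le[of I z w] by auto
  have large: "2 * L * R * norm (z - w) \<le> (3 * L + 1) * R * norm (z - w)"
    using L1 R0 by (intro mult_right_mono) auto
  consider "wedge I z > 0" "wedge I w > 0" | "wedge I z > 0" "wedge I w \<le> 0" | "wedge I z \<le> 0" "wedge I w > 0"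
    | "wedge I z \<le> 0" "wedge I w \<le> 0" by linarith
  then show ?thesis
  proof cases
    case 1
    have "\<bar>a z * (wedge I z - wedge I w)\<bar> \<le> (L * R) * (2 * norm (z - w))"
      unfolding abs_mult using a[OF 1(1) R(1)] wedge_diff_le[of I z w] L1 R0 by (intro mult_mono) auto
    moreover have "\<bar>wedge I w / ?s * across I (z - w)\<bar> \<le> ((1 + L) * R) * norm (z - w)"
    proof -
      have "\<bar>\<bar>a w\<bar> * cos (arc_half_angle I)\<bar> \<le> (L * R) * 1"
        unfolding abs_mult using a[OF 1(2) R(2)] L1 R0 by (intro mult_mono) auto
      moreover have "wedge I w / ?s = along I w - \<bar>a w\<bar> * cos (arc_half_angle I)"
        using s by (simp add: wedge_def a_def field_simps)
      moreover have "\<bar>along I w\<bar> \<le> R"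
        using abs_along_le[of I w] R(2) by linarith
      ultimately have "\<bar>wedge I w / ?s\<bar> \<le> (1 + L) * R"
        unfolding distrib_right by linarith
      then show ?thesis
        unfolding abs_mult using abs_across_le[of I "z - w"] L1 R0 by (intro mult_mono) auto
    qed
    moreover have "u_arc I z - u_arc I w = - (a z * (wedge I z - wedge I w)) - wedge I w / ?s * across I (z - w)"
      using 1 s by (simp add: u a_def along_across_linear field_simps)
    ultimately have "\<bar>u_arc I z - u_arc I w\<bar> \<le> (L * R) * (2 * norm (z - w)) + ((1 + L) * R) * norm (z - w)"
      by linarith
    then show ?thesis
      by (simp add: algebra_simps)
  next
    case 2
    then have "\<bar>u_arc I z - u_arc I w\<bar> = \<bar>a z\<bar> * wedge I z"
      by (simp add: u abs_mult)
    also have "\<dots> \<le> (L * R) * (2 * norm (z - w))"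
      using a[OF 2(1) R(1)] d 2 L1 R0 by (intro mult_mono) auto
    finally show ?thesis using large by simp
  next
    case 3
    then have "\<bar>u_arc I z - u_arc I w\<bar> = \<bar>a w\<bar> * wedge I w"
      by (simp add: u abs_mult)
    also have "\<dots> \<le> (L * R) * (2 * norm (z - w))"
      using a[OF 3(2) R(2)] d 3 L1 R0 by (intro mult_mono) auto
    finally show ?thesis using large by simp
  next
    case 4
    then show ?thesis using L1 R0 by (simp add: u)
  qed
qed

section \<open>Families of disjoint arcs\<close>

definition locally_lipschitz :: "(plane \<Rightarrow> real) \<Rightarrow> bool" where
  "locally_lipschitz u \<longleftrightarrow> (\<forall>R. \<exists>L. \<forall>z w. norm z \<le> R \<and> norm w \<le> R \<longrightarrow> \<bar>u z - u w\<bar> \<le> L * norm (z - w))"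

lemma locally_lipschitzE:
  assumes "locally_lipschitz u"
  obtains L where "L > 0" "\<And>w. norm (w - z) \<le> 1 \<Longrightarrow> \<bar>u w - u z\<bar> \<le> L * norm (w - z)"
proof -
  obtain L where L: "\<And>v w. norm v \<le> norm z + 1 \<and> norm w \<le> norm z + 1 \<longrightarrow> \<bar>u v - u w\<bar> \<le> L * norm (v - w)"
    using assms unfolding locally_lipschitz_def by blast
  have "\<bar>u w - u z\<bar> \<le> (\<bar>L\<bar> + 1) * norm (w - z)" if "norm (w - z) \<le> 1" for w
  proof -
    have "norm w \<le> norm z + 1"
      using norm_triangle_ineq2[of w z] that by linarith
    then have "\<bar>u w - u z\<bar> \<le> L * norm (w - z)"
      using L[of w z] by simp
    also have "\<dots> \<le> (\<bar>L\<bar> + 1) * norm (w - z)"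
      by (intro mult_right_mono) auto
    finally show ?thesis .
  qed
  then show ?thesis by (intro that[of "\<bar>L\<bar> + 1"]) auto
qed

lemma locally_lipschitz_continuous:
  assumes "locally_lipschitz u"
  shows "continuous_on UNIV u"
proof -
  have "isCont u z" for z
  proof -
    obtain L where L: "L > 0" "\<And>w. norm (w - z) \<le> 1 \<Longrightarrow> \<bar>u w - u z\<bar> \<le> L * norm (w - z)"
      by (rule locally_lipschitzE[OF assms], rule that)
    have "\<forall>\<^sub>F w in at z. norm (u w - u z) \<le> L * norm (w - z)"
      unfolding eventually_at using L(2) by (intro exI[of _ 1]) (simp add: dist_norm)
    moreover have "((\<lambda>w. L * norm (w - z)) \<longlongrightarrow> 0) (at z)"
      by (intro tendsto_eq_intros) auto
    ultimately have "((\<lambda>w. u w - u z) \<longlongrightarrow> 0) (at z)"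
      by (rule Lim_null_comparison)
    then show ?thesis
      unfolding isCont_def by (rule LIM_zero_cancel)
  qed
  then show ?thesis by (simp add: continuous_at_imp_continuous_on)
qed

definition grad_family :: "plane set set \<Rightarrow> plane \<Rightarrow> plane" where
  "grad_family \<F> z = (\<Sum>\<^sub>\<infinity>I\<in>\<F>. if wedge I z > 0 then grad_sector I z else 0)"

locale arc_family =
  fixes \<I> :: "plane set set"
  assumes arc: "I \<in> \<I> \<Longrightarrow> proper_open_arc I"
    and disj: "pairwise disjnt \<I>"
begin

lemma subfamily: "\<F> \<subseteq> \<I> \<Longrightarrow> arc_family \<F>"
  using arc disj by (auto simp: arc_family_def intro: pairwise_subset)

text \<open>Arcs of half-angle at most \<open>\<pi> / 2\<close> have slope bound 1, and at most one member of the family is longer.\<close>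

lemma slope_bound_exists: "\<exists>L. slope_bound L \<I>"
proof (cases "\<exists>I\<in>\<I>. cos (arc_half_angle I) < 0")
  case False
  then show ?thesis
    using across_le_acute arc unfolding slope_bound_def
    by (intro exI[of _ 1] conjI ballI allI impI) (simp_all add: not_less)
next
  case True
  then obtain I where I: "I \<in> \<I>" "cos (arc_half_angle I) < 0" by blast
  let ?L = "1 / sin (arc_half_angle I)"
  have s: "sin (arc_half_angle I) > 0" using arc[OF I(1)] by (rule arc_half_angle)
  then have L: "?L \<ge> 1" by simp
  have "\<bar>across J z\<bar> \<le> ?L * sin (arc_half_angle J) * norm z" if "J \<in> \<I>" "wedge J z > 0" for J z
  proof (cases "J = I")
    case True
    then show ?thesis using s abs_across_le by simp
  next
    case False
    then have "cos (arc_half_angle J) \<ge> 0"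
      using obtuse_arcs_meet[OF arc[OF I(1)] I(2) arc[OF that(1)]] pairwiseD[OF disj I(1) that(1)]
      unfolding disjnt_def by (metis linorder_not_less)
    then have "\<bar>across J z\<bar> \<le> 1 * (sin (arc_half_angle J) * norm z)"
      using across_le_acute arc that by simp
    also have "\<dots> \<le> ?L * (sin (arc_half_angle J) * norm z)"
      using L arc_half_angle(4)[OF arc[OF that(1)]] by (intro mult_right_mono) auto
    finally show ?thesis by (simp add: mult.assoc)
  qed
  then show ?thesis using L unfolding slope_bound_def by blast
qed

text \<open>Disjointness of the arcs in the form used throughout: an open sector does not meet the other
  closed sectors.\<close>

lemma wedge_unique:
  assumes I: "I \<in> \<I>" "wedge I z > 0" and J: "J \<in> \<I>" "wedge J z \<ge> 0"
  shows "I = J"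
proof (rule ccontr)
  assume "I \<noteq> J"
  \<comment> \<open>A small shift along the arc_axis of \<open>J\<close> leads into both open sectors.\<close>
  define e where "e = wedge I z / 4"
  define w where "w = z + e *\<^sub>R arc_axis J"
  have e: "e > 0" using I by (simp add: e_def)
  have "\<bar>wedge I w - wedge I z\<bar> \<le> 2 * e"
    using wedge_diff_le[of I w z] e by (simp add: w_def)
  then have "wedge I w > 0" using I(2) unfolding e_def by linarith
  moreover have "wedge J w = wedge J z + e * sin (arc_half_angle J)"
    by (simp add: w_def wedge_def along_across_linear algebra_simps)
  then have "wedge J w > 0"
    using e J(2) arc_half_angle(4)[OF arc[OF J(1)]] by (simp add: add_nonneg_pos)
  ultimately have "(1 / norm w) *\<^sub>R w \<in> I \<inter> J"
    using arc_point_of_wedge_pos arc I J by blast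
  then show False
    using disj I J \<open>I \<noteq> J\<close> unfolding pairwise_def disjnt_def by blast
qed

text \<open>The infinite sums in the definitions have at most one nonzero term.\<close>

lemma infsum_sector:
  fixes f :: "plane set \<Rightarrow> 'b::{topological_comm_monoid_add, t2_space}"
  assumes "I \<in> \<I>" "wedge I z > 0" "\<And>J. wedge J z \<le> 0 \<Longrightarrow> f J = 0"
  shows "infsum f \<I> = f I"
proof -
  have "f J = 0" if "J \<noteq> I" "J \<in> \<I>" for J
    using assms wedge_unique[of I z J] that by force
  then have "infsum f \<I> = infsum f {I}"
    using assms(1) by (intro infsum_cong_neutral) auto
  then show ?thesis by simp
qed

lemma u_family_in:
  assumes "I \<in> \<I>" "wedge I z > 0"
  shows "u_family \<I> z = u_sector I z" "u_family \<I> z = u_arc I z" "grad_family \<I> z = grad_sector I z"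
proof -
  have "infsum (\<lambda>J. if wedge J z > 0 then u_sector J z else 0) \<I> = u_sector I z"
    using infsum_sector[OF assms, of "\<lambda>J. if wedge J z > 0 then u_sector J z else 0"] assms by simp
  moreover have "u_family \<I> z = infsum (\<lambda>J. if wedge J z > 0 then u_sector J z else 0) \<I>"
    unfolding u_family_def using u_arc_eq(1) arc by (intro infsum_cong) auto
  ultimately show "u_family \<I> z = u_sector I z" by simp
  then show "u_family \<I> z = u_arc I z"
    using u_arc_eq(1)[OF arc] assms by simp
  show "grad_family \<I> z = grad_sector I z"
    unfolding grad_family_def
    using infsum_sector[OF assms, of "\<lambda>J. if wedge J z > 0 then grad_sector J z else 0"] assms by simp
qed

lemma u_family_out:
  assumes "\<And>I. I \<in> \<I> \<Longrightarrow> wedge I z \<le> 0"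
  shows "u_family \<I> z = 0" "grad_family \<I> z = 0"
proof -
  show "u_family \<I> z = 0"
    unfolding u_family_def
  proof (rule infsum_0)
    show "u_arc I z = 0" if "I \<in> \<I>" for I
      using u_arc_eq(1)[OF arc[OF that], of z] assms[OF that] by simp
  qed
  show "grad_family \<I> z = 0"
    unfolding grad_family_def using assms by (intro infsum_0) fastforce
qed

lemma norm_grad_family:
  assumes "slope_bound L \<I>"
  shows "norm (grad_family \<I> z) \<le> (2 * L + 1) * norm z"
proof (cases "\<exists>I\<in>\<I>. wedge I z > 0")
  case True
  then obtain I where I: "I \<in> \<I>" "wedge I z > 0" by blast
  have s: "sin (arc_half_angle I) > 0" using arc[OF I(1)] by (rule arc_half_angle)
  have "norm (rot90 z + grad_sector I z) = 2 * \<bar>across I z\<bar> / sin (arc_half_angle I)"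
    by (rule norm_normal[OF arc[OF I(1)]])
  also have "\<dots> \<le> 2 * L * norm z"
    using slope_boundD(2)[OF assms I] s by (simp add: field_simps)
  finally have "norm (grad_sector I z) \<le> 2 * L * norm z + norm z"
    using norm_triangle_ineq4[of "rot90 z + grad_sector I z" "rot90 z"] by simp
  then show ?thesis
    using u_family_in[OF I] by (simp add: algebra_simps)
next
  case False
  then show ?thesis
    using u_family_out(2)[of z] slope_boundD(1)[OF assms] by (simp add: not_less)
qed

lemma u_family_lipschitz:
  assumes L: "slope_bound L \<I>" and R: "norm z \<le> R" "norm w \<le> R"
  shows "\<bar>u_family \<I> z - u_family \<I> w\<bar> \<le> 2 * ((3 * L + 1) * R) * norm (z - w)"
proof -
  let ?C = "(3 * L + 1) * R * norm (z - w)"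
  have lip: "\<bar>u_arc I z - u_arc I w\<bar> \<le> ?C" if "I \<in> \<I>" for I
    using that by (intro u_arc_lipschitz arc R slope_bound_subset[OF L]) auto
  have "R \<ge> 0" using R(1) norm_ge_zero order_trans by blast
  then have C: "?C \<ge> 0" using slope_boundD(1)[OF L] by simp
  have zero: "u_arc I v = 0" if "I \<in> \<I>" "\<not> wedge I v > 0" for I v
    using that u_arc_eq(1)[OF arc] by simp
  show ?thesis
  proof (cases "\<exists>I\<in>\<I>. wedge I z > 0 \<and> wedge I w > 0")
    case True
    then obtain I where "I \<in> \<I>" "wedge I z > 0" "wedge I w > 0" by blast
    then show ?thesis
      using lip[of I] C by (simp add: u_family_in(2))
  next
    case False
    have "\<bar>u_family \<I> z\<bar> \<le> ?C"
    proof (cases "\<exists>I\<in>\<I>. wedge I z > 0")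
      case True
      then show ?thesis
        using lip zero False by (metis u_family_in(2) diff_zero)
    next
      case False
      then show ?thesis using u_family_out(1)[of z] C by (auto simp: not_less)
    qed
    moreover have "\<bar>u_family \<I> w\<bar> \<le> ?C"
    proof (cases "\<exists>I\<in>\<I>. wedge I w > 0")
      case True
      then show ?thesis
        using lip zero False by (metis u_family_in(2) abs_minus_commute diff_zero)
    next
      case False
      then show ?thesis using u_family_out(1)[of w] C by (auto simp: not_less)
    qed
    ultimately show ?thesis by linarith
  qed
qed

lemma locally_lipschitz_u_family: "locally_lipschitz (u_family \<I>)"
proof -
  obtain L where L: "slope_bound L \<I>" using slope_bound_exists by blast
  show ?thesis
    unfolding locally_lipschitz_def using u_family_lipschitz[OF L] by blast
qed

lemma continuous_u_family: "continuous_on UNIV (u_family \<I>)"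
  by (rule locally_lipschitz_continuous[OF locally_lipschitz_u_family])

lemma u_family_has_derivative_in:
  assumes "I \<in> \<I>" "wedge I z > 0"
  shows "(u_family \<I> has_derivative (\<lambda>h. grad_sector I z \<bullet> h)) (at z)"
proof (rule has_derivative_transform_within_open[OF u_sector_has_derivative])
  show "open {z. wedge I z > 0}"
    by (intro open_Collect_less continuous_intros continuous_on_id)
qed (use assms u_family_in(1) in auto)

lemma u_family_has_derivative_finite:
  assumes "finite \<I>" "\<And>I. I \<in> \<I> \<Longrightarrow> wedge I z \<noteq> 0"
  shows "(u_family \<I> has_derivative (\<lambda>h. grad_family \<I> z \<bullet> h)) (at z)"
proof (cases "\<exists>I\<in>\<I>. wedge I z > 0")
  case True
  then show ?thesis
    using u_family_has_derivative_in u_family_in(3) by metis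
next
  case False
  have "((\<lambda>_. 0) has_derivative (\<lambda>h. grad_family \<I> z \<bullet> h)) (at z)"
    using False u_family_out(2)[of z] by (auto simp: not_less)
  then show ?thesis
  proof (rule has_derivative_transform_within_open)
    show "open (\<Inter>I\<in>\<I>. {z. wedge I z < 0})"
      using assms(1) by (intro open_INT ballI open_Collect_less continuous_intros continuous_on_id)
    show "z \<in> (\<Inter>I\<in>\<I>. {z. wedge I z < 0})"
      using False assms(2) by force
    show "0 = u_family \<I> w" if "w \<in> (\<Inter>I\<in>\<I>. {z. wedge I z < 0})" for w
      using that by (intro u_family_out(1)[symmetric]) (auto simp: less_imp_le)
  qed
qed

lemma grad_family_borel_finite:
  assumes "finite \<I>"
  shows "grad_family \<I> \<in> borel_measurable borel"
proof -
  have "(\<lambda>z. if wedge I z > 0 then grad_sector I z else 0) \<in> borel_measurable borel" for I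
  proof (rule measurable_If)
    show "grad_sector I \<in> borel_measurable borel"
      by (intro borel_measurable_continuous_onI continuous_grad_sector)
    have "open {z. wedge I z > 0}"
      by (intro open_Collect_less continuous_intros continuous_on_id)
    then show "{z \<in> space borel. wedge I z > 0} \<in> sets borel" by simp
  qed simp
  then show ?thesis
    unfolding grad_family_def[abs_def] infsum_finite[OF assms] by (intro borel_measurable_sum)
qed

text \<open>A boundary half-line is contained in one of two lines through the origin, and a coordinate line that avoids
  the origin meets each of these in at most one point.\<close>

lemma piecewise_partial_finite:
  assumes "finite \<I>"
  shows "piecewise_partial b (u_family \<I>) (\<lambda>z. grad_family \<I> z \<bullet> axis_vec b)"
  unfolding piecewise_partial_def
proof (intro allI impI)
  fix c :: real assume c: "c \<noteq> 0"
  have line: "finite {x. axis_line b c x \<bullet> w = 0}" if "w \<noteq> 0" for w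
  proof -
    obtain p q where w: "w = (p, q)" by force
    then have pq: "p \<noteq> 0 \<or> q \<noteq> 0" using that by (auto simp: zero_prod_def)
    have "{x. axis_line b c x \<bullet> w = 0} \<subseteq> {- (c * q) / p, - (c * p) / q}"
      using c pq by (cases b; cases "p = 0"; cases "q = 0")
        (auto simp: axis_line_def w inner_prod_def field_simps eq_neg_iff_add_eq_0)
    then show ?thesis by (rule finite_subset) simp
  qed
  have "finite {x. wedge I (axis_line b c x) = 0}" for I
  proof -
    define w1 where "w1 = sin (arc_half_angle I) *\<^sub>R arc_axis I - cos (arc_half_angle I) *\<^sub>R rot90 (arc_axis I)"
    define w2 where "w2 = sin (arc_half_angle I) *\<^sub>R arc_axis I + cos (arc_half_angle I) *\<^sub>R rot90 (arc_axis I)"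
    have "w1 \<noteq> 0" "w2 \<noteq> 0"
    proof -
      have "(norm w1)\<^sup>2 = 1" "(norm w2)\<^sup>2 = 1"
        unfolding norm_along_across[of _ I] 
        by (simp_all add: w1_def w2_def along_across_linear) (simp_all add: along_def across_def dot_square_norm)
      then show "w1 \<noteq> 0" "w2 \<noteq> 0" by auto
    qed
    have "{x. wedge I (axis_line b c x) = 0} \<subseteq> {x. axis_line b c x \<bullet> w1 = 0} \<union> {x. axis_line b c x \<bullet> w2 = 0}"
      by (auto simp: wedge_def along_def across_def w1_def w2_def inner_diff_right inner_add_right abs_if
          mult.commute split: if_splits)
    then show ?thesis
      using line \<open>w1 \<noteq> 0\<close> \<open>w2 \<noteq> 0\<close> by (meson finite_UnI finite_subset)
  qed
  then have fin: "finite (\<Union>I\<in>\<I>. {x. wedge I (axis_line b c x) = 0})"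
    using assms by blast
  have "((\<lambda>x. u_family \<I> (axis_line b c x)) has_real_derivative
      grad_family \<I> (axis_line b c x) \<bullet> axis_vec b) (at x)"
    if "x \<notin> (\<Union>I\<in>\<I>. {x. wedge I (axis_line b c x) = 0})" for x
  proof -
    have "(u_family \<I> has_derivative (\<lambda>h. grad_family \<I> (axis_line b c x) \<bullet> h)) (at (axis_line b c x))"
      using that assms by (intro u_family_has_derivative_finite) auto
    from has_derivative_compose[OF axis_line_has_derivative this] show ?thesis
      by (simp add: has_field_derivative_def mult_commute_abs)
  qed
  with fin show "\<exists>S. finite S \<and> (\<forall>x. x \<notin> S \<longrightarrow> ((\<lambda>x. u_family \<I> (axis_line b c x)) has_real_derivative
      grad_family \<I> (axis_line b c x) \<bullet> axis_vec b) (at x))"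
    by (intro exI[of _ "\<Union>I\<in>\<I>. {x. wedge I (axis_line b c x) = 0}"]) simp
qed

lemma flux_family_finite:
  assumes "finite \<I>" "V \<in> test_fields UNIV"
  shows "(LINT p:subgraph (u_family \<I>)|lebesgue. hdiv V p)
    = (LINT z|lborel. V (at_height z (u_family \<I> z)) \<bullet> hnormal (grad_family \<I>) z)"
proof -
  obtain L where L: "slope_bound L \<I>" using slope_bound_exists by blast
  show ?thesis
    using piecewise_partial_finite[OF assms(1), of True] piecewise_partial_finite[OF assms(1), of False]
    by (intro flux_piecewise[OF continuous_u_family grad_family_borel_finite[OF assms(1)]
          norm_grad_family[OF L] _ _ assms(2)]) (simp_all add: axis_vec_def inner_prod_def)
qed

end

lemma hdiv_test_field:
  assumes "V \<in> test_fields \<Omega>"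
  shows "continuous_on UNIV (hdiv V)" "integrable lebesgue (hdiv V)"
proof -
  obtain F :: "heis \<Rightarrow> heis \<Rightarrow>\<^sub>L plane" where F: "\<And>p. (V has_derivative blinfun_apply (F p)) (at p)"
      "continuous_on UNIV F"
    using assms unfolding test_fields_def C1_on_def by auto
  obtain V' R where V': "\<And>p. norm p > R \<Longrightarrow> V p = 0"
    by (rule test_fieldE[OF assms], rule that)
  have eq: "hdiv V p = fst (F p (1, 0, fst (snd p))) + snd (F p (0, 1, - fst p))" for p
    by (rule hdiv_eq[OF F(1)])
  show c: "continuous_on UNIV (hdiv V)"
    unfolding eq[abs_def] by (intro continuous_intros F(2))
  have zero: "hdiv V p = 0" if "norm p > R" for p
    using derivative_zero_off_cball[OF F(1) that V'] by (simp add: eq)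
  obtain B where "\<And>p. \<bar>hdiv V p\<bar> \<le> B"
    using bounded_of_continuous_cball[OF c zero] by blast
  then have "integrable lborel (hdiv V)"
    using zero by (intro integrable_bounded_cball borel_measurable_continuous_onI c)
  then show "integrable lebesgue (hdiv V)"
    using integrable_completion[of "hdiv V" lborel] by (simp add: borel_measurable_integrable)
qed

lemma test_fields_mono: "V \<in> test_fields \<Omega> \<Longrightarrow> V \<in> test_fields UNIV"
  unfolding test_fields_def by blast

lemma closed_subgraph:
  assumes u: "continuous_on UNIV u"
  shows "closed (subgraph u)"
  unfolding subgraph_def
  by (intro closed_Collect_le continuous_intros continuous_on_compose2[OF u]) auto

context arc_family
begin

lemma trace_borel:
  assumes "continuous_on UNIV f"
  shows "(\<lambda>z. f (at_height z (u_family \<I> z))) \<in> borel_measurable borel"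
  by (intro borel_measurable_continuous_onI continuous_on_compose2[OF assms])
    (auto intro!: continuous_intros continuous_u_family)

lemma finite_exhaustion:
  assumes "countable \<I>"
  obtains \<F> :: "nat \<Rightarrow> plane set set"
  where "\<And>m. finite (\<F> m)" "\<And>m. \<F> m \<subseteq> \<I>"
    "\<And>z. \<forall>\<^sub>F m in sequentially. u_family (\<F> m) z = u_family \<I> z \<and> grad_family (\<F> m) z = grad_family \<I> z"
proof (cases "\<I> = {}")
  case True
  then show ?thesis by (intro that[of "\<lambda>_. {}"]) auto
next
  case False
  define \<F> where "\<F> m = from_nat_into \<I> ` {..m}" for m :: nat
  have sub: "\<F> m \<subseteq> \<I>" for m
    using from_nat_into[OF False] by (auto simp: \<F>_def)
  have "\<forall>\<^sub>F m in sequentially. u_family (\<F> m) z = u_family \<I> z \<and> grad_family (\<F> m) z = grad_family \<I> z" for z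
  proof (cases "\<exists>I\<in>\<I>. wedge I z > 0")
    case True
    then obtain I where I: "I \<in> \<I>" "wedge I z > 0" by blast
    then obtain j where j: "from_nat_into \<I> j = I"
      using from_nat_into_surj[OF assms] by blast
    show ?thesis
    proof (rule eventually_sequentiallyI[of j])
      fix m assume "j \<le> m"
      then have "I \<in> \<F> m" using j unfolding \<F>_def by blast
      then show "u_family (\<F> m) z = u_family \<I> z \<and> grad_family (\<F> m) z = grad_family \<I> z"
        using arc_family.u_family_in[OF subfamily[OF sub] _ I(2), of m] u_family_in[OF I] by simp
    qed
  next
    case False
    then have "u_family (\<F> m) z = u_family \<I> z \<and> grad_family (\<F> m) z = grad_family \<I> z" for m
      using arc_family.u_family_out[OF subfamily[OF sub], of m z] u_family_out[of z] sub[of m]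
      by (metis linorder_not_less subsetD)
    then show ?thesis by (intro always_eventually) blast
  qed
  then show ?thesis
    using sub by (intro that[of \<F>]) (auto simp: \<F>_def)
qed

lemma grad_family_borel:
  assumes "countable \<I>"
  shows "grad_family \<I> \<in> borel_measurable borel"
proof -
  obtain \<F> :: "nat \<Rightarrow> plane set set" where \<F>: "\<And>m. finite (\<F> m)" "\<And>m. \<F> m \<subseteq> \<I>"
    "\<And>z. \<forall>\<^sub>F m in sequentially. u_family (\<F> m) z = u_family \<I> z \<and> grad_family (\<F> m) z = grad_family \<I> z"
    by (rule finite_exhaustion[OF assms], rule that)
  show ?thesis
  proof (rule borel_measurable_LIMSEQ_metric)
    show "grad_family (\<F> m) \<in> borel_measurable borel" for m
      using arc_family.grad_family_borel_finite[OF subfamily[OF \<F>(2)] \<F>(1)] .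
    show "(\<lambda>m. grad_family (\<F> m) z) \<longlonglongrightarrow> grad_family \<I> z" for z
      by (rule tendsto_eventually, rule eventually_mono[OF \<F>(3)[of z]]) simp
  qed
qed

lemma norm_hnormal_le:
  assumes "slope_bound L \<I>"
  shows "norm (hnormal (grad_family \<I>) z) \<le> (2 * L + 2) * norm z"
proof -
  have "norm (hnormal (grad_family \<I>) z) \<le> norm (rot90 z) + norm (grad_family \<I> z)"
    unfolding hnormal_def norm_minus_cancel by (rule norm_triangle_ineq)
  then show ?thesis
    using norm_grad_family[OF assms, of z] by (simp add: algebra_simps)
qed

lemma flux_density_le:
  assumes L: "slope_bound L \<I>" and V: "norm v \<le> 1" "norm z > R \<Longrightarrow> v = 0" and R: "R \<ge> 0"
  shows "\<bar>v \<bullet> hnormal (grad_family \<I>) z\<bar> \<le> indicator (cball 0 R) z * ((2 * L + 2) * R)"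
proof (cases "norm z > R")
  case False
  have "\<bar>v \<bullet> hnormal (grad_family \<I>) z\<bar> \<le> norm v * norm (hnormal (grad_family \<I>) z)"
    by (rule Cauchy_Schwarz_ineq2)
  also have "\<dots> \<le> 1 * ((2 * L + 2) * norm z)"
    using V(1) norm_hnormal_le[OF L, of z] by (intro mult_mono) auto
  also have "\<dots> \<le> (2 * L + 2) * R"
    using False slope_boundD(1)[OF L] by (simp add: mult_left_mono)
  finally show ?thesis using False by simp
qed (use V(2) in simp)

lemma integrable_cball_const: "integrable lborel (\<lambda>z :: plane. indicator (cball 0 R) z * (c :: real))"
  by (rule integrable_bounded_cball[where R=R and B="\<bar>c\<bar>"]) (auto simp: indicator_def)

lemma integrable_flux:
  assumes L: "slope_bound L \<I>" and ct: "countable \<I>"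
    and v: "v \<in> borel_measurable borel" "\<And>z. norm (v z) \<le> 1" "\<And>z. norm z > R \<Longrightarrow> v z = 0" and R: "R \<ge> 0"
  shows "integrable lborel (\<lambda>z. v z \<bullet> hnormal (grad_family \<I>) z)"
    and "(\<lambda>z. v z \<bullet> hnormal (grad_family \<I>) z) \<in> borel_measurable borel"
proof -
  have [measurable]: "grad_family \<I> \<in> borel_measurable borel"
    by (rule grad_family_borel[OF ct])
  have [measurable]: "rot90 \<in> borel_measurable borel"
    by (intro borel_measurable_continuous_onI) (auto intro!: continuous_intros continuous_on_id)
  show m: "(\<lambda>z. v z \<bullet> hnormal (grad_family \<I>) z) \<in> borel_measurable borel"
    using v(1) unfolding hnormal_def by measurable
  show "integrable lborel (\<lambda>z. v z \<bullet> hnormal (grad_family \<I>) z)"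
  proof (rule Bochner_Integration.integrable_bound[OF integrable_cball_const[of R "(2 * L + 2) * R"]])
    show "AE z in lborel. norm (v z \<bullet> hnormal (grad_family \<I>) z) \<le> norm (indicator (cball 0 R) z * ((2 * L + 2) * R))"
      unfolding real_norm_def
      by (intro always_eventually allI order_trans[OF flux_density_le[OF L v(2,3) R] abs_ge_self])
  qed (use m in simp)
qed

text \<open>For an infinite family the sectors may accumulate along a set of rays of positive measure with empty interior, and coordinate lines
  may meet uncountably many of these. The formula is obtained from finite subfamilies by dominated
  convergence: at each point of the plane, height and gradient are eventually constant.\<close>

theorem flux_family:
  assumes ct: "countable \<I>" and V: "V \<in> test_fields \<Omega>"
  shows "(LINT p:subgraph (u_family \<I>)|lebesgue. hdiv V p)
    = (LINT z|lborel. V (at_height z (u_family \<I> z)) \<bullet> hnormal (grad_family \<I>) z)"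
proof -
  obtain L where L: "slope_bound L \<I>" using slope_bound_exists by blast
  obtain V' R where R: "R > 0" "\<And>p. norm p > R \<Longrightarrow> V p = 0"
    by (rule test_fieldE[OF V], rule that)
  have cV: "continuous_on UNIV V"
    using V by (rule test_field_continuous)
  have out: "V (at_height z t) = 0" if "norm z > R" for z t
    using that norm_at_height(1)[of z t] by (intro R(2)) linarith
  obtain \<F> :: "nat \<Rightarrow> plane set set" where \<F>: "\<And>m. finite (\<F> m)" "\<And>m. \<F> m \<subseteq> \<I>"
    "\<And>z. \<forall>\<^sub>F m in sequentially. u_family (\<F> m) z = u_family \<I> z \<and> grad_family (\<F> m) z = grad_family \<I> z"
    by (rule finite_exhaustion[OF ct], rule that)
  note fam = subfamily[OF \<F>(2)]
  let ?E = "\<lambda>\<F>. subgraph (u_family \<F>)"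
  let ?g = "\<lambda>\<F> z. V (at_height z (u_family \<F> z)) \<bullet> hnormal (grad_family \<F>) z"
  have meas: "(\<lambda>p. indicat_real (?E \<G>) p *\<^sub>R hdiv V p) \<in> borel_measurable lebesgue" if "arc_family \<G>" for \<G>
    using sets_completionI_sub[of "?E \<G>" lborel] closed_subgraph[OF arc_family.continuous_u_family[OF that]]
      borel_measurable_integrable[OF hdiv_test_field(2)[OF V]]
    by (intro borel_measurable_scaleR borel_measurable_indicator) simp_all
  have vm: "(\<lambda>z. V (at_height z (u_family \<G> z))) \<in> borel_measurable borel" if "arc_family \<G>" for \<G>
    by (rule arc_family.trace_borel[OF that cV])
  have 1: "(\<lambda>m. LINT p:?E (\<F> m)|lebesgue. hdiv V p) \<longlonglongrightarrow> (LINT p:?E \<I>|lebesgue. hdiv V p)"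
    unfolding set_lebesgue_integral_def
  proof (rule integral_dominated_convergence[where w="\<lambda>p. \<bar>hdiv V p\<bar>"])
    show "AE p in lebesgue. (\<lambda>m. indicat_real (?E (\<F> m)) p *\<^sub>R hdiv V p) \<longlonglongrightarrow> indicat_real (?E \<I>) p *\<^sub>R hdiv V p"
    proof (rule AE_I2, rule tendsto_eventually)
      fix p :: heis
      show "\<forall>\<^sub>F m in sequentially. indicat_real (?E (\<F> m)) p *\<^sub>R hdiv V p = indicat_real (?E \<I>) p *\<^sub>R hdiv V p"
        by (rule eventually_mono[OF \<F>(3)[of "(fst p, fst (snd p))"]]) (simp add: subgraph_def indicator_def)
    qed
    show "integrable lebesgue (\<lambda>p. \<bar>hdiv V p\<bar>)"
      using hdiv_test_field(2)[OF V] by simp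
  qed (use meas fam in \<open>auto simp: indicator_def intro: arc_family_axioms\<close>)
  have 2: "(\<lambda>m. LINT z|lborel. ?g (\<F> m) z) \<longlonglongrightarrow> (LINT z|lborel. ?g \<I> z)"
  proof (rule integral_dominated_convergence[where w="\<lambda>z. indicator (cball 0 R) z * ((2 * L + 2) * R)"])
    have sb: "slope_bound L (\<F> m)" for m
      using slope_bound_subset[OF L \<F>(2)] .
    have ctm: "countable (\<F> m)" for m
      using \<F>(1) by (rule countable_finite)
    show "?g (\<F> m) \<in> borel_measurable lborel" for m
      using arc_family.integrable_flux(2)[where R=R, OF fam sb ctm vm[OF fam]] R(1) out test_field_norm_le[OF V] by simp
    show "?g \<I> \<in> borel_measurable lborel"
      using integrable_flux(2)[where R=R, OF L ct vm[OF arc_family_axioms]] R(1) out test_field_norm_le[OF V] by simp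
    show "AE z in lborel. (\<lambda>m. ?g (\<F> m) z) \<longlonglongrightarrow> ?g \<I> z"
    proof (rule AE_I2, rule tendsto_eventually)
      fix z
      show "\<forall>\<^sub>F m in sequentially. ?g (\<F> m) z = ?g \<I> z"
        by (rule eventually_mono[OF \<F>(3)[of z]]) (simp add: hnormal_def)
    qed
    show "AE z in lborel. norm (?g (\<F> m) z) \<le> indicator (cball 0 R) z * ((2 * L + 2) * R)" for m
      unfolding real_norm_def
      by (intro always_eventually allI arc_family.flux_density_le[OF fam sb] test_field_norm_le[OF V] out)
        (use R(1) in simp_all)
  qed (rule integrable_cball_const)
  have "(LINT p:?E (\<F> m)|lebesgue. hdiv V p) = (LINT z|lborel. ?g (\<F> m) z)" for m
    by (rule arc_family.flux_family_finite[OF fam \<F>(1) test_fields_mono[OF V]])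
  with 1 2 show ?thesis
    using LIMSEQ_unique by simp
qed

end

section \<open>Calibration\<close>

text \<open>The function \<open>ln (partition_sum N k \<beta> z) / \<beta>\<close> is a smooth convex approximation of the support function
  \<open>max\<^sub>j (z \<bullet> k j)\<close>; its gradient is the convex combination \<open>softmax N k \<beta> z\<close> of the vectors \<open>k j\<close>.\<close>

definition partition_sum :: "nat \<Rightarrow> (nat \<Rightarrow> plane) \<Rightarrow> real \<Rightarrow> plane \<Rightarrow> real" where
  "partition_sum N k \<beta> z = (\<Sum>j<N. exp (\<beta> * (z \<bullet> k j)))"

definition weighted_sum :: "nat \<Rightarrow> (nat \<Rightarrow> plane) \<Rightarrow> real \<Rightarrow> plane \<Rightarrow> plane" where
  "weighted_sum N k \<beta> z = (\<Sum>j<N. exp (\<beta> * (z \<bullet> k j)) *\<^sub>R k j)"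

definition softmax :: "nat \<Rightarrow> (nat \<Rightarrow> plane) \<Rightarrow> real \<Rightarrow> plane \<Rightarrow> plane" where
  "softmax N k \<beta> z = inverse (partition_sum N k \<beta> z) *\<^sub>R weighted_sum N k \<beta> z"

lemma partition_sum_pos: "N > 0 \<Longrightarrow> partition_sum N k \<beta> z > 0"
  unfolding partition_sum_def by (intro sum_pos) auto

lemma softmax_inner_le:
  assumes "N > 0" "\<And>j. k j \<bullet> a \<le> b"
  shows "softmax N k \<beta> z \<bullet> a \<le> b"
proof -
  have "weighted_sum N k \<beta> z \<bullet> a = (\<Sum>j<N. exp (\<beta> * (z \<bullet> k j)) * (k j \<bullet> a))"
    by (simp add: weighted_sum_def inner_sum_left)
  also have "\<dots> \<le> (\<Sum>j<N. exp (\<beta> * (z \<bullet> k j)) * b)"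
    by (intro sum_mono mult_left_mono assms) simp
  also have "\<dots> = partition_sum N k \<beta> z * b"
    by (simp add: partition_sum_def sum_distrib_right)
  finally show ?thesis
    using partition_sum_pos[OF assms(1), of k \<beta> z] by (simp add: softmax_def field_simps)
qed

lemma norm_softmax_le:
  assumes "N > 0" "\<And>j. norm (k j) = 1"
  shows "norm (softmax N k \<beta> z) \<le> 1"
proof -
  have "norm (weighted_sum N k \<beta> z) \<le> (\<Sum>j<N. norm (exp (\<beta> * (z \<bullet> k j)) *\<^sub>R k j))"
    unfolding weighted_sum_def by (rule norm_sum)
  also have "\<dots> = partition_sum N k \<beta> z"
    by (simp add: partition_sum_def assms(2))
  finally show ?thesis
    using partition_sum_pos[OF assms(1), of k \<beta> z] by (simp add: softmax_def field_simps)
qed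

definition softmax_deriv :: "nat \<Rightarrow> (nat \<Rightarrow> plane) \<Rightarrow> real \<Rightarrow> plane \<Rightarrow> plane \<Rightarrow> plane" where
  "softmax_deriv N k \<beta> z h =
     (inverse (partition_sum N k \<beta> z) * \<beta>) *\<^sub>R (\<Sum>j<N. (exp (\<beta> * (z \<bullet> k j)) * (h \<bullet> k j)) *\<^sub>R k j)
     - ((inverse (partition_sum N k \<beta> z))\<^sup>2 * \<beta> * (h \<bullet> weighted_sum N k \<beta> z)) *\<^sub>R weighted_sum N k \<beta> z"

lemma softmax_has_derivative:
  assumes "N > 0"
  shows "(softmax N k \<beta> has_derivative softmax_deriv N k \<beta> z) (at z)"
proof -
  have e: "((\<lambda>z. exp (\<beta> * (z \<bullet> k j))) has_derivative (\<lambda>h. exp (\<beta> * (z \<bullet> k j)) * (\<beta> * (h \<bullet> k j)))) (at z)" for j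
    by (auto intro!: derivative_eq_intros)
  have Z: "(partition_sum N k \<beta> has_derivative (\<lambda>h. \<Sum>j<N. exp (\<beta> * (z \<bullet> k j)) * (\<beta> * (h \<bullet> k j)))) (at z)"
    unfolding partition_sum_def[abs_def] by (intro has_derivative_sum e)
  have S: "(weighted_sum N k \<beta> has_derivative (\<lambda>h. \<Sum>j<N. (exp (\<beta> * (z \<bullet> k j)) * (\<beta> * (h \<bullet> k j))) *\<^sub>R k j)) (at z)"
    unfolding weighted_sum_def[abs_def] by (intro has_derivative_sum has_derivative_scaleR_left e)
  have nz: "partition_sum N k \<beta> z \<noteq> 0" using partition_sum_pos[OF assms, of k \<beta> z] by simp
  have D: "(softmax N k \<beta> has_derivative (\<lambda>h.
      inverse (partition_sum N k \<beta> z) *\<^sub>R (\<Sum>j<N. (exp (\<beta> * (z \<bullet> k j)) * (\<beta> * (h \<bullet> k j))) *\<^sub>R k j)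
      + (- (inverse (partition_sum N k \<beta> z) * (\<Sum>j<N. exp (\<beta> * (z \<bullet> k j)) * (\<beta> * (h \<bullet> k j))) * inverse (partition_sum N k \<beta> z)))
        *\<^sub>R weighted_sum N k \<beta> z)) (at z)"
    unfolding softmax_def[abs_def] by (rule has_derivative_scaleR[OF Deriv.has_derivative_inverse[OF nz Z] S])
  have 1: "(\<Sum>j<N. (exp (\<beta> * (z \<bullet> k j)) * (\<beta> * (h \<bullet> k j))) *\<^sub>R k j)
      = \<beta> *\<^sub>R (\<Sum>j<N. (exp (\<beta> * (z \<bullet> k j)) * (h \<bullet> k j)) *\<^sub>R k j)" for h
    by (simp add: scaleR_sum_right mult.left_commute)
  have 2: "(\<Sum>j<N. exp (\<beta> * (z \<bullet> k j)) * (\<beta> * (h \<bullet> k j))) = \<beta> * (h \<bullet> weighted_sum N k \<beta> z)" for h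
    by (simp add: weighted_sum_def inner_sum_right sum_distrib_left mult.left_commute)
  show ?thesis
  proof (rule has_derivative_eq_rhs[OF D], rule ext)
    show "inverse (partition_sum N k \<beta> z) *\<^sub>R (\<Sum>j<N. (exp (\<beta> * (z \<bullet> k j)) * (\<beta> * (h \<bullet> k j))) *\<^sub>R k j)
      + (- (inverse (partition_sum N k \<beta> z) * (\<Sum>j<N. exp (\<beta> * (z \<bullet> k j)) * (\<beta> * (h \<bullet> k j))) * inverse (partition_sum N k \<beta> z)))
        *\<^sub>R weighted_sum N k \<beta> z = softmax_deriv N k \<beta> z h" for h
      unfolding 1 2 softmax_deriv_def scaleR_scaleR scaleR_minus_left diff_conv_add_uminus power2_eq_square
      by (simp only: mult.commute mult.left_commute mult.assoc)
  qed
qed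

lemma continuous_softmax_deriv:
  assumes "N > 0"
  shows "continuous_on UNIV (\<lambda>z. softmax_deriv N k \<beta> z h)"
proof -
  have "partition_sum N k \<beta> z \<noteq> 0" for z using partition_sum_pos[OF assms, of k \<beta> z] by simp
  moreover have "continuous_on UNIV (partition_sum N k \<beta>)" "continuous_on UNIV (weighted_sum N k \<beta>)"
    unfolding partition_sum_def[abs_def] weighted_sum_def[abs_def] by (intro continuous_intros)+
  ultimately show ?thesis
    unfolding softmax_deriv_def by (intro continuous_intros) auto
qed

text \<open>The derivative of a gradient is symmetric.\<close>

lemma softmax_curl_free: "snd (softmax_deriv N k \<beta> z (1, 0)) = fst (softmax_deriv N k \<beta> z (0, 1))"
  by (simp add: softmax_deriv_def snd_sum fst_sum inner_prod_def mult.commute mult.left_commute)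

text \<open>The Laplace principle. Put \<open>d\<^sub>j = m - z \<bullet> k j \<ge> 0\<close>. Indices with \<open>d\<^sub>j \<le> 2 \<epsilon>\<close> contribute at most \<open>2 \<epsilon>\<close> to the mean
  of \<open>d\<close>; each of the others contributes at most \<open>2 / \<beta>\<close>, because some index of weight at least
  \<open>exp (\<beta> (m - \<epsilon>))\<close> is present and \<open>s \<le> exp s\<close>. With \<open>n + 1\<close> indices and \<open>\<beta> = (n + 1)\<^sup>2\<close> the total error is \<open>2 \<epsilon> + 2 / (n + 1)\<close>.\<close>

lemma softmax_tendsto_max:
  assumes le: "\<And>j. z \<bullet> k j \<le> m" and dense: "\<And>\<epsilon>. \<epsilon> > 0 \<Longrightarrow> \<exists>j. z \<bullet> k j > m - \<epsilon>"
  shows "(\<lambda>n. z \<bullet> softmax (Suc n) k ((real (Suc n))\<^sup>2) z) \<longlonglongrightarrow> m"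
proof (rule LIMSEQ_I)
  fix r :: real assume "r > 0"
  define \<epsilon> where "\<epsilon> = r / 4"
  have \<epsilon>: "\<epsilon> > 0" using \<open>r > 0\<close> by (simp add: \<epsilon>_def)
  obtain j0 where j0: "z \<bullet> k j0 > m - \<epsilon>" using dense[OF \<epsilon>] by blast
  obtain n0 where n0: "2 / real (Suc n0) < r / 2"
  proof -
    obtain n0 where "inverse (real (Suc n0)) < r / 4"
      using reals_Archimedean[of "r / 4"] \<open>r > 0\<close> by auto
    then show ?thesis by (intro that[of n0]) (simp add: field_simps)
  qed
  have "norm (z \<bullet> softmax (Suc n) k ((real (Suc n))\<^sup>2) z - m) < r" if n: "n \<ge> max j0 n0" for n
  proof -
    define \<beta> where "\<beta> = (real (Suc n))\<^sup>2"
    define N where "N = Suc n"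
    define d where "d j = m - z \<bullet> k j" for j
    define w where "w j = exp (\<beta> * (z \<bullet> k j))" for j
    have \<beta>: "\<beta> > 0" by (simp add: \<beta>_def)
    have d: "d j \<ge> 0" for j using le by (simp add: d_def)
    have summand: "w j * d j \<le> w j * (2 * \<epsilon>) + (2 / \<beta>) * w j0" for j
    proof (cases "d j \<le> 2 * \<epsilon>")
      case True
      then have "w j * d j \<le> w j * (2 * \<epsilon>)" by (intro mult_left_mono) (auto simp: w_def)
      moreover have "(2 / \<beta>) * w j0 \<ge> 0" using \<beta> by (simp add: w_def)
      ultimately show ?thesis by linarith
    next
      case False
      have "\<beta> * d j / 2 \<le> exp (\<beta> * d j / 2)"
        using exp_ge_add_one_self[of "\<beta> * d j / 2"] by linarith
      then have "d j * exp (- (\<beta> * d j / 2)) \<le> 2 / \<beta>"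
        using \<beta> by (simp add: exp_minus field_simps)
      moreover have "exp (\<beta> * m - \<beta> * d j / 2) \<le> w j0"
      proof -
        have "\<beta> * (m - d j / 2) \<le> \<beta> * (z \<bullet> k j0)"
          using False j0 \<beta> by (intro mult_left_mono) auto
        then show ?thesis by (simp add: w_def right_diff_distrib)
      qed
      ultimately have "(d j * exp (- (\<beta> * d j / 2))) * exp (\<beta> * m - \<beta> * d j / 2) \<le> (2 / \<beta>) * w j0"
        using \<beta> by (intro mult_mono) auto
      moreover have "w j = exp (- (\<beta> * d j / 2)) * exp (\<beta> * m - \<beta> * d j / 2)"
        by (simp add: w_def d_def exp_add[symmetric] algebra_simps)
      ultimately have "w j * d j \<le> (2 / \<beta>) * w j0" by (simp add: mult_ac)
      moreover have "w j * (2 * \<epsilon>) \<ge> 0" using \<epsilon> by (simp add: w_def)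
      ultimately show ?thesis by linarith
    qed
    have Z: "partition_sum N k \<beta> z = (\<Sum>j<N. w j)" by (simp add: partition_sum_def w_def)
    have Zpos: "partition_sum N k \<beta> z > 0" by (rule partition_sum_pos) (simp add: N_def)
    have "w j0 \<le> partition_sum N k \<beta> z"
      unfolding Z using n by (intro member_le_sum) (auto simp: N_def w_def)
    then have w0: "real N * ((2 / \<beta>) * w j0) \<le> real N * ((2 / \<beta>) * partition_sum N k \<beta> z)"
      using \<beta> by (intro mult_left_mono) auto
    have "(\<Sum>j<N. w j * d j) \<le> (\<Sum>j<N. w j * (2 * \<epsilon>) + (2 / \<beta>) * w j0)"
      by (intro sum_mono summand)
    also have "\<dots> = partition_sum N k \<beta> z * (2 * \<epsilon>) + real N * ((2 / \<beta>) * w j0)"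
      unfolding Z by (simp add: sum.distrib sum_distrib_right)
    also have "\<dots> \<le> partition_sum N k \<beta> z * (2 * \<epsilon>) + real N * ((2 / \<beta>) * partition_sum N k \<beta> z)"
      using w0 by simp
    also have "real N * ((2 / \<beta>) * partition_sum N k \<beta> z) = partition_sum N k \<beta> z * (2 / real N)"
    proof -
      have "real N * (2 / \<beta>) = 2 / real N"
        unfolding \<beta>_def N_def power2_eq_square by (simp del: of_nat_Suc)
      then show ?thesis by (metis mult.assoc mult.commute)
    qed
    also have "partition_sum N k \<beta> z * (2 * \<epsilon>) + partition_sum N k \<beta> z * (2 / real N)
        = partition_sum N k \<beta> z * (2 * \<epsilon> + 2 / real N)"
      by (rule distrib_left[symmetric])
    finally have sum_le: "(\<Sum>j<N. w j * d j) \<le> partition_sum N k \<beta> z * (2 * \<epsilon> + 2 / real N)" .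
    have "(\<Sum>j<N. w j * d j) = partition_sum N k \<beta> z * m - z \<bullet> weighted_sum N k \<beta> z"
      unfolding Z by (simp add: weighted_sum_def inner_sum_right d_def w_def right_diff_distrib sum_subtractf sum_distrib_right)
    moreover have "z \<bullet> weighted_sum N k \<beta> z = partition_sum N k \<beta> z * (z \<bullet> softmax N k \<beta> z)"
      using Zpos by (simp add: softmax_def)
    ultimately have eq: "(\<Sum>j<N. w j * d j) = partition_sum N k \<beta> z * (m - z \<bullet> softmax N k \<beta> z)"
      by (simp add: right_diff_distrib)
    have "m - z \<bullet> softmax N k \<beta> z \<le> 2 * \<epsilon> + 2 / real N"
      using sum_le Zpos unfolding eq by simp
    moreover have "m - z \<bullet> softmax N k \<beta> z \<ge> 0"
      using softmax_inner_le[of N k z m \<beta> z] le by (simp add: N_def inner_commute)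
    moreover have "2 / real N \<le> 2 / real (Suc n0)"
      using n by (intro divide_left_mono) (auto simp: N_def)
    ultimately show ?thesis
      using n0 unfolding \<epsilon>_def N_def \<beta>_def real_norm_def by linarith
  qed
  then show "\<exists>no. \<forall>n\<ge>no. norm (z \<bullet> softmax (Suc n) k ((real (Suc n))\<^sup>2) z - m) < r"
    by blast
qed

lemma along_le_cos:
  assumes I: "proper_open_arc I" and k: "norm k = 1" "wedge I k \<le> 0"
  shows "along I k \<le> cos (arc_half_angle I)"
proof -
  note \<alpha> = arc_half_angle[OF I]
  have "(along I k)\<^sup>2 + \<bar>across I k\<bar>\<^sup>2 = 1"
    using norm_along_across[of k I] k(1) by simp
  from sincos_total_pi[OF abs_ge_zero this]
  obtain t where t: "0 \<le> t" "t \<le> pi" "along I k = cos t" "\<bar>across I k\<bar> = sin t"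
    by blast
  have "sin (arc_half_angle I - t) \<le> 0"
    using k(2) t by (simp add: wedge_def sin_diff algebra_simps)
  then have "arc_half_angle I \<le> t"
    using sin_gt_zero[of "arc_half_angle I - t"] t \<alpha> by (intro leI notI) auto
  then show ?thesis
    using t \<alpha> by (simp add: cos_monotone_0_pi_le)
qed

context arc_family
begin

text \<open>The complement of the arcs in the circle. The calibrating field is the gradient, turned by \<open>- \<pi> / 2\<close>, of the support function of this set.\<close>

definition free_directions :: "plane set" where
  "free_directions = {k. norm k = 1 \<and> (\<forall>I\<in>\<I>. wedge I k \<le> 0)}"

lemma nearest_endpoint:
  assumes I: "I \<in> \<I>"
  defines "\<kappa> \<equiv> \<lambda>z. cos (arc_half_angle I) *\<^sub>R arc_axis I
    + ((if across I z \<ge> 0 then 1 else - 1) * sin (arc_half_angle I)) *\<^sub>R rot90 (arc_axis I)"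
  shows "\<kappa> z \<in> free_directions"
proof -
  have k: "norm (\<kappa> z) = 1" "along I (\<kappa> z) = cos (arc_half_angle I)"
    "across I (\<kappa> z) = (if across I z \<ge> 0 then 1 else - 1) * sin (arc_half_angle I)"
    unfolding \<kappa>_def by (rule grad_normal(2-4)[OF arc[OF I]])+
  have "sin (arc_half_angle I) > 0" using arc[OF I] by (rule arc_half_angle)
  then have sec0: "wedge I (\<kappa> z) = 0"
    by (simp add: wedge_def k(2,3) abs_mult)
  have "wedge J (\<kappa> z) \<le> 0" if "J \<in> \<I>" for J
    using wedge_unique[OF that _ I, of "\<kappa> z"] sec0 by fastforce
  then show ?thesis using k(1) by (simp add: free_directions_def)
qed

text \<open>At every point \<open>z\<close> the horizontal normal points in the direction of a free direction \<open>\<kappa>\<close>, turned by \<open>- \<pi> / 2\<close>, that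
  maximizes \<open>z \<bullet> k\<close>, with a quantitative form of uniqueness. Over a sector, \<open>z\<close> is a nonnegative combination of
  the axis, on which \<open>\<kappa>\<close> is as large as any free direction, and of \<open>\<kappa>\<close> itself. Elsewhere \<open>\<kappa>\<close> is the direction of \<open>z\<close>.\<close>

lemma exposed_direction:
  assumes ne: "\<I> \<noteq> {}"
  defines "N \<equiv> hnormal (grad_family \<I>)"
  obtains \<kappa> where "\<kappa> \<in> free_directions" "N z = norm (N z) *\<^sub>R (- rot90 \<kappa>)"
    "\<And>k. k \<in> free_directions \<Longrightarrow> z \<bullet> \<kappa> - z \<bullet> k \<ge> norm (N z) / 2 * (1 - \<kappa> \<bullet> k)"
proof (cases "\<exists>I\<in>\<I>. wedge I z > 0")
  case True
  then obtain I where I: "I \<in> \<I>" "wedge I z > 0" by blast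
  have s: "sin (arc_half_angle I) > 0" using arc[OF I(1)] by (rule arc_half_angle)
  define \<sigma> :: real where "\<sigma> = (if across I z \<ge> 0 then 1 else - 1)"
  define \<kappa> where "\<kappa> = cos (arc_half_angle I) *\<^sub>R arc_axis I + (\<sigma> * sin (arc_half_angle I)) *\<^sub>R rot90 (arc_axis I)"
  define l where "l = \<bar>across I z\<bar> / sin (arc_half_angle I)"
  define m where "m = wedge I z / sin (arc_half_angle I)"
  have lm: "l \<ge> 0" "m > 0" using s I(2) by (simp_all add: l_def m_def)
  note gn = grad_normal[OF arc[OF I(1)], of z, folded \<sigma>_def, folded \<kappa>_def]
  have N: "N z = (2 * l) *\<^sub>R (- rot90 \<kappa>)"
    unfolding N_def hnormal_def u_family_in(3)[OF I] using gn(1) by (simp add: l_def)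
  then have normN: "norm (N z) = 2 * l"
    using gn(2) lm by simp
  have \<kappa>: "\<kappa> \<in> free_directions"
    using nearest_endpoint[OF I(1), of z] unfolding \<kappa>_def \<sigma>_def .
  \<comment> \<open>\<open>z\<close> is a positive combination of the arc_axis and of the nearest endpoint \<open>\<kappa>\<close>.\<close>
  have "z = m *\<^sub>R arc_axis I + l *\<^sub>R \<kappa>"
  proof -
    have "l * (\<sigma> * sin (arc_half_angle I)) = across I z"
      using s by (simp add: l_def \<sigma>_def)
    moreover have "m + l * cos (arc_half_angle I) = along I z"
      using s by (simp add: m_def l_def wedge_def field_simps)
    moreover have "m *\<^sub>R arc_axis I + l *\<^sub>R \<kappa>
        = (m + l * cos (arc_half_angle I)) *\<^sub>R arc_axis I + (l * (\<sigma> * sin (arc_half_angle I))) *\<^sub>R rot90 (arc_axis I)"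
      by (simp add: \<kappa>_def scaleR_add_right scaleR_add_left)
    ultimately show ?thesis
      using frame_axis[of z I] by simp
  qed
  then have zk: "z \<bullet> k = m * along I k + l * (\<kappa> \<bullet> k)" for k
    using arg_cong[of z "m *\<^sub>R arc_axis I + l *\<^sub>R \<kappa>" "\<lambda>v. v \<bullet> k"]
    by (simp add: inner_add_left along_def inner_commute[of k])
  have "z \<bullet> \<kappa> - z \<bullet> k \<ge> norm (N z) / 2 * (1 - \<kappa> \<bullet> k)" if "k \<in> free_directions" for k
  proof -
    have "along I k \<le> cos (arc_half_angle I)"
      using that I(1) by (intro along_le_cos arc) (auto simp: free_directions_def)
    then have "m * along I k \<le> m * along I \<kappa>"
      using lm gn(3) by simp
    moreover have "\<kappa> \<bullet> \<kappa> = 1"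
      using gn(2) by (simp add: dot_square_norm)
    ultimately show ?thesis
      unfolding zk normN by (simp add: algebra_simps)
  qed
  with \<kappa> N normN show ?thesis by (intro that[of \<kappa>]) auto
next
  case False
  then have N: "N z = - rot90 z"
    using u_family_out(2)[of z] by (auto simp: N_def hnormal_def not_less)
  show ?thesis
  proof (cases "z = 0")
    case True
    obtain I where "I \<in> \<I>" using ne by blast
    then show ?thesis
      using True N nearest_endpoint by (intro that) auto
  next
    case nz: False
    define \<kappa> where "\<kappa> = (1 / norm z) *\<^sub>R z"
    have "\<kappa> \<in> free_directions"
      using False nz by (auto simp: free_directions_def \<kappa>_def wedge_scale not_less divide_nonpos_pos)
    moreover have z: "z = norm z *\<^sub>R \<kappa>" using nz by (simp add: \<kappa>_def)
    moreover have "N z = norm (N z) *\<^sub>R (- rot90 \<kappa>)"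
      using N nz by (simp add: \<kappa>_def rot90_linear)
    moreover have "z \<bullet> \<kappa> - z \<bullet> k \<ge> norm (N z) / 2 * (1 - \<kappa> \<bullet> k)" if "k \<in> free_directions" for k
    proof -
      have k1: "norm \<kappa> = 1" "norm k = 1"
        using nz that by (simp_all add: \<kappa>_def free_directions_def)
      then have "\<kappa> \<bullet> k \<le> 1"
        using norm_cauchy_schwarz[of \<kappa> k] by simp
      moreover have "z \<bullet> \<kappa> - z \<bullet> k = norm z * (1 - \<kappa> \<bullet> k)"
        using k1 by (subst (1 2) z) (simp add: dot_square_norm right_diff_distrib)
      ultimately show ?thesis
        using N by (simp add: mult_right_mono)
    qed
    ultimately show ?thesis by (intro that[of \<kappa>]) auto
  qed
qed

text \<open>The fields \<open>\<nu> n\<close> are the softmax gradients for a dense sequence of free directions, turned by \<open>- \<pi> / 2\<close>. The rotation makes curl-free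
  fields divergence-free. The inequality of \<open>exposed_direction\<close> passes to convex combinations, so
  that \<open>\<bar>N\<bar> - \<nu> n \<bullet> N\<close> is at most twice the gap in the Laplace principle.\<close>

theorem calibration:
  assumes ne: "\<I> \<noteq> {}"
  obtains \<nu> :: "nat \<Rightarrow> plane \<Rightarrow> plane" and \<nu>' :: "nat \<Rightarrow> plane \<Rightarrow> plane \<Rightarrow> plane"
  where "\<And>n z. (\<nu> n has_derivative \<nu>' n z) (at z)" "\<And>n h. continuous_on UNIV (\<lambda>z. \<nu>' n z h)"
    "\<And>n z. fst (\<nu>' n z (1, 0)) + snd (\<nu>' n z (0, 1)) = 0"
    "\<And>n z. norm (\<nu> n z) \<le> 1"
    "\<And>z. (\<lambda>n. \<nu> n z \<bullet> hnormal (grad_family \<I>) z) \<longlonglongrightarrow> norm (hnormal (grad_family \<I>) z)"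
proof -
  obtain T where T: "countable T" "T \<subseteq> free_directions" "free_directions \<subseteq> closure T"
    using separable[of free_directions] by blast
  have "free_directions \<noteq> {}"
    using ne nearest_endpoint by blast
  then have T_ne: "T \<noteq> {}" using T(3) by auto
  define k where "k = from_nat_into T"
  have k_in: "k j \<in> free_directions" for j
    using from_nat_into[OF T_ne] T(2) unfolding k_def by blast
  have k_norm: "norm (k j) = 1" for j
    using k_in[of j] by (simp add: free_directions_def)
  define \<nu> where "\<nu> n z = - rot90 (softmax (Suc n) k ((real (Suc n))\<^sup>2) z)" for n z
  define \<nu>' where "\<nu>' n z h = - rot90 (softmax_deriv (Suc n) k ((real (Suc n))\<^sup>2) z h)" for n z h
  have bl: "bounded_linear (\<lambda>z. - rot90 z)"
    by (intro linear_conv_bounded_linear[THEN iffD1] linearI) (simp_all add: rot90_linear)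
  show ?thesis
  proof
    show "(\<nu> n has_derivative \<nu>' n z) (at z)" for n z
      unfolding \<nu>_def[abs_def] \<nu>'_def[abs_def]
      by (rule bounded_linear.has_derivative[OF bl softmax_has_derivative]) simp
    show "continuous_on UNIV (\<lambda>z. \<nu>' n z h)" for n h
      unfolding \<nu>'_def by (intro continuous_intros continuous_softmax_deriv) simp
    show "fst (\<nu>' n z (1, 0)) + snd (\<nu>' n z (0, 1)) = 0" for n z
      by (simp add: \<nu>'_def softmax_curl_free)
    show "norm (\<nu> n z) \<le> 1" for n z
      using norm_softmax_le[of "Suc n" k _ z] k_norm by (simp add: \<nu>_def del: of_nat_Suc)
    fix z
    define N where "N = hnormal (grad_family \<I>) z"
    obtain \<kappa> where \<kappa>: "\<kappa> \<in> free_directions" "N = norm N *\<^sub>R (- rot90 \<kappa>)"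
        "\<And>k. k \<in> free_directions \<Longrightarrow> z \<bullet> \<kappa> - z \<bullet> k \<ge> norm N / 2 * (1 - \<kappa> \<bullet> k)"
      using exposed_direction[OF ne, of z] unfolding N_def by blast
    define M where "M n = softmax (Suc n) k ((real (Suc n))\<^sup>2) z" for n
    have norm\<kappa>: "norm \<kappa> = 1" using \<kappa>(1) by (simp add: free_directions_def)
    have lim: "(\<lambda>n. z \<bullet> M n) \<longlonglongrightarrow> z \<bullet> \<kappa>"
      unfolding M_def
    proof (rule softmax_tendsto_max)
      show "z \<bullet> k j \<le> z \<bullet> \<kappa>" for j
      proof -
        have "\<kappa> \<bullet> k j \<le> 1"
          using norm_cauchy_schwarz[of \<kappa> "k j"] norm\<kappa> k_norm by simp
        then have "norm N / 2 * (1 - \<kappa> \<bullet> k j) \<ge> 0" by simp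
        then show ?thesis using \<kappa>(3)[OF k_in[of j]] by linarith
      qed
      fix \<epsilon> :: real assume "\<epsilon> > 0"
      then have "\<epsilon> / (norm z + 1) > 0" by (simp add: add_nonneg_pos)
      moreover have "\<kappa> \<in> closure T" using \<kappa>(1) T(3) by blast
      ultimately obtain t where t: "t \<in> T" "dist t \<kappa> < \<epsilon> / (norm z + 1)"
        unfolding closure_approachable by blast
      obtain j where j: "k j = t"
        using from_nat_into_surj[OF T(1) t(1)] unfolding k_def by blast
      have "z \<bullet> \<kappa> - z \<bullet> t \<le> norm z * norm (t - \<kappa>)"
        using norm_cauchy_schwarz[of z "\<kappa> - t"] by (simp add: inner_diff_right norm_minus_commute)
      also have "\<dots> \<le> (norm z + 1) * norm (t - \<kappa>)"
        by (intro mult_right_mono) auto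
      also have "\<dots> < (norm z + 1) * (\<epsilon> / (norm z + 1))"
        using t(2) by (intro mult_strict_left_mono) (auto simp: dist_norm add_nonneg_pos)
      also have "\<dots> = \<epsilon>"
        using norm_ge_zero[of z] by (simp add: add_nonneg_eq_0_iff)
      finally show "\<exists>j. z \<bullet> k j > z \<bullet> \<kappa> - \<epsilon>"
        using j by (intro exI[of _ j]) simp
    qed
    have gap: "norm N * (1 - \<kappa> \<bullet> M n) \<le> 2 * (z \<bullet> \<kappa> - z \<bullet> M n)" for n
    proof -
      have "M n \<bullet> (z - (norm N / 2) *\<^sub>R \<kappa>) \<le> z \<bullet> \<kappa> - norm N / 2"
        unfolding M_def
      proof (rule softmax_inner_le)
        show "k j \<bullet> (z - (norm N / 2) *\<^sub>R \<kappa>) \<le> z \<bullet> \<kappa> - norm N / 2" for j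
          using \<kappa>(3)[OF k_in[of j]] by (simp add: inner_diff_right inner_commute field_simps)
      qed simp
      then show ?thesis
        by (simp add: inner_diff_right inner_commute algebra_simps)
    qed
    have pos: "norm N * (1 - \<kappa> \<bullet> M n) \<ge> 0" for n
    proof -
      have "norm (M n) \<le> 1"
        using norm_softmax_le[of "Suc n" k _ z] k_norm by (simp add: M_def del: of_nat_Suc)
      then have "\<kappa> \<bullet> M n \<le> 1"
        using norm_cauchy_schwarz[of \<kappa> "M n"] norm\<kappa> by simp
      then show ?thesis by simp
    qed
    have "(\<lambda>n. norm N * (1 - \<kappa> \<bullet> M n)) \<longlonglongrightarrow> 0"
    proof (rule tendsto_sandwich[of "\<lambda>_. 0" _ _ "\<lambda>n. 2 * (z \<bullet> \<kappa> - z \<bullet> M n)"])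
      have "(\<lambda>n. 2 * (z \<bullet> \<kappa> - z \<bullet> M n)) \<longlonglongrightarrow> 2 * (z \<bullet> \<kappa> - z \<bullet> \<kappa>)"
        by (intro tendsto_intros lim)
      then show "(\<lambda>n. 2 * (z \<bullet> \<kappa> - z \<bullet> M n)) \<longlonglongrightarrow> 0" by simp
    qed (use gap pos in auto)
    then have "(\<lambda>n. norm N - norm N * (1 - \<kappa> \<bullet> M n)) \<longlonglongrightarrow> norm N - 0"
      by (intro tendsto_diff tendsto_const)
    moreover have "norm N - norm N * (1 - \<kappa> \<bullet> M n) = \<nu> n z \<bullet> N" for n
    proof -
      have "\<nu> n z \<bullet> N = \<nu> n z \<bullet> (norm N *\<^sub>R (- rot90 \<kappa>))" using \<kappa>(2) by simp
      also have "\<dots> = norm N * (\<kappa> \<bullet> M n)"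
        by (simp add: \<nu>_def M_def inner_commute)
      finally show ?thesis by (simp add: right_diff_distrib)
    qed
    ultimately show "(\<lambda>n. \<nu> n z \<bullet> hnormal (grad_family \<I>) z) \<longlonglongrightarrow> norm (hnormal (grad_family \<I>) z)"
      by (simp add: N_def)
  qed
qed

end

section \<open>Minimality\<close>

context arc_family
begin

text \<open>Test the perimeter of \<open>F\<close> against \<open>W n = (1 - \<eta>) V + \<eta> \<nu> n\<close>. On the symmetric difference \<open>\<eta>\<close> attains its maximum 1, so
  its derivative vanishes and the divergence of \<open>W n\<close> is that of \<open>\<nu> n\<close>, which is zero. Hence \<open>W n\<close> has the same
  integral over \<open>F\<close> as over the subgraph, where it is the flux through the graph.\<close>

lemma competitor_flux_le:
  assumes ne: "\<I> \<noteq> {}" and ct: "countable \<I>"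
    and V: "V \<in> test_fields \<Omega>"
    and \<eta>: "C1_on UNIV \<eta>" "\<And>p. 0 \<le> \<eta> p" "\<And>p. \<eta> p \<le> 1"
      "compact (closure {p. \<eta> p \<noteq> 0})" "closure {p. \<eta> p \<noteq> 0} \<subseteq> \<Omega>"
    and F: "\<And>p. p \<in> sym_diff (subgraph (u_family \<I>)) F \<Longrightarrow> \<eta> p = 1"
  defines "N \<equiv> hnormal (grad_family \<I>)" and "q \<equiv> \<lambda>z. at_height z (u_family \<I> z)"
  shows "ereal (LINT z|lborel. (1 - \<eta> (q z)) * (V (q z) \<bullet> N z) + \<eta> (q z) * norm (N z)) \<le> perimeter F \<Omega>"
    and "integrable lborel (\<lambda>z. (1 - \<eta> (q z)) * (V (q z) \<bullet> N z) + \<eta> (q z) * norm (N z))"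
proof -
  let ?E = "subgraph (u_family \<I>)"
  obtain \<nu> :: "nat \<Rightarrow> plane \<Rightarrow> plane" and \<nu>' :: "nat \<Rightarrow> plane \<Rightarrow> plane \<Rightarrow> plane" where
    \<nu>: "\<And>n z. (\<nu> n has_derivative \<nu>' n z) (at z)" "\<And>n h. continuous_on UNIV (\<lambda>z. \<nu>' n z h)"
      "\<And>n z. fst (\<nu>' n z (1, 0)) + snd (\<nu>' n z (0, 1)) = 0" "\<And>n z. norm (\<nu> n z) \<le> 1"
      "\<And>z. (\<lambda>n. \<nu> n z \<bullet> N z) \<longlonglongrightarrow> norm (N z)"
    by (rule calibration[OF ne, folded N_def], rule that)
  obtain L where L: "slope_bound L \<I>" using slope_bound_exists by blast
  obtain V' :: "heis \<Rightarrow> heis \<Rightarrow>\<^sub>L plane" where V': "\<And>p. (V has_derivative V' p) (at p)" "continuous_on UNIV V'"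
    using V unfolding test_fields_def C1_on_def by auto
  obtain \<eta>' :: "heis \<Rightarrow> heis \<Rightarrow>\<^sub>L real" where \<eta>': "\<And>p. (\<eta> has_derivative \<eta>' p) (at p)" "continuous_on UNIV \<eta>'"
    using \<eta>(1) unfolding C1_on_def by auto
  have cV: "continuous_on UNIV V" and c\<eta>: "continuous_on UNIV \<eta>"
    by (rule test_field_continuous[OF V], rule C1_on_continuous[OF \<eta>(1)])
  define pr :: "heis \<Rightarrow> plane" where "pr p = (fst p, fst (snd p))" for p
  have pr': "(pr has_derivative pr) (at p)" for p
    unfolding pr_def[abs_def] by (auto intro!: derivative_eq_intros)
  have cpr: "continuous_on A pr" for A
    unfolding pr_def[abs_def] by (intro continuous_intros)
  have c\<nu>: "continuous_on UNIV (\<nu> n)" for n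
    using \<nu>(1) by (meson continuous_at_imp_continuous_on has_derivative_continuous)
  define W where "W n p = (1 - \<eta> p) *\<^sub>R V p + \<eta> p *\<^sub>R \<nu> n (pr p)" for n p
  define W' where "W' n p h = ((1 - \<eta> p) *\<^sub>R V' p h + (0 - \<eta>' p h) *\<^sub>R V p)
    + (\<eta> p *\<^sub>R \<nu>' n (pr p) (pr h) + \<eta>' p h *\<^sub>R \<nu> n (pr p))" for n p h
  have W': "(W n has_derivative W' n p) (at p)" for n p
    unfolding W_def[abs_def] W'_def[abs_def]
    by (intro has_derivative_add has_derivative_scaleR has_derivative_diff has_derivative_const
        \<eta>' V' has_derivative_compose[OF pr' \<nu>(1)])
  have supp: "{p. W n p \<noteq> 0} \<subseteq> closure {p. V p \<noteq> 0} \<union> closure {p. \<eta> p \<noteq> 0}" for n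
  proof
    fix p assume "p \<in> {p. W n p \<noteq> 0}"
    then have "p \<in> {p. V p \<noteq> 0} \<union> {p. \<eta> p \<noteq> 0}" by (auto simp: W_def)
    then show "p \<in> closure {p. V p \<noteq> 0} \<union> closure {p. \<eta> p \<noteq> 0}"
      by (rule subsetD[OF Un_mono[OF closure_subset closure_subset]])
  qed
  have comp: "compact (closure {p. V p \<noteq> 0} \<union> closure {p. \<eta> p \<noteq> 0})"
    using V \<eta>(4) unfolding test_fields_def by (intro compact_Un) auto
  have clW: "closure {p. W n p \<noteq> 0} \<subseteq> closure {p. V p \<noteq> 0} \<union> closure {p. \<eta> p \<noteq> 0}" for n
    by (intro closure_minimal supp compact_imp_closed comp)
  have W: "W n \<in> test_fields \<Omega>" for n
    unfolding test_fields_def mem_Collect_eq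
  proof (intro conjI allI)
    have "continuous_on UNIV (\<lambda>p. W' n p h)" for h
      unfolding W'_def
      by (intro continuous_intros c\<eta> cV V'(2) \<eta>'(2) continuous_on_compose2[OF \<nu>(2) cpr]
          continuous_on_compose2[OF c\<nu> cpr]) auto
    then show "C1_on UNIV (W n)"
      using W' by (intro C1_onI)
    show "compact (closure {p. W n p \<noteq> 0})"
      using bounded_subset[OF compact_imp_bounded[OF comp] clW] by (simp add: compact_eq_bounded_closed)
    show "closure {p. W n p \<noteq> 0} \<subseteq> \<Omega>"
      using clW[of n] \<eta>(5) V unfolding test_fields_def by blast
    show "norm (W n p) \<le> 1" for p
    proof -
      have "norm (W n p) \<le> (1 - \<eta> p) * norm (V p) + \<eta> p * norm (\<nu> n (pr p))"
        using norm_triangle_ineq[of "(1 - \<eta> p) *\<^sub>R V p" "\<eta> p *\<^sub>R \<nu> n (pr p)"] \<eta>(2,3)[of p]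
        by (simp add: W_def)
      also have "\<dots> \<le> (1 - \<eta> p) * 1 + \<eta> p * 1"
        using \<eta>(2,3)[of p] \<nu>(4) test_field_norm_le[OF V] by (intro add_mono mult_left_mono) auto
      finally show ?thesis by simp
    qed
  qed
  have div0: "hdiv (W n) p = 0" if "\<eta> p = 1" for n p
  proof -
    have "blinfun_apply (\<eta>' p) = (\<lambda>h. 0)"
      using that \<eta>(3) by (intro differential_zero_maxmin[OF _ open_UNIV \<eta>'(1)]) auto
    then have "hdiv (W n) p = fst (\<nu>' n (pr p) (1, 0)) + snd (\<nu>' n (pr p) (0, 1))"
      using that by (simp add: hdiv_eq[OF W'] W'_def pr_def)
    then show ?thesis using \<nu>(3) by simp
  qed
  have le: "ereal (LINT z|lborel. W n (q z) \<bullet> N z) \<le> perimeter F \<Omega>" for n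
  proof -
    have ind: "indicat_real ?E p *\<^sub>R hdiv (W n) p = indicat_real F p *\<^sub>R hdiv (W n) p" for p
      using F[of p] div0[of p n] by (auto simp: indicator_def)
    have "(LINT p:F|lebesgue. hdiv (W n) p) = (LINT p:?E|lebesgue. hdiv (W n) p)"
      unfolding set_lebesgue_integral_def ind ..
    also have "\<dots> = (LINT z|lborel. W n (q z) \<bullet> N z)"
      unfolding N_def q_def by (rule flux_family[OF ct W])
    finally show ?thesis
      unfolding perimeter_def using W by (metis (no_types, lifting) SUP_upper)
  qed
  obtain V1 R1 where R1: "R1 > 0" "\<And>p. norm p > R1 \<Longrightarrow> V p = 0"
    by (rule test_fieldE[OF V], rule that)
  obtain R2 where R2: "R2 > 0" "\<And>p. p \<in> closure {p. \<eta> p \<noteq> 0} \<Longrightarrow> norm p \<le> R2"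
    using compact_imp_bounded[OF \<eta>(4)] unfolding bounded_pos by blast
  define R where "R = max R1 R2"
  have R: "R \<ge> 0" using R1 by (simp add: R_def)
  have out: "W n (q z) = 0" "V (q z) = 0" "\<eta> (q z) = 0" if "norm z > R" for n z
  proof -
    have qR: "norm (q z) > R" using that norm_at_height(1)[of z "u_family \<I> z"] by (simp add: q_def)
    have "V (q z) = 0"
      using qR by (intro R1(2)) (simp add: R_def)
    moreover have "\<eta> (q z) = 0"
    proof (rule ccontr)
      assume "\<eta> (q z) \<noteq> 0"
      then have "norm (q z) \<le> R2"
        by (intro R2(2) subsetD[OF closure_subset]) simp
      then show False using qR by (simp add: R_def)
    qed
    ultimately have "V (q z) = 0" "\<eta> (q z) = 0" by simp_all
    then show "W n (q z) = 0" "V (q z) = 0" "\<eta> (q z) = 0" by (simp_all add: W_def)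
  qed
  have cW: "continuous_on UNIV (W n)" for n
    using W by (rule test_field_continuous)
  have mW: "(\<lambda>z. W n (q z) \<bullet> N z) \<in> borel_measurable lborel" for n
    unfolding N_def q_def
    using integrable_flux(2)[where R=R, OF L ct trace_borel[OF cW]] out[unfolded q_def] R test_field_norm_le[OF W] by simp
  let ?l = "\<lambda>z. (1 - \<eta> (q z)) * (V (q z) \<bullet> N z) + \<eta> (q z) * norm (N z)"
  have ptw: "(\<lambda>n. W n (q z) \<bullet> N z) \<longlonglongrightarrow> ?l z" for z
  proof -
    have "pr (q z) = z" by (simp add: pr_def q_def at_height_def)
    then have "W n (q z) \<bullet> N z = (1 - \<eta> (q z)) * (V (q z) \<bullet> N z) + \<eta> (q z) * (\<nu> n z \<bullet> N z)" for n
      by (simp add: W_def inner_add_left)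
    then show ?thesis by (simp only:) (intro tendsto_intros \<nu>(5))
  qed
  have ml: "?l \<in> borel_measurable lborel"
    by (rule borel_measurable_LIMSEQ_real[OF ptw mW])
  have bnd: "norm (W n (q z) \<bullet> N z) \<le> indicator (cball 0 R) z * ((2 * L + 2) * R)" for n z
    unfolding N_def real_norm_def
    by (intro flux_density_le[OF L] test_field_norm_le[OF W] out R)
  note dc = ml mW integrable_cball_const[of R "(2 * L + 2) * R"]
  show "integrable lborel ?l"
    by (rule integrable_dominated_convergence[OF dc]) (auto intro!: always_eventually ptw bnd simp del: real_norm_def)
  have "(\<lambda>n. LINT z|lborel. W n (q z) \<bullet> N z) \<longlonglongrightarrow> (LINT z|lborel. ?l z)"
    by (rule integral_dominated_convergence[OF dc]) (auto intro!: always_eventually ptw bnd simp del: real_norm_def)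
  then have "(\<lambda>n. ereal (LINT z|lborel. W n (q z) \<bullet> N z)) \<longlonglongrightarrow> ereal (LINT z|lborel. ?l z)"
    by (rule tendsto_ereal)
  then show "ereal (LINT z|lborel. ?l z) \<le> perimeter F \<Omega>"
    by (rule LIMSEQ_le_const2) (use le in blast)
qed

lemma graph_flux_zero:
  assumes "V \<in> test_fields \<Omega>" "\<And>z. at_height z (u_family \<I> z) \<notin> \<Omega>"
  shows "V (at_height z (u_family \<I> z)) = 0"
proof (rule ccontr)
  assume "V (at_height z (u_family \<I> z)) \<noteq> 0"
  then have "at_height z (u_family \<I> z) \<in> closure {p. V p \<noteq> 0}"
    by (intro subsetD[OF closure_subset]) simp
  then show False
    using assms unfolding test_fields_def by blast
qed

lemma locally_finite_perimeter_subgraph: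
  assumes ct: "countable \<I>"
  shows "locally_finite_perimeter (subgraph (u_family \<I>))"
  unfolding locally_finite_perimeter_def
proof (intro conjI allI impI)
  show "subgraph (u_family \<I>) \<in> sets lebesgue"
    using sets_completionI_sub[of "subgraph (u_family \<I>)" lborel] closed_subgraph[OF continuous_u_family]
    by simp
  fix \<Omega> :: "heis set" assume "open \<Omega> \<and> bounded \<Omega>"
  then obtain R where R: "R > 0" "\<And>p. p \<in> \<Omega> \<Longrightarrow> norm p \<le> R"
    unfolding bounded_pos by blast
  obtain L where L: "slope_bound L \<I>" using slope_bound_exists by blast
  define c where "c = (LINT z :: plane|lborel. indicator (cball 0 R) z * ((2 * L + 2) * R))"
  have "ereal (LINT p:subgraph (u_family \<I>)|lebesgue. hdiv V p) \<le> ereal c" if V: "V \<in> test_fields \<Omega>" for V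
  proof -
    let ?v = "\<lambda>z. V (at_height z (u_family \<I> z))"
    have cV: "continuous_on UNIV V"
      using V by (rule test_field_continuous)
    have vm: "?v \<in> borel_measurable borel"
      by (rule trace_borel[OF cV])
    have v0: "?v z = 0" if "norm z > R" for z
    proof (rule ccontr)
      assume "?v z \<noteq> 0"
      then have "at_height z (u_family \<I> z) \<in> closure {p. V p \<noteq> 0}"
        by (intro subsetD[OF closure_subset]) simp
      then have "norm (at_height z (u_family \<I> z)) \<le> R"
        using V by (intro R(2)) (auto simp: test_fields_def)
      then show False using that norm_at_height(1)[of z "u_family \<I> z"] by linarith
    qed
    have "(LINT z|lborel. ?v z \<bullet> hnormal (grad_family \<I>) z) \<le> c"
      unfolding c_def
    proof (rule integral_mono)
      show "integrable lborel (\<lambda>z. ?v z \<bullet> hnormal (grad_family \<I>) z)"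
        using R(1) by (intro integrable_flux(1)[OF L ct vm test_field_norm_le[OF V] v0]) auto
      show "?v z \<bullet> hnormal (grad_family \<I>) z \<le> indicator (cball 0 R) z * ((2 * L + 2) * R)" for z
        using R(1) by (intro order_trans[OF abs_ge_self flux_density_le[OF L test_field_norm_le[OF V] v0]]) auto
    qed (rule integrable_cball_const)
    then show ?thesis by (simp add: flux_family[OF ct V])
  qed
  then have "perimeter (subgraph (u_family \<I>)) \<Omega> \<le> ereal c"
    unfolding perimeter_def by (rule SUP_least)
  then show "perimeter (subgraph (u_family \<I>)) \<Omega> < \<infinity>"
    by (rule le_less_trans) simp
qed

text \<open>Replacing \<open>V\<close> by the calibration where \<open>\<eta>\<close> is positive can only increase the flux, since \<open>V \<bullet> N \<le> \<bar>N\<bar>\<close>.\<close>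

lemma local_perimeter_minimizer_subgraph:
  assumes ne: "\<I> \<noteq> {}" and ct: "countable \<I>"
  shows "local_perimeter_minimizer (subgraph (u_family \<I>))"
  unfolding local_perimeter_minimizer_def perimeter_minimizer_def
proof (intro allI impI, elim conjE)
  let ?E = "subgraph (u_family \<I>)" and ?N = "hnormal (grad_family \<I>)" and ?q = "\<lambda>z. at_height z (u_family \<I> z)"
  fix \<Omega> F :: "heis set"
  assume op: "open \<Omega>" and cp: "compact (closure (sym_diff ?E F))" and sub: "closure (sym_diff ?E F) \<subseteq> \<Omega>"
  obtain \<eta> :: "heis \<Rightarrow> real"
    where \<eta>: "C1_on UNIV \<eta>" "\<And>p. 0 \<le> \<eta> p" "\<And>p. \<eta> p \<le> 1" "\<And>p. p \<in> closure (sym_diff ?E F) \<Longrightarrow> \<eta> p = 1"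
      "compact (closure {p. \<eta> p \<noteq> 0})" "closure {p. \<eta> p \<noteq> 0} \<subseteq> \<Omega>"
    by (rule C1_cutoff[OF cp op sub], rule that)
  have \<eta>F: "\<eta> p = 1" if "p \<in> sym_diff ?E F" for p
    using that by (intro \<eta>(4) subsetD[OF closure_subset])
  obtain L where L: "slope_bound L \<I>" using slope_bound_exists by blast
  show "perimeter ?E \<Omega> \<le> perimeter F \<Omega>"
    unfolding perimeter_def[of ?E]
  proof (rule SUP_least)
    fix V assume V: "V \<in> test_fields \<Omega>"
    note comp = competitor_flux_le[OF ne ct V \<eta>(1-3,5,6) \<eta>F]
    obtain V1 R where R: "R > 0" "\<And>p. norm p > R \<Longrightarrow> V p = 0"
      by (rule test_fieldE[OF V], rule that)
    have cV: "continuous_on UNIV V"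
      using V by (rule test_field_continuous)
    have vm: "(\<lambda>z. V (?q z)) \<in> borel_measurable borel"
      by (rule trace_borel[OF cV])
    have v0: "V (?q z) = 0" if "norm z > R" for z
      using that norm_at_height(1)[of z "u_family \<I> z"] by (intro R(2)) linarith
    have "(LINT z|lborel. V (?q z) \<bullet> ?N z)
        \<le> (LINT z|lborel. (1 - \<eta> (?q z)) * (V (?q z) \<bullet> ?N z) + \<eta> (?q z) * norm (?N z))"
    proof (rule integral_mono[OF _ comp(2)])
      show "integrable lborel (\<lambda>z. V (?q z) \<bullet> ?N z)"
        using R(1) by (intro integrable_flux(1)[OF L ct vm test_field_norm_le[OF V] v0]) auto
      show "V (?q z) \<bullet> ?N z \<le> (1 - \<eta> (?q z)) * (V (?q z) \<bullet> ?N z) + \<eta> (?q z) * norm (?N z)" for z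
      proof -
        have "V (?q z) \<bullet> ?N z \<le> norm (V (?q z)) * norm (?N z)"
          by (rule norm_cauchy_schwarz)
        also have "\<dots> \<le> 1 * norm (?N z)"
          by (intro mult_right_mono test_field_norm_le[OF V]) simp
        finally have "\<eta> (?q z) * (V (?q z) \<bullet> ?N z) \<le> \<eta> (?q z) * norm (?N z)"
          using \<eta>(2) by (simp add: mult_left_mono)
        then show ?thesis by (simp add: left_diff_distrib)
      qed
    qed auto
    then show "ereal (LINT p:?E|lebesgue. hdiv V p) \<le> perimeter F \<Omega>"
      unfolding flux_family[OF ct V] using comp(1) by (meson ereal_less_eq(3) order_trans)
  qed
qed

lemma hnormal_eq_0_imp:
  assumes "hnormal (grad_family \<I>) z = 0"
  shows "z = 0 \<or> (\<exists>I\<in>\<I>. across I z = 0)"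
proof (cases "\<exists>I\<in>\<I>. wedge I z > 0")
  case True
  then obtain I where I: "I \<in> \<I>" "wedge I z > 0" by blast
  have s: "sin (arc_half_angle I) > 0" using arc[OF I(1)] by (rule arc_half_angle)
  have "norm (rot90 z + grad_sector I z) = 2 * \<bar>across I z\<bar> / sin (arc_half_angle I)"
    by (rule norm_normal[OF arc[OF I(1)]])
  moreover have "rot90 z + grad_sector I z = 0"
    using assms unfolding hnormal_def u_family_in(3)[OF I] neg_equal_0_iff_equal .
  ultimately show ?thesis using s I by auto
next
  case False
  then have "rot90 z = 0"
    using assms u_family_out(2)[of z] by (auto simp: hnormal_def not_less)
  then have "norm z = 0" by (metis norm_zero rot90_simps(3))
  then show ?thesis by simp
qed

text \<open>Apart from the origin, the normal vanishes only on the bisectrices, which are the characteristic half-lines of the surface.\<close>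

lemma hnormal_nonzero_AE:
  assumes ct: "countable \<I>"
  shows "AE z in lebesgue. hnormal (grad_family \<I>) z \<noteq> 0"
proof -
  have "negligible ({0} \<union> (\<Union>I\<in>\<I>. {z. across I z = 0}))"
  proof (intro negligible_Un negligible_countable_Union countable_image ct)
    show "negligible S" if S: "S \<in> (\<lambda>I. {z. across I z = 0}) ` \<I>" for S
    proof -
      obtain I where S: "S = {z. across I z = 0}" using S by blast
      have "rot90 (arc_axis I) \<noteq> 0"
        using norm_axis[of I] by (metis norm_zero rot90_simps(3) zero_neq_one)
      then show ?thesis
        using negligible_hyperplane[of "rot90 (arc_axis I)" 0]
        by (simp add: S across_def inner_commute)
    qed
  qed simp
  then have "{0} \<union> (\<Union>I\<in>\<I>. {z. across I z = 0}) \<in> null_sets lebesgue"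
    by (simp add: negligible_iff_null_sets)
  from AE_not_in[OF this] show ?thesis
    by (rule eventually_mono) (use hnormal_eq_0_imp in auto)
qed

text \<open>A field supported off the graph has no flux. Near a point of the graph, the competitor inequality with \<open>V = 0\<close> and with the subgraph itself as competitor
  bounds the perimeter below by the integral of \<open>\<eta> \<bar>N\<bar>\<close>.\<close>

lemma perimeter_support_subgraph:
  assumes ne: "\<I> \<noteq> {}" and ct: "countable \<I>"
  shows "perimeter_support (subgraph (u_family \<I>)) = range (\<lambda>z. at_height z (u_family \<I> z))"
proof (intro equalityI subsetI)
  let ?E = "subgraph (u_family \<I>)" and ?N = "hnormal (grad_family \<I>)" and ?q = "\<lambda>z. at_height z (u_family \<I> z)"
  fix p assume p: "p \<in> perimeter_support ?E"
  show "p \<in> range ?q"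
  proof (rule ccontr)
    assume "p \<notin> range ?q"
    let ?U = "{p :: heis. snd (snd p) \<noteq> u_family \<I> (fst p, fst (snd p))}"
    have "open ?U"
      by (intro open_Collect_neq continuous_intros continuous_on_compose2[OF continuous_u_family]) auto
    moreover have "p \<in> ?U"
    proof (rule ccontr)
      assume "p \<notin> ?U"
      then have "p = ?q (fst p, fst (snd p))" by (simp add: at_height_def prod_eq_iff)
      with \<open>p \<notin> range ?q\<close> show False by blast
    qed
    ultimately have "perimeter ?E ?U > 0"
      using p unfolding perimeter_support_def by blast
    moreover have "perimeter ?E ?U \<le> 0"
      unfolding perimeter_def
    proof (rule SUP_least)
      fix V assume V: "V \<in> test_fields ?U"
      have "?q z \<notin> ?U" for z by (simp add: at_height_def)
      then show "ereal (LINT p:?E|lebesgue. hdiv V p) \<le> 0"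
        unfolding flux_family[OF ct V] by (simp add: graph_flux_zero[OF V])
    qed
    ultimately show False by simp
  qed
next
  let ?E = "subgraph (u_family \<I>)" and ?N = "hnormal (grad_family \<I>)" and ?q = "\<lambda>z. at_height z (u_family \<I> z)"
  fix p assume "p \<in> range ?q"
  then obtain z0 where z0: "p = ?q z0" by blast
  show "p \<in> perimeter_support ?E"
    unfolding perimeter_support_def mem_Collect_eq
  proof (intro allI impI, elim conjE)
    fix U :: "heis set" assume U: "open U" "p \<in> U"
    then have "{p} \<subseteq> U" by simp
    obtain \<eta> :: "heis \<Rightarrow> real"
      where \<eta>: "C1_on UNIV \<eta>" "\<And>p. 0 \<le> \<eta> p" "\<And>p. \<eta> p \<le> 1" "\<And>x. x \<in> {p} \<Longrightarrow> \<eta> x = 1"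
        "compact (closure {p. \<eta> p \<noteq> 0})" "closure {p. \<eta> p \<noteq> 0} \<subseteq> U"
      by (rule C1_cutoff[OF compact_sing[of p] U(1) \<open>{p} \<subseteq> U\<close>], rule that)
    have V0: "(\<lambda>_. 0) \<in> test_fields U"
      unfolding test_fields_def by (auto intro!: C1_onI[of _ _ "\<lambda>_ _. 0"])
    have none: "\<eta> x = 1" if "x \<in> sym_diff ?E ?E" for x
      using that by simp
    note comp = competitor_flux_le[where F="?E", OF ne ct V0 \<eta>(1-3,5,6) none]
    have int: "integrable lborel (\<lambda>z. \<eta> (?q z) * norm (?N z))"
      using comp(2) by simp
    have "(LINT z|lborel. \<eta> (?q z) * norm (?N z)) \<noteq> 0"
    proof
      assume "(LINT z|lborel. \<eta> (?q z) * norm (?N z)) = 0"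
      then have "AE z in lborel. \<eta> (?q z) * norm (?N z) = 0"
        using integral_nonneg_eq_0_iff_AE[OF int] \<eta>(2) by simp
      then have "AE z in lebesgue. \<eta> (?q z) * norm (?N z) = 0"
        by (rule AE_completion)
      then have AE: "AE z in lebesgue. z \<notin> {z. \<eta> (?q z) > 0}"
        using hnormal_nonzero_AE[OF ct] by eventually_elim auto
      have c: "continuous_on UNIV (\<lambda>z. \<eta> (?q z))"
        by (intro continuous_on_compose2[OF C1_on_continuous[OF \<eta>(1)]] continuous_intros continuous_u_family) auto
      then have op: "open {z. \<eta> (?q z) > 0}"
        by (intro open_Collect_less continuous_on_const)
      then have "{z. \<eta> (?q z) > 0} \<in> sets lebesgue"
        using sets_completionI_sub[of "{z. \<eta> (?q z) > 0}" lborel] by simp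
      then have "negligible {z. \<eta> (?q z) > 0}"
        using AE by (simp add: negligible_iff_null_sets AE_iff_null_sets)
      moreover have "z0 \<in> {z. \<eta> (?q z) > 0}"
        using \<eta>(4) z0 by simp
      ultimately show False
        using open_not_negligible[OF op] by blast
    qed
    moreover have "(LINT z|lborel. \<eta> (?q z) * norm (?N z)) \<ge> 0"
      using \<eta>(2) by (intro integral_nonneg_AE always_eventually) simp
    ultimately have "0 < ereal (LINT z|lborel. \<eta> (?q z) * norm (?N z))" by simp
    also have "\<dots> \<le> perimeter ?E U"
      using comp(1) by simp
    finally show "perimeter ?E U > 0" .
  qed
qed

lemma C_surface_eq: "C_surface \<I> = range (\<lambda>z. at_height z (u_family \<I> z))"
  by (force simp: C_surface_def t_graph_def at_height_def image_iff)

lemma u_family_scale: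
  assumes "l > 0"
  shows "u_family \<I> (l *\<^sub>R z) = l\<^sup>2 * u_family \<I> z"
proof -
  have "wedge I (l *\<^sub>R z) > 0 \<longleftrightarrow> wedge I z > 0" for I
    using assms by (simp add: wedge_scale zero_less_mult_iff)
  moreover have "u_sector I (l *\<^sub>R z) = l\<^sup>2 * u_sector I z" for I
    using assms by (simp add: u_sector_def along_across_linear abs_mult power2_eq_square algebra_simps)
  moreover note pos = calculation
  show ?thesis
  proof (cases "\<exists>I\<in>\<I>. wedge I z > 0")
    case True
    then obtain I where "I \<in> \<I>" "wedge I z > 0" by blast
    then show ?thesis
      using u_family_in(1)[of I z] u_family_in(1)[of I "l *\<^sub>R z"] pos by simp
  next
    case False
    then have "wedge I z \<le> 0" "wedge I (l *\<^sub>R z) \<le> 0" if "I \<in> \<I>" for I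
      using pos(1)[of I] that by (meson linorder_not_less)+
    then show ?thesis
      using u_family_out(1)[of z] u_family_out(1)[of "l *\<^sub>R z"] by simp
  qed
qed

lemma heis_cone_C_surface: "heis_cone (C_surface \<I>)"
  unfolding heis_cone_def
proof (intro allI impI)
  fix l :: real assume l: "l > 0"
  have d: "dilation l (at_height z (u_family \<I> z)) = at_height (l *\<^sub>R z) (u_family \<I> (l *\<^sub>R z))" for z
    using u_family_scale[OF l] by (simp add: dilation_def at_height_def)
  have "surj (\<lambda>z :: plane. l *\<^sub>R z)"
    using l by (intro surjI[of _ "\<lambda>z. (1 / l) *\<^sub>R z"]) simp
  then have "range (\<lambda>z. at_height (l *\<^sub>R z) (u_family \<I> (l *\<^sub>R z))) = range (\<lambda>z. at_height z (u_family \<I> z))"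
    using image_image[of "\<lambda>z. at_height z (u_family \<I> z)" "\<lambda>z. l *\<^sub>R z" UNIV] by simp
  then show "dilation l ` C_surface \<I> = C_surface \<I>"
    unfolding C_surface_eq image_image d .
qed

theorem minimal_cone_C_surface:
  assumes "\<I> \<noteq> {}" "countable \<I>"
  shows "minimal_cone (C_surface \<I>)"
  unfolding minimal_cone_def minimal_surface_def
  using locally_finite_perimeter_subgraph local_perimeter_minimizer_subgraph perimeter_support_subgraph
    heis_cone_C_surface assms C_surface_eq by metis

end

section \<open>Regularity of graphs\<close>

lemma C1_surface_graphI:
  fixes u :: "plane \<Rightarrow> real"
  assumes u: "\<And>z. (u has_derivative (\<lambda>h. D z \<bullet> h)) (at z)" and D: "continuous_on UNIV D"
  shows "C1_surface (range (\<lambda>z. at_height z (u z)))"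
  unfolding C1_surface_def
proof (intro ballI exI conjI)
  define pr :: "heis \<Rightarrow> plane" where "pr p = (fst p, fst (snd p))" for p
  define f where "f c p = (fst p, fst (snd p), snd (snd p) + c * u (pr p))" for c :: real and p :: heis
  have ct_pr: "continuous_on A pr" for A
    unfolding pr_def[abs_def] by (intro continuous_intros)
  have pr': "(pr has_derivative pr) (at p)" for p
    unfolding pr_def[abs_def] by (auto intro!: derivative_eq_intros)
  have fd: "(f c has_derivative (\<lambda>h. (fst h, fst (snd h), snd (snd h) + c * (D (pr p) \<bullet> pr h)))) (at p)" for c p
    unfolding f_def[abs_def]
    by (intro has_derivative_Pair has_derivative_add has_derivative_mult_right has_derivative_fst has_derivative_snd
        has_derivative_ident has_derivative_compose[OF pr' u])
  have C1: "C1_on UNIV (f c)" for c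
    by (rule C1_onI[OF fd]) (intro continuous_intros continuous_on_compose2[OF D ct_pr] subset_UNIV)
  have inv: "f (- c) (f c p) = p" for c p
    by (simp add: f_def pr_def)
  show "open (UNIV :: heis set)" "open (UNIV :: heis set)" by simp_all
  show "p \<in> UNIV" for p :: heis by simp
  show "homeomorphism UNIV UNIV (f (- 1)) (f 1)"
  proof -
    have "range (f c) = UNIV" for c
      using inv[of "- c"] by (intro surjI[of _ "f (- c)"]) simp
    then show ?thesis
      using C1_on_continuous[OF C1] inv[of 1] inv[of "- 1"] by (simp add: homeomorphism_def)
  qed
  show "C1_on UNIV (f (- 1))" "C1_on UNIV (f 1)" by (rule C1)+
  show "f (- 1) ` (range (\<lambda>z. at_height z (u z)) \<inter> UNIV) = {q \<in> UNIV. snd (snd q) = 0}"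
  proof (intro equalityI subsetI)
    fix q assume "q \<in> f (- 1) ` (range (\<lambda>z. at_height z (u z)) \<inter> UNIV)"
    then show "q \<in> {q \<in> UNIV. snd (snd q) = 0}"
      by (auto simp: f_def at_height_def pr_def)
  next
    fix q :: heis assume "q \<in> {q \<in> UNIV. snd (snd q) = 0}"
    then have "q = f (- 1) (at_height (pr q) (u (pr q)))"
      by (simp add: f_def at_height_def pr_def prod_eq_iff)
    then show "q \<in> f (- 1) ` (range (\<lambda>z. at_height z (u z)) \<inter> UNIV)" by blast
  qed
qed

text \<open>A curve in a Lipschitz graph cannot have a vertical velocity. Hence the tangent planes of such a graph are
  not vertical.\<close>

lemma no_vertical_curve:
  fixes \<gamma> :: "real \<Rightarrow> heis"
  assumes u: "locally_lipschitz u"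
    and \<gamma>: "(\<gamma> has_derivative (\<lambda>s. s *\<^sub>R (0, 0, 1))) (at 0)"
    and d: "d > 0" "\<And>s. \<bar>s\<bar> < d \<Longrightarrow> \<gamma> s \<in> range (\<lambda>z. at_height z (u z))"
  shows False
proof -
  define \<zeta> where "\<zeta> s = (fst (\<gamma> s), fst (snd (\<gamma> s)))" for s
  define \<tau> where "\<tau> s = snd (snd (\<gamma> s))" for s
  have \<tau>u: "\<tau> s = u (\<zeta> s)" if "\<bar>s\<bar> < d" for s
    using d(2)[OF that] by (auto simp: \<tau>_def \<zeta>_def at_height_def)
  obtain L where L: "L > 0" "\<And>w. norm (w - \<zeta> 0) \<le> 1 \<Longrightarrow> \<bar>u w - u (\<zeta> 0)\<bar> \<le> L * norm (w - \<zeta> 0)"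
    by (rule locally_lipschitzE[OF u], rule that)
  have \<zeta>': "(\<zeta> has_derivative (\<lambda>s. 0)) (at 0)"
    using has_derivative_Pair[OF has_derivative_fst[OF \<gamma>] has_derivative_fst[OF has_derivative_snd[OF \<gamma>]]]
    by (simp add: \<zeta>_def[abs_def] zero_prod_def)
  have \<tau>': "(\<tau> has_derivative (\<lambda>s. s)) (at 0)"
    using has_derivative_snd[OF has_derivative_snd[OF \<gamma>]] by (simp add: \<tau>_def[abs_def])
  \<comment> \<open>The Lipschitz bound makes \<open>\<tau>\<close> move by at most \<open>L * e\<close> times \<open>\<bar>s\<bar>\<close>, against at least \<open>1 / 2\<close> times \<open>\<bar>s\<bar>\<close> by its derivative.\<close>
  define e where "e = 1 / (4 * (L + 1))"
  have e: "e > 0" "e \<le> 1" "L * e \<le> 1 / 4"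
    using L(1) by (auto simp: e_def field_simps)
  obtain d1 where d1: "d1 > 0" "\<And>s. \<bar>s\<bar> < d1 \<Longrightarrow> norm (\<zeta> s - \<zeta> 0) \<le> e * \<bar>s\<bar>"
    using \<zeta>' e(1) unfolding has_derivative_at_alt by force
  obtain d2 where d2: "d2 > 0" "\<And>s. \<bar>s\<bar> < d2 \<Longrightarrow> \<bar>\<tau> s - \<tau> 0 - s\<bar> \<le> 1 / 2 * \<bar>s\<bar>"
    using \<tau>' unfolding has_derivative_at_alt
    by (metis diff_zero real_norm_def half_gt_zero_iff zero_less_one)
  define s where "s = min (min d d1) (min d2 1) / 2"
  have s: "s > 0" "\<bar>s\<bar> < d" "\<bar>s\<bar> < d1" "\<bar>s\<bar> < d2" "s < 1"
    using d(1) d1(1) d2(1) by (auto simp: s_def)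
  have "e * \<bar>s\<bar> \<le> 1 * 1"
    using e s by (intro mult_mono) auto
  then have "norm (\<zeta> s - \<zeta> 0) \<le> 1"
    using d1(2)[OF s(3)] by linarith
  then have "\<bar>u (\<zeta> s) - u (\<zeta> 0)\<bar> \<le> L * norm (\<zeta> s - \<zeta> 0)"
    by (rule L(2))
  also have "\<dots> \<le> L * (e * \<bar>s\<bar>)"
    using d1(2)[OF s(3)] L(1) by (intro mult_left_mono) auto
  also have "\<dots> = (L * e) * \<bar>s\<bar>" by simp
  also have "\<dots> \<le> 1 / 4 * \<bar>s\<bar>"
    using e(3) by (intro mult_right_mono) auto
  finally have "\<bar>\<tau> s - \<tau> 0\<bar> \<le> 1 / 4 * \<bar>s\<bar>"
    using \<tau>u[OF s(2)] \<tau>u[of 0] d(1) by simp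
  with d2(2)[OF s(4)] s(1) show False by linarith
qed

text \<open>The third component \<open>h\<close> of a straightening chart vanishes on the graph. Its vertical derivative \<open>c\<close> is nonzero, since
  otherwise the inverse chart would map a line in \<open>{t = 0}\<close> to a curve in the graph with vertical velocity. As \<open>u\<close> is
  Lipschitz, \<open>h (z, u z) = 0\<close> may be differentiated as in the implicit function theorem.\<close>

lemma C1_surface_graph_local:
  fixes u :: "plane \<Rightarrow> real"
  assumes u: "locally_lipschitz u" and surf: "C1_surface (range (\<lambda>z. at_height z (u z)))"
  obtains W D where "open W" "z0 \<in> W" "continuous_on W D"
    "\<And>z. z \<in> W \<Longrightarrow> (u has_derivative (\<lambda>h. D z \<bullet> h)) (at z)"
proof -
  define q where "q z = at_height z (u z)" for z
  obtain U V and \<phi> :: "heis \<Rightarrow> heis" and \<psi> where UV: "open U" "q z0 \<in> U" "open V" "homeomorphism U V \<phi> \<psi>"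
      "C1_on U \<phi>" "C1_on V \<psi>" "\<phi> ` (range q \<inter> U) = {p \<in> V. snd (snd p) = 0}"
    using bspec[OF surf[unfolded C1_surface_def] rangeI[of "\<lambda>z. at_height z (u z)" z0]]
    unfolding q_def[symmetric] q_def[abs_def, symmetric] by (elim exE conjE) (rule that)
  obtain \<phi>' :: "heis \<Rightarrow> heis \<Rightarrow>\<^sub>L heis"
    where \<phi>': "\<And>p. p \<in> U \<Longrightarrow> (\<phi> has_derivative \<phi>' p) (at p)" "continuous_on U \<phi>'"
    using UV(5) unfolding C1_on_def by blast
  obtain \<psi>' :: "heis \<Rightarrow> heis \<Rightarrow>\<^sub>L heis"
    where \<psi>': "\<And>p. p \<in> V \<Longrightarrow> (\<psi> has_derivative \<psi>' p) (at p)"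
    using UV(6) unfolding C1_on_def by blast
  have hom: "\<And>p. p \<in> U \<Longrightarrow> \<psi> (\<phi> p) = p" "\<And>p. p \<in> U \<Longrightarrow> \<phi> p \<in> V"
    using UV(4) unfolding homeomorphism_def by blast+
  define h where "h p = snd (snd (\<phi> p))" for p
  define h' where "h' p v = snd (snd (\<phi>' p v))" for p v
  have h': "(h has_derivative h' p) (at p)" if "p \<in> U" for p
    unfolding h_def[abs_def] h'_def[abs_def] by (intro has_derivative_snd \<phi>' that)
  have lin: "linear (h' p)" if "p \<in> U" for p
    using h'[OF that] by (intro bounded_linear.linear has_derivative_bounded_linear)
  have h0: "h (q z) = 0" if "q z \<in> U" for z
    using UV(7) that unfolding h_def by blast
  have cq: "continuous_on UNIV q"
    unfolding q_def by (intro continuous_intros locally_lipschitz_continuous[OF u])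
  define W where "W = q -` U"
  have W: "open W" "z0 \<in> W"
    using continuous_on_open_vimage[of UNIV q] cq UV(1,2) by (auto simp: W_def)
  define c where "c z = h' (q z) (0, 0, 1)" for z
  have c: "c z \<noteq> 0" if z: "z \<in> W" for z
  proof
    assume "c z = 0"
    have p: "q z \<in> U" using z by (simp add: W_def)
    define b where "b = \<phi> (q z)"
    define w where "w = \<phi>' (q z) (0, 0, 1)"
    have b: "b \<in> V" "snd (snd b) = 0"
      using hom(2)[OF p] h0[OF p] by (simp_all add: b_def h_def)
    have w0: "snd (snd w) = 0"
      using \<open>c z = 0\<close> by (simp add: c_def h'_def w_def)
    have "((\<lambda>p. \<psi> (\<phi> p)) has_derivative (\<lambda>v. \<psi>' b (\<phi>' (q z) v))) (at (q z))"
      using has_derivative_compose[OF \<phi>'(1)[OF p]] \<psi>'[OF b(1)] by (simp add: b_def)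
    then have "((\<lambda>p. p) has_derivative (\<lambda>v. \<psi>' b (\<phi>' (q z) v))) (at (q z))"
      by (rule has_derivative_transform_within_open[OF _ UV(1) p]) (rule hom(1))
    then have "(\<lambda>v. \<psi>' b (\<phi>' (q z) v)) = (\<lambda>v. v)"
      by (rule has_derivative_unique[OF _ has_derivative_ident])
    then have \<psi>w: "\<psi>' b w = (0, 0, 1)"
      unfolding w_def by metis
    define \<gamma> where "\<gamma> s = \<psi> (b + s *\<^sub>R w)" for s :: real
    have "((\<lambda>s. b + s *\<^sub>R w) has_derivative (\<lambda>s. s *\<^sub>R w)) (at 0)"
      by (auto intro!: derivative_eq_intros)
    then have "(\<gamma> has_derivative (\<lambda>s. \<psi>' b (s *\<^sub>R w))) (at 0)"
      unfolding \<gamma>_def[abs_def] using \<psi>'[OF b(1)] by (intro has_derivative_compose[of _ _ 0 UNIV \<psi>]) auto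
    then have \<gamma>: "(\<gamma> has_derivative (\<lambda>s. s *\<^sub>R (0, 0, 1))) (at 0)"
      by (simp only: blinfun.scaleR_right \<psi>w)
    have "open ((\<lambda>s :: real. b + s *\<^sub>R w) -` V)"
      by (intro open_vimage UV(3) continuous_intros)
    moreover have "0 \<in> (\<lambda>s :: real. b + s *\<^sub>R w) -` V" using b by simp
    ultimately obtain d where d: "d > 0" "ball 0 d \<subseteq> (\<lambda>s :: real. b + s *\<^sub>R w) -` V"
      unfolding open_contains_ball by blast
    have "\<gamma> s \<in> range q" if "\<bar>s\<bar> < d" for s
    proof -
      have "b + s *\<^sub>R w \<in> {p \<in> V. snd (snd p) = 0}"
        using d(2) that b w0 by (auto simp: subset_iff)
      then obtain p where "p \<in> range q \<inter> U" "\<phi> p = b + s *\<^sub>R w"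
        unfolding UV(7)[symmetric] by (metis imageE)
      then show ?thesis
        using hom(1)[of p] by (simp add: \<gamma>_def)
    qed
    then show False
      using no_vertical_curve[OF u \<gamma> d(1)] unfolding q_def by blast
  qed
  define D where "D z = (- h' (q z) (1, 0, 0) / c z, - h' (q z) (0, 1, 0) / c z)" for z
  have "continuous_on W (\<lambda>z. h' (q z) v)" for v
    unfolding h'_def by (intro continuous_intros continuous_on_compose2[OF \<phi>'(2)] continuous_on_subset[OF cq])
      (auto simp: W_def)
  then have "continuous_on W D"
    using c unfolding D_def c_def by (intro continuous_intros) auto
  moreover have "(u has_derivative (\<lambda>v. D z \<bullet> v)) (at z)" if z: "z \<in> W" for z
    unfolding has_derivative_at_alt
  proof (intro conjI allI impI)
    show "bounded_linear (\<lambda>v. D z \<bullet> v)" by (rule bounded_linear_inner_right)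
    fix e :: real assume e: "e > 0"
    have p: "q z \<in> U" using z by (simp add: W_def)
    have split: "h' (q z) (at_height v t) = c z * (t - D z \<bullet> v)" for v t
    proof -
      have "at_height v t = fst v *\<^sub>R (1, 0, 0) + (snd v *\<^sub>R (0, 1, 0) + t *\<^sub>R (0, 0, 1))"
        by (simp add: at_height_def)
      then have "h' (q z) (at_height v t) = fst v * h' (q z) (1, 0, 0) + (snd v * h' (q z) (0, 1, 0) + t * c z)"
        by (simp only: linear_add[OF lin[OF p]] linear_scale[OF lin[OF p]] real_scaleR_def c_def)
      moreover have "c z * (D z \<bullet> v) = - (fst v * h' (q z) (1, 0, 0)) - snd v * h' (q z) (0, 1, 0)"
        using c[OF z] by (simp add: D_def inner_prod_def field_simps)
      ultimately show ?thesis by (simp add: algebra_simps)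
    qed
    obtain L where L: "L > 0" "\<And>w. norm (w - z) \<le> 1 \<Longrightarrow> \<bar>u w - u z\<bar> \<le> L * norm (w - z)"
      by (rule locally_lipschitzE[OF u], rule that)
    define e' where "e' = e * \<bar>c z\<bar> / (1 + L)"
    have "e' > 0" using e c[OF z] L(1) by (simp add: e'_def)
    then obtain d1 where d1: "d1 > 0"
      "\<And>p. norm (p - q z) < d1 \<Longrightarrow> norm (h p - h (q z) - h' (q z) (p - q z)) \<le> e' * norm (p - q z)"
      using h'[OF p] unfolding has_derivative_at_alt by blast
    obtain d2 where d2: "d2 > 0" "ball z d2 \<subseteq> W"
      using W(1) z unfolding open_contains_ball by blast
    show "\<exists>d>0. \<forall>y. norm (y - z) < d \<longrightarrow> norm (u y - u z - D z \<bullet> (y - z)) \<le> e * norm (y - z)"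
    proof (intro exI[of _ "min (min d2 1) (d1 / (1 + L))"] conjI allI impI)
      show "min (min d2 1) (d1 / (1 + L)) > 0" using d1 d2 L by simp
      fix y assume y: "norm (y - z) < min (min d2 1) (d1 / (1 + L))"
      then have "y \<in> ball z d2" by (simp add: dist_norm norm_minus_commute)
      then have "y \<in> W" using d2(2) by blast
      then have hy: "h (q y) = 0" "h (q z) = 0"
        using h0 p by (simp_all add: W_def)
      have ul: "\<bar>u y - u z\<bar> \<le> L * norm (y - z)" using y by (intro L(2)) simp
      have diff: "q y - q z = at_height (y - z) (u y - u z)"
        by (simp add: q_def at_height_def)
      have "norm (q y - q z) \<le> norm (y - z) + \<bar>u y - u z\<bar>"
      proof -
        have "at_height (y - z) (u y - u z) = at_height (y - z) 0 + at_height 0 (u y - u z)"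
          by (simp add: at_height_def)
        moreover have "norm (at_height v 0) = norm v" "norm (at_height 0 t) = \<bar>t\<bar>" for v t
          by (simp_all add: at_height_def norm_prod_def)
        ultimately show ?thesis
          unfolding diff using norm_triangle_ineq[of "at_height (y - z) 0" "at_height 0 (u y - u z)"] by simp
      qed
      then have nq: "norm (q y - q z) \<le> (1 + L) * norm (y - z)"
        using ul by (simp add: algebra_simps)
      also have "\<dots> < d1"
        using y L(1) by (simp add: field_simps)
      finally have "norm (h (q y) - h (q z) - h' (q z) (q y - q z)) \<le> e' * norm (q y - q z)"
        by (rule d1(2))
      also have "\<dots> \<le> e' * ((1 + L) * norm (y - z))"
        using nq \<open>e' > 0\<close> by (intro mult_left_mono) auto
      also have "\<dots> = \<bar>c z\<bar> * (e * norm (y - z))"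
        using L(1) by (simp add: e'_def field_simps)
      finally have "\<bar>c z\<bar> * \<bar>u y - u z - D z \<bullet> (y - z)\<bar> \<le> \<bar>c z\<bar> * (e * norm (y - z))"
        unfolding hy diff split by (simp add: abs_mult)
      then show "norm (u y - u z - D z \<bullet> (y - z)) \<le> e * norm (y - z)"
        using c[OF z] by simp
    qed
  qed
  ultimately show ?thesis
    using W by (intro that[of W D]) auto
qed

theorem C1_surface_graphD:
  fixes u :: "plane \<Rightarrow> real"
  assumes u: "locally_lipschitz u" and surf: "C1_surface (range (\<lambda>z. at_height z (u z)))"
  obtains D where "continuous_on UNIV D" "\<And>z. (u has_derivative (\<lambda>h. D z \<bullet> h)) (at z)"
proof -
  define D where "D z = (frechet_derivative u (at z) (1, 0), frechet_derivative u (at z) (0, 1))" for z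
  have D_eq: "D z = d" if "(u has_derivative (\<lambda>h. d \<bullet> h)) (at z)" for z d
    using frechet_derivative_at[OF that] by (simp add: D_def inner_prod_def flip: fun_cong[OF frechet_derivative_at[OF that]])
  have "isCont D z \<and> (u has_derivative (\<lambda>h. D z \<bullet> h)) (at z)" for z
  proof -
    obtain W E where W: "open W" "z \<in> W" "continuous_on W E"
      "\<And>z. z \<in> W \<Longrightarrow> (u has_derivative (\<lambda>h. E z \<bullet> h)) (at z)"
      by (rule C1_surface_graph_local[OF u surf, of z], rule that)
    have DE: "D y = E y" if "y \<in> W" for y
      using D_eq[OF W(4)[OF that]] .
    have "continuous_on W D"
      using W(3) by (rule continuous_on_eq) (simp add: DE)
    then have "isCont D z" using W(1,2) by (simp add: continuous_on_eq_continuous_at)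
    then show ?thesis using W(4)[OF W(2)] DE[OF W(2)] by simp
  qed
  then show ?thesis
    by (intro that[of D]) (auto intro: continuous_at_imp_continuous_on)
qed

section \<open>When the cone is continuously differentiable\<close>

lemma has_derivative_finite_closed_cover:
  fixes f :: "'a::real_normed_vector \<Rightarrow> 'b::real_normed_vector"
  assumes fin: "finite A" and ne: "A \<noteq> {}" and closed: "\<And>i. i \<in> A \<Longrightarrow> closed (S i)" and cover: "(\<Union>i\<in>A. S i) = UNIV"
    and der: "\<And>i. i \<in> A \<Longrightarrow> x \<in> S i \<Longrightarrow> (f has_derivative f') (at x within S i)"
  shows "(f has_derivative f') (at x)"
proof -
  let ?g = "\<lambda>y. (1 / norm (y - x)) *\<^sub>R (f y - (f x + f' (y - x)))"
  have "(?g \<longlongrightarrow> 0) (at x within S i)" if "i \<in> A" for i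
  proof (cases "x \<in> S i")
    case True
    then show ?thesis
      using der[OF that] by (simp add: has_derivative_within)
  next
    case False
    then have "at x within S i = bot"
      using closed[OF that] by (simp add: at_within_eq_bot_iff closed_limpt islimpt_def)
    then show ?thesis by simp
  qed
  with fin have "(?g \<longlongrightarrow> 0) (at x within (\<Union>i\<in>A. S i))"
    by (induction A rule: finite_induct) (auto intro!: Lim_Un)
  moreover obtain i where "i \<in> A" "x \<in> S i"
    using cover by blast
  then have "bounded_linear f'"
    using der by (intro has_derivative_bounded_linear)
  ultimately show ?thesis
    unfolding cover by (simp add: has_derivative_within)
qed

context arc_family
begin

lemma closed_sectors_cover:
  assumes fin: "finite \<I>" and ne: "\<I> \<noteq> {}" and cl: "closure (\<Union>\<I>) = sphere 0 1"
  shows "(\<Union>I\<in>\<I>. {z. wedge I z \<ge> 0}) = UNIV"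
proof (intro equalityI subsetI UNIV_I)
  fix z :: plane
  show "z \<in> (\<Union>I\<in>\<I>. {z. wedge I z \<ge> 0})"
  proof (cases "z = 0")
    case True
    then show ?thesis using ne by (auto simp: wedge_def along_across_linear)
  next
    case False
    have "closed {z. wedge I z \<ge> 0}" for I
      by (intro closed_Collect_le continuous_intros continuous_on_id)
    then have "closure (\<Union>\<I>) \<subseteq> (\<Union>I\<in>\<I>. {z. wedge I z \<ge> 0})"
      using arc_iff_wedge[OF arc] fin by (intro closure_minimal closed_UN) (auto intro: less_imp_le)
    moreover have "(1 / norm z) *\<^sub>R z \<in> closure (\<Union>\<I>)"
      using False cl by simp
    ultimately obtain I where I: "I \<in> \<I>" "wedge I ((1 / norm z) *\<^sub>R z) \<ge> 0" by blast
    then have "wedge I z \<ge> 0"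
      using False by (simp add: wedge_scale zero_le_divide_iff)
    then show ?thesis using I(1) by blast
  qed
qed

text \<open>The finitely many closed sectors cover the plane, on each of them \<open>u\<close> agrees with a \<open>C\<^sup>1\<close> function, and on common
  boundary half-lines the gradients agree.\<close>

lemma C1_surface_of_full_closure:
  assumes fin: "finite \<I>" and ne: "\<I> \<noteq> {}" and cl: "closure (\<Union>\<I>) = sphere 0 1"
  shows "C1_surface (C_surface \<I>)"
proof -
  define D where "D z = (if \<exists>I\<in>\<I>. wedge I z > 0 then grad_family \<I> z else rot90 z)" for z
  have on_sector: "D z = grad_sector I z" "u_family \<I> z = u_sector I z" if I: "I \<in> \<I>" and z: "wedge I z \<ge> 0" for I z
  proof -
    have "D z = grad_sector I z \<and> u_family \<I> z = u_sector I z"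
    proof (cases "wedge I z > 0")
      case True
      then show ?thesis using I u_family_in by (auto simp: D_def)
    next
      case False
      then have 0: "wedge I z = 0" using z by simp
      have none: "\<not> wedge J z > 0" if "J \<in> \<I>" for J
        using wedge_unique[OF that _ I z] 0 by force
      then have "\<not> (\<exists>J\<in>\<I>. wedge J z > 0)" by blast
      then have "D z = rot90 z" unfolding D_def by (rule if_not_P)
      moreover have "u_family \<I> z = 0"
        using none by (intro u_family_out(1)) (simp add: not_less)
      ultimately show ?thesis
        using grad_boundary[OF arc[OF I] 0] u_sector_boundary[OF arc[OF I] 0] by simp
    qed
    then show "D z = grad_sector I z" "u_family \<I> z = u_sector I z" by simp_all
  qed
  note cover = closed_sectors_cover[OF assms]
  have closed: "closed {z. wedge I z \<ge> 0}" for I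
    by (intro closed_Collect_le continuous_intros continuous_on_id)
  have "continuous_on (\<Union>I\<in>\<I>. {z. wedge I z \<ge> 0}) D"
  proof (intro continuous_on_closed_Union fin closed)
    show "continuous_on {z. wedge I z \<ge> 0} D" if "I \<in> \<I>" for I
      using continuous_grad_sector by (rule continuous_on_eq) (simp add: on_sector(1)[OF that])
  qed
  then have "continuous_on UNIV D" unfolding cover .
  moreover have "(u_family \<I> has_derivative (\<lambda>h. D z \<bullet> h)) (at z)" for z
  proof (rule has_derivative_finite_closed_cover[OF fin ne closed cover])
    fix I assume I: "I \<in> \<I>" "z \<in> {z. wedge I z \<ge> 0}"
    have "(u_sector I has_derivative (\<lambda>h. D z \<bullet> h)) (at z within {z. wedge I z \<ge> 0})"
      using has_derivative_at_withinI[OF u_sector_has_derivative] on_sector(1)[OF I(1)] I(2) by simp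
    then show "(u_family \<I> has_derivative (\<lambda>h. D z \<bullet> h)) (at z within {z. wedge I z \<ge> 0})"
      by (rule has_derivative_transform[rotated 2]) (use I on_sector(2)[OF I(1)] in auto)
  qed
  ultimately show ?thesis
    unfolding C_surface_eq by (intro C1_surface_graphI)
qed

lemma gradient_on_sector:
  assumes D: "continuous_on UNIV D" "\<And>z. (u_family \<I> has_derivative (\<lambda>h. D z \<bullet> h)) (at z)"
    and I: "I \<in> \<I>" "wedge I z \<ge> 0"
  shows "D z = grad_sector I z"
proof -
  have inside: "D w = grad_sector I w" if "wedge I w > 0" for w
  proof -
    have "(\<lambda>h. D w \<bullet> h) = (\<lambda>h. grad_sector I w \<bullet> h)"
      using has_derivative_unique[OF D(2) u_family_has_derivative_in[OF I(1) that]] .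
    then show ?thesis by (metis vector_eq_rdot inner_commute)
  qed
  define w where "w n = z + (1 / real (Suc n)) *\<^sub>R arc_axis I" for n
  have "w \<longlonglongrightarrow> z + 0 *\<^sub>R arc_axis I"
    unfolding w_def by (intro tendsto_intros LIMSEQ_Suc[OF lim_1_over_n])
  then have w: "w \<longlonglongrightarrow> z" by simp
  have "wedge I (w n) = wedge I z + (1 / real (Suc n)) * sin (arc_half_angle I)" for n
    by (simp add: w_def wedge_def along_across_linear algebra_simps)
  then have "wedge I (w n) > 0" for n
    using I arc_half_angle(4)[OF arc[OF I(1)]] by (simp add: add_nonneg_pos)
  then have eq: "D (w n) = grad_sector I (w n)" for n by (rule inside)
  have c: "isCont D z" "isCont (grad_sector I) z"
    using D(1) continuous_grad_sector[of UNIV I] unfolding continuous_on_eq_continuous_at[OF open_UNIV] by blast+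
  have "(\<lambda>n. D (w n)) \<longlonglongrightarrow> D z" "(\<lambda>n. grad_sector I (w n)) \<longlonglongrightarrow> grad_sector I z"
    by (rule isCont_tendsto_compose[OF c(1) w], rule isCont_tendsto_compose[OF c(2) w])
  then show ?thesis unfolding eq by (metis LIMSEQ_unique)
qed

text \<open>The segment from \<open>q\<close> to \<open>b\<close> crosses the boundary of the sector over \<open>I\<close>, where the gradient is \<open>rot90 z\<close>; let \<open>b\<close> tend to \<open>q\<close>.\<close>

lemma angular_derivative_limit:
  assumes D: "continuous_on UNIV D" "\<And>z. (u_family \<I> has_derivative (\<lambda>h. D z \<bullet> h)) (at z)"
    and near: "\<And>\<epsilon>. \<epsilon> > 0 \<Longrightarrow> \<exists>I\<in>\<I>. \<exists>b. dist b q < \<epsilon> \<and> wedge I q \<le> 0 \<and> wedge I b \<ge> 0"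
  shows "D q \<bullet> rot90 q = (norm q)\<^sup>2"
proof -
  let ?Z = "{z. D z \<bullet> rot90 z = (norm z)\<^sup>2}"
  have "closed ?Z"
    by (intro closed_Collect_eq continuous_intros D(1) continuous_on_id)
  moreover have "q \<in> closure ?Z"
    unfolding closure_approachable
  proof (intro allI impI)
    fix \<epsilon> :: real assume "\<epsilon> > 0"
    then obtain I b where I: "I \<in> \<I>" and b: "dist b q < \<epsilon>" "wedge I q \<le> 0" "wedge I b \<ge> 0"
      using near by blast
    have "\<exists>t\<ge>0. t \<le> 1 \<and> wedge I (q + t *\<^sub>R (b - q)) = 0"
    proof (rule IVT')
      show "continuous_on {0..1} (\<lambda>t. wedge I (q + t *\<^sub>R (b - q)))"
        by (intro continuous_intros)
    qed (use b in auto)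
    then obtain t where t: "0 \<le> t" "t \<le> 1" "wedge I (q + t *\<^sub>R (b - q)) = 0" by blast
    let ?z = "q + t *\<^sub>R (b - q)"
    have "D ?z = rot90 ?z"
      using gradient_on_sector[OF D I, of ?z] grad_boundary[OF arc[OF I] t(3)] t(3) by simp
    then have "?z \<in> ?Z" by (simp add: dot_square_norm)
    moreover have "dist ?z q < \<epsilon>"
    proof -
      have "dist ?z q = t * dist b q" using t(1) by (simp add: dist_norm)
      also have "\<dots> \<le> 1 * dist b q" using t by (intro mult_right_mono) auto
      finally show ?thesis using b(1) by simp
    qed
    ultimately show "\<exists>z\<in>?Z. dist z q < \<epsilon>" by blast
  qed
  ultimately have "q \<in> ?Z" by simp
  then show ?thesis by simp
qed

text \<open>The angular derivative of \<open>u\<close> on the unit circle is \<open>- 1\<close> at the centre of each arc and \<open>1\<close> at its endpoints. At an accumulation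
  point of centres a continuous gradient would have to realize both values.\<close>

lemma finite_of_C1:
  assumes D: "continuous_on UNIV D" "\<And>z. (u_family \<I> has_derivative (\<lambda>h. D z \<bullet> h)) (at z)"
  shows "finite \<I>"
proof (rule ccontr)
  assume infin: "infinite \<I>"
  have "inj_on arc_axis \<I>"
  proof (rule inj_onI)
    fix I J assume "I \<in> \<I>" "J \<in> \<I>" "arc_axis I = arc_axis J"
    then show "I = J"
      using wedge_unique[of I "arc_axis I" J] wedge_axis_pos arc by (metis less_imp_le)
  qed
  then have "infinite (arc_axis ` \<I>)" using infin finite_imageD by blast
  moreover have "arc_axis ` \<I> \<subseteq> sphere 0 1" by auto
  ultimately obtain q where q: "q \<in> sphere 0 1" "q islimpt (arc_axis ` \<I>)"
    using compact_sphere[of "0 :: plane" 1] unfolding compact_eq_Bolzano_Weierstrass by blast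
  have "D q \<bullet> rot90 q = (norm q)\<^sup>2"
  proof (rule angular_derivative_limit[OF D])
    fix \<epsilon> :: real assume "\<epsilon> > 0"
    then have infb: "infinite (arc_axis ` \<I> \<inter> ball q \<epsilon>)"
      using q(2) by (simp add: islimpt_eq_infinite_ball)
    have "\<exists>I\<in>\<I>. arc_axis I \<in> ball q \<epsilon> \<and> wedge I q \<le> 0"
    proof (rule ccontr)
      assume "\<not> (\<exists>I\<in>\<I>. arc_axis I \<in> ball q \<epsilon> \<and> wedge I q \<le> 0)"
      then have sub: "arc_axis ` \<I> \<inter> ball q \<epsilon> \<subseteq> arc_axis ` {I \<in> \<I>. wedge I q > 0}"
        by (auto simp: not_le)
      have "finite {I \<in> \<I>. wedge I q > 0}"
      proof (cases "{I \<in> \<I>. wedge I q > 0} = {}")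
        case True
        then show ?thesis by (simp only: finite.emptyI)
      next
        case False
        then obtain I0 where "I0 \<in> \<I>" "wedge I0 q > 0" by blast
        then have "J = I0" if "J \<in> \<I>" "wedge J q > 0" for J
          using wedge_unique[of J q I0] that by simp
        then have "{I \<in> \<I>. wedge I q > 0} \<subseteq> {I0}" by blast
        then show ?thesis by (rule finite_subset) simp
      qed
      then show False using infb finite_subset[OF sub] by blast
    qed
    then obtain I where I: "I \<in> \<I>" "arc_axis I \<in> ball q \<epsilon>" "wedge I q \<le> 0" by blast
    then show "\<exists>I\<in>\<I>. \<exists>b. dist b q < \<epsilon> \<and> wedge I q \<le> 0 \<and> wedge I b \<ge> 0"
      using wedge_axis_pos[OF arc[OF I(1)]] by (intro bexI[of _ I] exI[of _ "arc_axis I"]) (auto simp: dist_commute)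
  qed
  moreover have "D q \<bullet> rot90 q = - 1"
  proof -
    let ?Z = "{z. D z \<bullet> rot90 z = - 1}"
    have "D (arc_axis I) \<bullet> rot90 (arc_axis I) = - 1" if "I \<in> \<I>" for I
    proof -
      have "D (arc_axis I) = grad_sector I (arc_axis I)"
        using wedge_axis_pos[OF arc[OF that]] by (intro gradient_on_sector[OF D that]) simp
      then show ?thesis by (simp add: grad_sector_def dot_square_norm)
    qed
    then have "arc_axis ` \<I> \<subseteq> ?Z" by auto
    then have "q islimpt ?Z" using q(2) islimpt_subset by blast
    moreover have "closed ?Z"
      by (intro closed_Collect_eq continuous_intros D(1) continuous_on_id)
    ultimately show ?thesis unfolding closed_limpt by blast
  qed
  ultimately show False using q(1) by simp
qed

text \<open>At a boundary point of the closure of the sectors, the gradient is a limit of gradients in a gap, hence zero, while its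
  angular component is 1 by approximation from the sectors.\<close>

lemma full_closure_of_C1:
  assumes D: "continuous_on UNIV D" "\<And>z. (u_family \<I> has_derivative (\<lambda>h. D z \<bullet> h)) (at z)"
    and ne: "\<I> \<noteq> {}"
  shows "closure (\<Union>\<I>) = sphere 0 1"
proof (rule equalityI)
  show "closure (\<Union>\<I>) \<subseteq> sphere 0 1"
    using arc_iff_wedge arc by (intro closure_minimal) auto
  define O1 where "O1 = (\<Union>I\<in>\<I>. {z. wedge I z > 0})"
  define T where "T = closure O1"
  have opO: "open O1"
    unfolding O1_def by (intro open_UN ballI open_Collect_less continuous_intros continuous_on_id)
  have "sphere 0 1 \<subseteq> T"
  proof (rule ccontr)
    assume "\<not> sphere 0 1 \<subseteq> T"
    then have "sphere 0 1 - T \<noteq> {}" by blast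
    moreover have "sphere 0 1 \<inter> T \<noteq> {}"
    proof -
      obtain I where "I \<in> \<I>" using ne by blast
      then have "arc_axis I \<in> O1" using wedge_axis_pos arc by (auto simp: O1_def)
      then have "arc_axis I \<in> sphere 0 1 \<inter> T"
        using closure_subset[of O1] by (auto simp: T_def)
      then show ?thesis by blast
    qed
    moreover have "connected (sphere (0 :: plane) 1)"
      by (rule connected_sphere) simp
    ultimately have "sphere 0 1 \<inter> frontier T \<noteq> {}"
      by (intro connected_Int_frontier)
    then obtain q where q: "norm q = 1" "q \<in> frontier T" by auto
    have qT: "q \<in> T" "q \<notin> interior T"
      using q(2) by (auto simp: frontier_def T_def)
    have "O1 \<subseteq> interior T"
      using opO closure_subset[of O1] by (intro interior_maximal) (auto simp: T_def)
    then have out: "wedge I q \<le> 0" if "I \<in> \<I>" for I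
      using qT(2) that by (force simp: O1_def)
    have "D q \<bullet> rot90 q = (norm q)\<^sup>2"
    proof (rule angular_derivative_limit[OF D])
      fix \<epsilon> :: real assume "\<epsilon> > 0"
      then obtain b where b: "b \<in> O1" "dist b q < \<epsilon>"
        using qT(1) unfolding T_def closure_approachable by blast
      then obtain I where "I \<in> \<I>" "wedge I b > 0" by (auto simp: O1_def)
      then show "\<exists>I\<in>\<I>. \<exists>b. dist b q < \<epsilon> \<and> wedge I q \<le> 0 \<and> wedge I b \<ge> 0"
        using b(2) out by (intro bexI[of _ I] exI[of _ b]) auto
    qed
    moreover have "D q = 0"
    proof -
      have "D z = 0" if z: "z \<in> - T" for z
      proof -
        have zero: "u_family \<I> w = 0" if "w \<in> - T" for w
          using that closure_subset[of O1] by (intro u_family_out(1)) (force simp: T_def O1_def)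
        have "open (- T)" by (simp add: T_def open_Compl)
        then have "((\<lambda>_. 0) has_derivative (\<lambda>h. D z \<bullet> h)) (at z)"
          by (rule has_derivative_transform_within_open[OF D(2) _ z]) (rule zero)
        then have "(\<lambda>h. D z \<bullet> h) = (\<lambda>h. 0)"
          by (rule has_derivative_unique[OF _ has_derivative_const])
        then have "D z \<bullet> D z = 0" by metis
        then show ?thesis by simp
      qed
      then have "- T \<subseteq> {z. D z = 0}" by blast
      moreover have "closed {z. D z = 0}"
        by (intro closed_Collect_eq D(1) continuous_on_const)
      ultimately have "closure (- T) \<subseteq> {z. D z = 0}" by (rule closure_minimal)
      then show ?thesis using qT(2) by (auto simp: closure_complement)
    qed
    ultimately show False using q(1) by simp
  qed
  moreover have "v \<in> closure (\<Union>\<I>)" if v: "v \<in> T" "norm v = 1" for v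
  proof -
    obtain x where x: "\<And>n. x n \<in> O1" "x \<longlonglongrightarrow> v"
      using v(1) unfolding T_def closure_sequential by blast
    have "(\<lambda>n. (1 / norm (x n)) *\<^sub>R x n) \<longlonglongrightarrow> (1 / norm v) *\<^sub>R v"
      using v(2) by (intro tendsto_intros x(2)) auto
    moreover have "(1 / norm (x n)) *\<^sub>R x n \<in> \<Union>\<I>" for n
    proof -
      obtain I where "I \<in> \<I>" "wedge I (x n) > 0" using x(1)[of n] by (auto simp: O1_def)
      then show ?thesis using arc_point_of_wedge_pos[OF arc] by blast
    qed
    ultimately show ?thesis
      unfolding closure_sequential using v(2) by (intro exI[of _ "\<lambda>n. (1 / norm (x n)) *\<^sub>R x n"]) simp
  qed
  ultimately show "sphere 0 1 \<subseteq> closure (\<Union>\<I>)" by auto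
qed

end

theorem theorem1p1:
  fixes \<I> :: "(real \<times> real) set set"
  assumes "\<I> \<noteq> {}"
    and "countable \<I>"
    and "\<And>I. I \<in> \<I> \<Longrightarrow> proper_open_arc I"
    and "pairwise disjnt \<I>"
  shows "minimal_cone (C_surface \<I>) \<and>
    (C1_surface (C_surface \<I>) \<longleftrightarrow> finite \<I> \<and> closure (\<Union>\<I>) = sphere 0 1)"
proof -
  interpret arc_family \<I>
    using assms(3,4) by unfold_locales
  have "finite \<I> \<and> closure (\<Union>\<I>) = sphere 0 1" if surf: "C1_surface (C_surface \<I>)"
  proof -
    obtain D where D: "continuous_on UNIV D" "\<And>z. (u_family \<I> has_derivative (\<lambda>h. D z \<bullet> h)) (at z)"
      by (rule C1_surface_graphD[OF locally_lipschitz_u_family surf[unfolded C_surface_eq]], rule that)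
    show ?thesis
      using finite_of_C1[OF D] full_closure_of_C1[OF D assms(1)] by blast
  qed
  then show ?thesis
    using minimal_cone_C_surface[OF assms(1,2)] C1_surface_of_full_closure assms(1) by blast
qed

end
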